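(* Let $\mathbb F$ be a field of characteristic zero, let $n\geq 1$ and $k\geq 1$, and let $Z_{n,k}$ be the degree-$k$ homogeneous component of the center $Z_n$ of the universal enveloping algebra of the standard filiform Lie algebra $\mathfrak g(n+2)$ over $\mathbb F$. Then the following are true: (1) $\dim Z_{n,k}$ coincides with the number of irreducible components of the $\mathfrak{sl}_2$-module $S^k(U_n)$, where $U_n$ is the $(n+1)$-dimensional irreducible representation of $\mathfrak{sl}_2$ over $\mathbb F$ and $S^k$ is the $k$-th symmetric power. (2) $\dim Z_{n,k}$ is equal to the number of partitions of $\lfloor kn/2\rfloor$ into $k$ blocks each of size at most $n$ (permitting block size zero). (3) $\dim Z_{n,k}=\dim Z_{k,n}$.
   Context: The standard filiform Lie algebra $\mathfrak g(n+2)$ over $\mathbb F$ has basis $x,y_0,y_1,\ldots,y_n$ and nonzero brackets $[x,y_i]=y_{i-1}$ for $1\leq i\leq n$. By the Poincaré–Birkhoff–Witt Theorem the polynomial algebra $\mathbb F[y_0,\ldots,y_n]$ is a subalgebra of $U(\mathfrak g(n+2))$. In characteristic zero, $Z_n$, the center of $U(\mathfrak g(n+2))$, is viewed as a graded subalgebra (with respect to polynomial degree) of $\mathbb F[y_0,\ldots,y_n]$, namely the set of $f$ with $\sum_{i=0}^{n-1}y_i\,\partial f/\partial y_{i+1}=0$. $Z_{n,k}$ is its component consisting of homogeneous polynomials of degree $k$ (together with $0$). The number of irreducible components of a finite-dimensional $\mathfrak{sl}_2$-module is the number of summands in a decomposition into a direct sum of irreducible submodules. *)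

theory Defs
  imports Complex_Main "HOL-Library.Poly_Mapping" "HOL-Library.Multiset" "HOL-Library.FuncSet"
begin

section \<open>Vector spaces of finitely supported functions\<close>

text \<open>All vector spaces below are subspaces of \<open>'b \<Rightarrow>\<^sub>0 'a\<close>, the vector space over \<open>'a\<close> with
  basis \<open>Poly_Mapping.single b 1\<close>, where \<open>b\<close> ranges over the type \<open>'b\<close>.\<close>

definition pm_scale :: "'a::field \<Rightarrow> ('b \<Rightarrow>\<^sub>0 'a) \<Rightarrow> ('b \<Rightarrow>\<^sub>0 'a)" where
  "pm_scale c = Poly_Mapping.map ((*) c)"

lemma lookup_pm_scale [simp]:
  "Poly_Mapping.lookup (pm_scale c v) b = c * Poly_Mapping.lookup v b"
  by (simp add: pm_scale_def Poly_Mapping.map.rep_eq when_def)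

interpretation pm: vector_space pm_scale
  by unfold_locales (auto intro!: poly_mapping_eqI simp: lookup_add algebra_simps)

definition lin_ext :: "('b \<Rightarrow> ('c \<Rightarrow>\<^sub>0 'a)) \<Rightarrow> ('b \<Rightarrow>\<^sub>0 'a::field) \<Rightarrow> ('c \<Rightarrow>\<^sub>0 'a)" where
  "lin_ext \<phi> v = (\<Sum>b\<in>Poly_Mapping.keys v. pm_scale (Poly_Mapping.lookup v b) (\<phi> b))"

lemma lin_ext_superset:
  assumes "finite A" "Poly_Mapping.keys v \<subseteq> A"
  shows "lin_ext \<phi> v = (\<Sum>b\<in>A. pm_scale (Poly_Mapping.lookup v b) (\<phi> b))"
  unfolding lin_ext_def using assms
  by (intro sum.mono_neutral_left) (auto simp: in_keys_iff)

lemma lin_ext_single [simp]: "lin_ext \<phi> (Poly_Mapping.single b c) = pm_scale c (\<phi> b)"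
  by (subst lin_ext_superset[of "{b}"]) auto

lemma lin_ext_add: "lin_ext \<phi> (u + v) = lin_ext \<phi> u + lin_ext \<phi> v"
proof -
  let ?A = "Poly_Mapping.keys u \<union> Poly_Mapping.keys v"
  have "Poly_Mapping.keys (u + v) \<subseteq> ?A" by (rule Poly_Mapping.keys_add)
  then show ?thesis
    by (simp add: lin_ext_superset[of ?A] lookup_add pm.scale_left_distrib sum.distrib)
qed

lemma lin_ext_scale: "lin_ext \<phi> (pm_scale c v) = pm_scale c (lin_ext \<phi> v)"
proof -
  have "Poly_Mapping.keys (pm_scale c v) \<subseteq> Poly_Mapping.keys v" by (auto simp: in_keys_iff)
  then show ?thesis
    by (simp add: lin_ext_superset[of "Poly_Mapping.keys v"] pm.scale_sum_right)
qed

lemma linear_lin_ext: "Vector_Spaces.linear pm_scale pm_scale (lin_ext \<phi>)"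
  by unfold_locales (auto simp: lin_ext_add lin_ext_scale)


section \<open>Universal enveloping algebras\<close>

definition lie_algebra ::
    "('b \<Rightarrow>\<^sub>0 'a::field) set \<Rightarrow> (('b \<Rightarrow>\<^sub>0 'a) \<Rightarrow> ('b \<Rightarrow>\<^sub>0 'a) \<Rightarrow> ('b \<Rightarrow>\<^sub>0 'a)) \<Rightarrow> bool" where
  "lie_algebra L br \<longleftrightarrow>
     pm.subspace L \<and>
     (\<forall>u\<in>L. \<forall>v\<in>L. br u v \<in> L) \<and>
     (\<forall>u\<in>L. \<forall>v\<in>L. \<forall>w\<in>L. br (u + v) w = br u w + br v w \<and> br w (u + v) = br w u + br w v) \<and>
     (\<forall>c. \<forall>u\<in>L. \<forall>v\<in>L. br (pm_scale c u) v = pm_scale c (br u v) \<and>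
                        br u (pm_scale c v) = pm_scale c (br u v)) \<and>
     (\<forall>u\<in>L. br u u = 0) \<and>
     (\<forall>u\<in>L. \<forall>v\<in>L. \<forall>w\<in>L. br u (br v w) + br v (br w u) + br w (br u v) = 0)"

text \<open>Words under concatenation, so that \<open>'g free_monoid \<Rightarrow>\<^sub>0 'a\<close>, with the convolution product of
  \<^theory>\<open>HOL-Library.Poly_Mapping\<close>, is the free associative unital algebra on \<open>'g\<close>.\<close>

datatype 'g free_monoid = Word (letters: "'g list")

instantiation free_monoid :: (type) monoid_add
begin
definition zero_free_monoid :: "'a free_monoid" where "0 = Word []"
definition plus_free_monoid :: "'a free_monoid \<Rightarrow> 'a free_monoid \<Rightarrow> 'a free_monoid" where
  "v + w = Word (letters v @ letters w)"
instance by standard (auto simp: zero_free_monoid_def plus_free_monoid_def)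
end

definition free_alg :: "'g set \<Rightarrow> ('g free_monoid \<Rightarrow>\<^sub>0 'a::field) set" where
  "free_alg G = {a. \<forall>w\<in>Poly_Mapping.keys a. set (letters w) \<subseteq> G}"

definition letter :: "'g \<Rightarrow> ('g free_monoid \<Rightarrow>\<^sub>0 'a::field)" where
  "letter u = Poly_Mapping.single (Word [u]) 1"

text \<open>The generators of the free algebra are all elements of the Lie algebra \<open>L\<close>, not just a basis.
  The first two families of relations turn the free algebra into the tensor algebra of \<open>L\<close>, and the
  third one turns the tensor algebra into \<open>U(L)\<close>.\<close>

inductive_set ue_relations for L :: "('b \<Rightarrow>\<^sub>0 'a::field) set"
    and br :: "('b \<Rightarrow>\<^sub>0 'a) \<Rightarrow> ('b \<Rightarrow>\<^sub>0 'a) \<Rightarrow> ('b \<Rightarrow>\<^sub>0 'a)" where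
  "u \<in> L \<Longrightarrow> v \<in> L \<Longrightarrow> letter (u + v) - letter u - letter v \<in> ue_relations L br"
| "u \<in> L \<Longrightarrow> letter (pm_scale c u) - pm_scale c (letter u) \<in> ue_relations L br"
| "u \<in> L \<Longrightarrow> v \<in> L \<Longrightarrow>
     letter u * letter v - letter v * letter u - letter (br u v) \<in> ue_relations L br"

definition ue_ideal :: "('b \<Rightarrow>\<^sub>0 'a::field) set \<Rightarrow> (('b \<Rightarrow>\<^sub>0 'a) \<Rightarrow> ('b \<Rightarrow>\<^sub>0 'a) \<Rightarrow> ('b \<Rightarrow>\<^sub>0 'a)) \<Rightarrow>
    (('b \<Rightarrow>\<^sub>0 'a) free_monoid \<Rightarrow>\<^sub>0 'a) set" where
  "ue_ideal L br =
     pm.span {a * r * b | a r b. a \<in> free_alg L \<and> r \<in> ue_relations L br \<and> b \<in> free_alg L}"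

text \<open>\<open>U(L)\<close> is \<open>free_alg L\<close> modulo the two-sided ideal \<open>ue_ideal L br\<close>. Elements of \<open>U(L)\<close> are
  handled through representatives: \<open>ue_center L br\<close> consists of all representatives of elements
  of the center of \<open>U(L)\<close>.\<close>

definition ue_center :: "('b \<Rightarrow>\<^sub>0 'a::field) set \<Rightarrow> (('b \<Rightarrow>\<^sub>0 'a) \<Rightarrow> ('b \<Rightarrow>\<^sub>0 'a) \<Rightarrow> ('b \<Rightarrow>\<^sub>0 'a)) \<Rightarrow>
    (('b \<Rightarrow>\<^sub>0 'a) free_monoid \<Rightarrow>\<^sub>0 'a) set" where
  "ue_center L br = {a \<in> free_alg L. \<forall>b\<in>free_alg L. a * b - b * a \<in> ue_ideal L br}"


section \<open>Polynomials\<close>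

text \<open>The monomial \<open>m\<close> stands for the product of the \<open>y\<^sub>i ^ lookup m i\<close>.\<close>

type_synonym 'a mpoly = "(nat \<Rightarrow>\<^sub>0 nat) \<Rightarrow>\<^sub>0 'a"

definition pvar :: "nat \<Rightarrow> 'a::field mpoly" where
  "pvar i = Poly_Mapping.single (Poly_Mapping.single i 1) 1"

definition mon_degree :: "(nat \<Rightarrow>\<^sub>0 nat) \<Rightarrow> nat" where
  "mon_degree m = (\<Sum>i\<in>Poly_Mapping.keys m. Poly_Mapping.lookup m i)"

text \<open>\<open>polys n\<close> is the polynomial ring in the \<open>n + 1\<close> variables \<open>y\<^sub>0, \<dots>, y\<^sub>n\<close>.\<close>

definition polys :: "nat \<Rightarrow> 'a::field mpoly set" where
  "polys n = {p. \<forall>m\<in>Poly_Mapping.keys p. Poly_Mapping.keys m \<subseteq> {..n}}"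

definition hom_polys :: "nat \<Rightarrow> nat \<Rightarrow> 'a::field mpoly set" where
  "hom_polys n k = {p \<in> polys n. \<forall>m\<in>Poly_Mapping.keys p. mon_degree m = k}"

definition pdiff :: "nat \<Rightarrow> 'a::field mpoly \<Rightarrow> 'a mpoly" where
  "pdiff i = lin_ext (\<lambda>m. Poly_Mapping.single (m - Poly_Mapping.single i 1)
                            (of_nat (Poly_Mapping.lookup m i)))"


section \<open>The standard filiform Lie algebra and the center of its enveloping algebra\<close>

datatype filiform_basis = gen_x | gen_y nat

fun filiform_basis_bracket ::
    "filiform_basis \<Rightarrow> filiform_basis \<Rightarrow> (filiform_basis \<Rightarrow>\<^sub>0 'a::field)" where
  "filiform_basis_bracket gen_x (gen_y (Suc i)) = Poly_Mapping.single (gen_y i) 1"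
| "filiform_basis_bracket (gen_y (Suc i)) gen_x = - Poly_Mapping.single (gen_y i) 1"
| "filiform_basis_bracket _ _ = 0"

definition filiform_bracket ::
    "(filiform_basis \<Rightarrow>\<^sub>0 'a::field) \<Rightarrow> (filiform_basis \<Rightarrow>\<^sub>0 'a) \<Rightarrow> (filiform_basis \<Rightarrow>\<^sub>0 'a)" where
  "filiform_bracket u v = lin_ext (\<lambda>a. lin_ext (filiform_basis_bracket a) v) u"

text \<open>\<open>filiform n\<close> is the \<open>(n + 2)\<close>-dimensional Lie algebra \<open>\<gg>(n + 2)\<close>, with basis
  \<open>x, y\<^sub>0, \<dots>, y\<^sub>n\<close>.\<close>

definition filiform :: "nat \<Rightarrow> (filiform_basis \<Rightarrow>\<^sub>0 'a::field) set" where
  "filiform n = {u. Poly_Mapping.keys u \<subseteq> insert gen_x (gen_y ` {..n})}"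

text \<open>The embedding of the polynomial ring in \<open>y\<^sub>0, \<dots>, y\<^sub>n\<close> into \<open>U(\<gg>(n + 2))\<close>, on
  representatives. The order of the factors of a monomial is immaterial modulo the ideal, since the
  \<open>y\<^sub>i\<close> commute.\<close>

definition poly_to_ue :: "nat \<Rightarrow> 'a::field mpoly \<Rightarrow> ((filiform_basis \<Rightarrow>\<^sub>0 'a) free_monoid \<Rightarrow>\<^sub>0 'a)" where
  "poly_to_ue n = lin_ext (\<lambda>m. Poly_Mapping.single
     (Word (concat (map (\<lambda>i. replicate (Poly_Mapping.lookup m i) (Poly_Mapping.single (gen_y i) 1))
                        [0..<Suc n]))) 1)"

text \<open>\<open>filiform_center n\<close> is the center of \<open>U(\<gg>(n + 2))\<close>, viewed inside the polynomial ring in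
  \<open>y\<^sub>0, \<dots>, y\<^sub>n\<close>. Theorem \<open>filiform_center_eq\<close> below describes it as the kernel of
  \<open>\<Sum>i<n. y\<^sub>i * \<partial>/\<partial>y\<^sub>i\<^sub>+\<^sub>1\<close>.\<close>

definition filiform_center :: "nat \<Rightarrow> 'a::field mpoly set" where
  "filiform_center n = {p \<in> polys n. poly_to_ue n p \<in> ue_center (filiform n) filiform_bracket}"

definition filiform_center_hom :: "nat \<Rightarrow> nat \<Rightarrow> 'a::field mpoly set" where
  "filiform_center_hom n k = filiform_center n \<inter> hom_polys n k"


section \<open>Modules over sl(2)\<close>

text \<open>A module over \<open>sl\<^sub>2\<close> is given by the actions \<open>e\<close>, \<open>h\<close>, \<open>f\<close> of the standard basis, which has
  the brackets \<open>[e, f] = h\<close>, \<open>[h, e] = 2 e\<close> and \<open>[h, f] = - 2 f\<close>.\<close>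

definition sl2_submodule :: "(('b \<Rightarrow>\<^sub>0 'a::field) \<Rightarrow> ('b \<Rightarrow>\<^sub>0 'a)) \<Rightarrow> (('b \<Rightarrow>\<^sub>0 'a) \<Rightarrow> ('b \<Rightarrow>\<^sub>0 'a)) \<Rightarrow>
    (('b \<Rightarrow>\<^sub>0 'a) \<Rightarrow> ('b \<Rightarrow>\<^sub>0 'a)) \<Rightarrow> ('b \<Rightarrow>\<^sub>0 'a) set \<Rightarrow> bool" where
  "sl2_submodule e h f W \<longleftrightarrow> pm.subspace W \<and> e ` W \<subseteq> W \<and> h ` W \<subseteq> W \<and> f ` W \<subseteq> W"

definition sl2_module :: "(('b \<Rightarrow>\<^sub>0 'a::field) \<Rightarrow> ('b \<Rightarrow>\<^sub>0 'a)) \<Rightarrow> (('b \<Rightarrow>\<^sub>0 'a) \<Rightarrow> ('b \<Rightarrow>\<^sub>0 'a)) \<Rightarrow>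
    (('b \<Rightarrow>\<^sub>0 'a) \<Rightarrow> ('b \<Rightarrow>\<^sub>0 'a)) \<Rightarrow> ('b \<Rightarrow>\<^sub>0 'a) set \<Rightarrow> bool" where
  "sl2_module e h f V \<longleftrightarrow>
     Vector_Spaces.linear pm_scale pm_scale e \<and>
     Vector_Spaces.linear pm_scale pm_scale h \<and>
     Vector_Spaces.linear pm_scale pm_scale f \<and>
     sl2_submodule e h f V \<and>
     (\<forall>v\<in>V. e (f v) - f (e v) = h v \<and>
            h (e v) - e (h v) = pm_scale 2 (e v) \<and>
            h (f v) - f (h v) = pm_scale (-2) (f v))"

definition sl2_irreducible :: "(('b \<Rightarrow>\<^sub>0 'a::field) \<Rightarrow> ('b \<Rightarrow>\<^sub>0 'a)) \<Rightarrow> (('b \<Rightarrow>\<^sub>0 'a) \<Rightarrow> ('b \<Rightarrow>\<^sub>0 'a)) \<Rightarrow>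
    (('b \<Rightarrow>\<^sub>0 'a) \<Rightarrow> ('b \<Rightarrow>\<^sub>0 'a)) \<Rightarrow> ('b \<Rightarrow>\<^sub>0 'a) set \<Rightarrow> bool" where
  "sl2_irreducible e h f W \<longleftrightarrow> sl2_submodule e h f W \<and> W \<noteq> {0} \<and>
     (\<forall>W'. sl2_submodule e h f W' \<and> W' \<subseteq> W \<longrightarrow> W' = {0} \<or> W' = W)"

text \<open>The direct sum decompositions of \<open>V\<close> into irreducible submodules. A set of submodules
  suffices, because the summands are nonzero and hence pairwise distinct.\<close>

definition sl2_decomposition :: "(('b \<Rightarrow>\<^sub>0 'a::field) \<Rightarrow> ('b \<Rightarrow>\<^sub>0 'a)) \<Rightarrow> (('b \<Rightarrow>\<^sub>0 'a) \<Rightarrow> ('b \<Rightarrow>\<^sub>0 'a)) \<Rightarrow>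
    (('b \<Rightarrow>\<^sub>0 'a) \<Rightarrow> ('b \<Rightarrow>\<^sub>0 'a)) \<Rightarrow> ('b \<Rightarrow>\<^sub>0 'a) set \<Rightarrow> ('b \<Rightarrow>\<^sub>0 'a) set set \<Rightarrow> bool" where
  "sl2_decomposition e h f V \<W> \<longleftrightarrow>
     finite \<W> \<and> (\<forall>W\<in>\<W>. W \<subseteq> V \<and> sl2_irreducible e h f W) \<and>
     (\<forall>v\<in>V. \<exists>!g. g \<in> (\<Pi>\<^sub>E W\<in>\<W>. W) \<and> v = (\<Sum>W\<in>\<W>. g W))"

text \<open>\<open>U_space n\<close>, with \<open>U_e n\<close>, \<open>U_h n\<close> and \<open>U_f n\<close>, is the irreducible module \<open>U\<^sub>n\<close> of dimension \<open>n + 1\<close>, on the basis \<open>u\<^sub>0, \<dots>, u\<^sub>n\<close> of weight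
  vectors, where \<open>u\<^sub>0\<close> is the highest weight vector and \<open>u\<^sub>i\<close> is \<open>f ^ i u\<^sub>0 / i!\<close>.\<close>

definition U_space :: "nat \<Rightarrow> (nat \<Rightarrow>\<^sub>0 'a::field) set" where
  "U_space n = {v. Poly_Mapping.keys v \<subseteq> {..n}}"

definition U_e :: "nat \<Rightarrow> (nat \<Rightarrow>\<^sub>0 'a::field) \<Rightarrow> (nat \<Rightarrow>\<^sub>0 'a)" where
  "U_e n = lin_ext (\<lambda>i. if i = 0 then 0
                         else Poly_Mapping.single (i - 1) (of_nat n - of_nat i + 1))"

definition U_h :: "nat \<Rightarrow> (nat \<Rightarrow>\<^sub>0 'a::field) \<Rightarrow> (nat \<Rightarrow>\<^sub>0 'a)" where
  "U_h n = lin_ext (\<lambda>i. Poly_Mapping.single i (of_nat n - 2 * of_nat i))"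

definition U_f :: "nat \<Rightarrow> (nat \<Rightarrow>\<^sub>0 'a::field) \<Rightarrow> (nat \<Rightarrow>\<^sub>0 'a)" where
  "U_f n = lin_ext (\<lambda>i. if i < n then Poly_Mapping.single (i + 1) (of_nat i + 1) else 0)"

text \<open>The symmetric algebra of \<open>U\<^sub>n\<close> is the polynomial ring on the basis \<open>u\<^sub>0, \<dots>, u\<^sub>n\<close>, so
  \<open>S\<^sup>k(U\<^sub>n)\<close> is \<open>hom_polys n k\<close>. An element of a Lie algebra acting on \<open>U\<^sub>n\<close> by \<open>T\<close> acts on the
  symmetric algebra by the derivation that extends \<open>T\<close>.\<close>

definition lin_form :: "(nat \<Rightarrow>\<^sub>0 'a::field) \<Rightarrow> 'a mpoly" where
  "lin_form = lin_ext pvar"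

definition sym_deriv :: "nat \<Rightarrow> ((nat \<Rightarrow>\<^sub>0 'a::field) \<Rightarrow> (nat \<Rightarrow>\<^sub>0 'a)) \<Rightarrow> 'a mpoly \<Rightarrow> 'a mpoly" where
  "sym_deriv n T p = (\<Sum>i\<le>n. lin_form (T (Poly_Mapping.single i 1)) * pdiff i p)"

abbreviation sym_power_decomposition :: "nat \<Rightarrow> nat \<Rightarrow> 'a::field mpoly set set \<Rightarrow> bool" where
  "sym_power_decomposition n k \<equiv>
     sl2_decomposition (sym_deriv n (U_e n)) (sym_deriv n (U_h n)) (sym_deriv n (U_f n))
       (hom_polys n k)"

section \<open>Consistency of the definitions\<close>

subsection \<open>\<open>\<gg>(n + 2)\<close> is a Lie algebra, and \<open>U\<^sub>n\<close> is the irreducible module of dimension \<open>n + 1\<close>\<close>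

lemma lookup_lin_ext: "finite A \<Longrightarrow> Poly_Mapping.keys v \<subseteq> A \<Longrightarrow>
   Poly_Mapping.lookup (lin_ext \<phi> v) c = (\<Sum>b\<in>A. Poly_Mapping.lookup v b * Poly_Mapping.lookup (\<phi> b) c)"
  by (simp add: lin_ext_superset[of A] lookup_sum)

lemma lin_ext_id: "lin_ext (\<lambda>i. Poly_Mapping.single i 1) u = u"
proof (rule poly_mapping_eqI)
  fix k
  show "Poly_Mapping.lookup (lin_ext (\<lambda>i. Poly_Mapping.single i 1) u) k = Poly_Mapping.lookup u k"
    by (subst lookup_lin_ext[of "insert k (Poly_Mapping.keys u)"])
       (auto simp: lookup_single when_def if_distrib cong: if_cong)
qed

lemma lookup_filiform_bracket:
  "Poly_Mapping.lookup (filiform_bracket u v) b =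
     (case b of gen_x \<Rightarrow> 0 | gen_y i \<Rightarrow> Poly_Mapping.lookup u gen_x * Poly_Mapping.lookup v (gen_y (Suc i))
                              - Poly_Mapping.lookup u (gen_y (Suc i)) * Poly_Mapping.lookup v gen_x)"
proof -
  have 1: "Poly_Mapping.lookup (filiform_basis_bracket a c :: filiform_basis \<Rightarrow>\<^sub>0 'a) gen_x = 0" for a c
    by (cases "(a, c)" rule: filiform_basis_bracket.cases) (auto simp: lookup_single when_def)
  have 2: "Poly_Mapping.lookup (filiform_basis_bracket a c :: filiform_basis \<Rightarrow>\<^sub>0 'a) (gen_y i) =
      (if a = gen_x then (if c = gen_y (Suc i) then 1 else 0) else 0) - 
      (if a = gen_y (Suc i) then (if c = gen_x then 1 else 0) else 0)" for a c i
    by (cases "(a, c)" rule: filiform_basis_bracket.cases) (auto simp: lookup_single when_def)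
  define A where "A = Poly_Mapping.keys u \<union> Poly_Mapping.keys v \<union> {b, gen_x} \<union> (case b of gen_x \<Rightarrow> {} | gen_y i \<Rightarrow> {gen_y (Suc i)})"
  have A: "finite A" "Poly_Mapping.keys u \<subseteq> A" "Poly_Mapping.keys v \<subseteq> A" "gen_x \<in> A"
    by (auto simp: A_def split: filiform_basis.splits)
  have e: "Poly_Mapping.lookup (filiform_bracket u v) b = (\<Sum>a\<in>A. \<Sum>c\<in>A. Poly_Mapping.lookup u a * (Poly_Mapping.lookup v c * Poly_Mapping.lookup (filiform_basis_bracket a c) b))"
    unfolding filiform_bracket_def
    by (simp add: lookup_lin_ext[OF A(1,2)] lookup_lin_ext[OF A(1,3)] sum_distrib_left)
  show ?thesis
  proof (cases b)
    case gen_x then show ?thesis by (simp add: e[unfolded gen_x] 1)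
  next
    case (gen_y i)
    have "gen_y (Suc i) \<in> A" using gen_y by (simp add: A_def)
    have "(\<Sum>c\<in>A. Poly_Mapping.lookup u a * (Poly_Mapping.lookup v c * Poly_Mapping.lookup (filiform_basis_bracket a c) b))
     = (if a = gen_x then Poly_Mapping.lookup u a * Poly_Mapping.lookup v (gen_y (Suc i)) else 0) - 
       (if a = gen_y (Suc i) then Poly_Mapping.lookup u a * Poly_Mapping.lookup v gen_x else 0)" for a
    proof -
      have d: "(\<Sum>c\<in>A. g c * (if c = z then 1 else 0)) = g z" if "z \<in> A" for z and g :: "_ \<Rightarrow> 'a"
        using that A(1) by (simp add: if_distrib cong: if_cong)
      show ?thesis using d[of gen_x] d[of "gen_y (Suc i)"] A \<open>gen_y (Suc i) \<in> A\<close>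
        by (cases "a = gen_x"; cases "a = gen_y (Suc i)")
           (simp_all add: gen_y 2 sum_negf flip: mult.assoc)
    qed
    then show ?thesis using A(1,4) \<open>gen_y (Suc i) \<in> A\<close> unfolding gen_y by (simp add: e[unfolded gen_y] sum_subtractf)
  qed
qed

lemma lie_algebra_filiform: "lie_algebra (filiform n) (filiform_bracket :: _ \<Rightarrow> _ \<Rightarrow> (filiform_basis \<Rightarrow>\<^sub>0 'a::field))"
proof -
  have L: "u \<in> filiform n \<longleftrightarrow> (\<forall>i>n. Poly_Mapping.lookup u (gen_y i) = 0)" for u :: "filiform_basis \<Rightarrow>\<^sub>0 'a"
    unfolding filiform_def
    by (auto simp: subset_iff in_keys_iff) (metis filiform_basis.exhaust image_eqI atMost_iff not_le_imp_less)
  show ?thesis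
    unfolding lie_algebra_def pm.subspace_def
    by (auto intro!: poly_mapping_eqI simp: L lookup_filiform_bracket lookup_add algebra_simps split: filiform_basis.splits)
qed

lemma lookup_U_h [simp]:
  "Poly_Mapping.lookup (U_h n v) j = (of_nat n - 2 * of_nat j) * Poly_Mapping.lookup v j"
  unfolding U_h_def
  by (subst lookup_lin_ext[of "insert j (Poly_Mapping.keys v)"]) (auto simp: lookup_single when_def if_distrib cong: if_cong)

lemma lookup_U_e [simp]:
  "Poly_Mapping.lookup (U_e n v) j = (of_nat n - of_nat j) * Poly_Mapping.lookup v (Suc j)"
proof -
  have "Poly_Mapping.lookup (U_e n v) j = (\<Sum>i\<in>insert (Suc j) (Poly_Mapping.keys v). if i = Suc j then (of_nat n - of_nat j) * Poly_Mapping.lookup v (Suc j) else 0)"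
    unfolding U_e_def
    by (subst lookup_lin_ext[of "insert (Suc j) (Poly_Mapping.keys v)"], simp, blast, rule sum.cong)
       (auto simp: lookup_single when_def)
  then show ?thesis by simp
qed

lemma lookup_U_f [simp]:
  "Poly_Mapping.lookup (U_f n v) j = (if 0 < j \<and> j \<le> n then of_nat j * Poly_Mapping.lookup v (j - 1) else 0)"
proof -
  have "Poly_Mapping.lookup (U_f n v) j = (\<Sum>i\<in>insert (j - 1) (Poly_Mapping.keys v). if i = j - 1 then (if 0 < j \<and> j \<le> n then of_nat j * Poly_Mapping.lookup v (j - 1) else 0) else 0)"
    unfolding U_f_def
    by (subst lookup_lin_ext[of "insert (j - 1) (Poly_Mapping.keys v)"], simp, blast, rule sum.cong)
       (auto simp: lookup_single when_def mult.commute algebra_simps)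
  then show ?thesis by simp
qed

lemma in_U_space: "v \<in> U_space n \<longleftrightarrow> (\<forall>i>n. Poly_Mapping.lookup v i = 0)"
  by (auto simp: U_space_def subset_iff in_keys_iff) (use not_le_imp_less in blast)

lemma sl2_submodule_U_space: "sl2_submodule (U_e n) (U_h n) (U_f n) (U_space n)"
  by (auto simp: sl2_submodule_def pm.subspace_def in_U_space lookup_add)

lemma sl2_module_U_space: "sl2_module (U_e n) (U_h n) (U_f n) (U_space n)"
proof -
  have "U_e n (U_f n v) - U_f n (U_e n v) = U_h n v" if "v \<in> U_space n" for v
    using that 
    by (intro poly_mapping_eqI) (auto simp: lookup_minus in_U_space algebra_simps of_nat_diff not_le less_Suc_eq_le dest: antisym)
  moreover have "U_h n (U_e n v) - U_e n (U_h n v) = pm_scale 2 (U_e n v)" for v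
    by (intro poly_mapping_eqI) (auto simp: lookup_minus algebra_simps)
  moreover have "U_h n (U_f n v) - U_f n (U_h n v) = pm_scale (-2) (U_f n v)" for v
    by (intro poly_mapping_eqI) (auto simp: lookup_minus algebra_simps of_nat_diff)
  ultimately show ?thesis
    unfolding sl2_module_def
    by (auto simp: sl2_submodule_U_space) (auto simp: U_e_def U_h_def U_f_def intro: linear_lin_ext)
qed

lemma sl2_irreducible_U_space:
  "sl2_irreducible (U_e n) (U_h n) (U_f n) (U_space n :: (nat \<Rightarrow>\<^sub>0 'a::field_char_0) set)"
proof -
  have ne: "(Poly_Mapping.single 0 1 :: nat \<Rightarrow>\<^sub>0 'a) \<in> U_space n" "(Poly_Mapping.single 0 1 :: nat \<Rightarrow>\<^sub>0 'a) \<noteq> 0"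
    by (auto simp: in_U_space lookup_single simp del: single_one dest: arg_cong[where f = "\<lambda>v. Poly_Mapping.lookup v 0"])
  have "W = U_space n" if W: "sl2_submodule (U_e n) (U_h n) (U_f n) W" "W \<subseteq> U_space n" "W \<noteq> {0}"
    for W :: "(nat \<Rightarrow>\<^sub>0 'a) set"
  proof -
    have sub: "pm.subspace W" and We: "v \<in> W \<Longrightarrow> U_e n v \<in> W" and Wf: "v \<in> W \<Longrightarrow> U_f n v \<in> W" for v
      using W(1) by (auto simp: sl2_submodule_def)
    have low: "Poly_Mapping.single 0 1 \<in> W"
      if "v \<in> W" "\<forall>i>m. Poly_Mapping.lookup v i = 0" "m \<le> n" "Poly_Mapping.lookup v m \<noteq> 0" for v m
      using that
    proof (induction m arbitrary: v)
      case 0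
      have "pm_scale (inverse (Poly_Mapping.lookup v 0)) v = Poly_Mapping.single 0 1"
        using 0 by (intro poly_mapping_eqI) (auto simp: lookup_single when_def simp del: single_one)
      then show ?case using 0(1) sub by (metis pm.subspace_scale)
    next
      case (Suc m)
      have "(of_nat n :: 'a) - of_nat m \<noteq> 0" using Suc.prems(3) by auto
      then show ?case using Suc.prems We by (intro Suc.IH[of "U_e n v"]) auto
    qed
    obtain v where v: "v \<in> W" "v \<noteq> 0" using W(3) sub pm.subspace_0 by blast
    define m where "m = Max (Poly_Mapping.keys v)"
    have k: "finite (Poly_Mapping.keys v)" "Poly_Mapping.keys v \<noteq> {}" using v by auto
    have "m \<in> Poly_Mapping.keys v" using k unfolding m_def by (rule Max_in)
    moreover have "\<forall>i>m. Poly_Mapping.lookup v i = 0" unfolding m_def using Max_ge[OF k(1)]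
      by (metis in_keys_iff not_less)
    moreover have "m \<le> n" using \<open>m \<in> _\<close> v(1) W(2) by (auto simp: U_space_def)
    ultimately have 0: "Poly_Mapping.single 0 1 \<in> W" using low v by (auto simp: in_keys_iff)
    have all: "Poly_Mapping.single i 1 \<in> W" if "i \<le> n" for i
      using that
    proof (induction i)
      case (Suc i)
      have nz: "(of_nat i + 1 :: 'a) \<noteq> 0" by (metis of_nat_Suc of_nat_neq_0 add.commute)
      have "pm_scale (inverse (of_nat i + 1)) (U_f n (Poly_Mapping.single i 1)) = (Poly_Mapping.single (Suc i) 1 :: nat \<Rightarrow>\<^sub>0 'a)"
        using Suc.prems nz by (intro poly_mapping_eqI) (auto simp: lookup_single when_def field_simps)
      then show ?case using Suc sub Wf by (metis Suc_leD pm.subspace_scale)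
    qed (use 0 in simp)
    have "u \<in> W" if "u \<in> U_space n" for u
    proof -
      have "u = lin_ext (\<lambda>i. Poly_Mapping.single i 1) u" by (rule lin_ext_id[symmetric])
      also have "\<dots> \<in> W" unfolding lin_ext_def using that all sub
        by (intro pm.subspace_sum pm.subspace_scale) (auto simp: U_space_def)
      finally show ?thesis .
    qed
    then show ?thesis using W(2) by blast
  qed
  then show ?thesis unfolding sl2_irreducible_def using sl2_submodule_U_space ne by blast
qed

lemma dim_U_space: "pm.dim (U_space n :: (nat \<Rightarrow>\<^sub>0 'a::field) set) = n + 1"
proof -
  let ?s = "\<lambda>i. Poly_Mapping.single i (1::'a)"
  have inj: "inj_on ?s {..n}"
    by (rule inj_onI) (metis lookup_single_eq lookup_single_not_eq zero_neq_one)
  have "card (?s ` {..n}) = pm.dim (U_space n :: (nat \<Rightarrow>\<^sub>0 'a) set)"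
  proof (rule pm.basis_card_eq_dim)
    show "?s ` {..n} \<subseteq> U_space n" by (auto simp: in_U_space lookup_single)
    show "U_space n \<subseteq> pm.span (?s ` {..n})"
    proof
      fix u :: "nat \<Rightarrow>\<^sub>0 'a" assume u: "u \<in> U_space n"
      have "u = lin_ext ?s u" by (rule lin_ext_id[symmetric])
      also have "\<dots> \<in> pm.span (?s ` {..n})"
        unfolding lin_ext_def using u
        by (intro pm.span_sum pm.span_scale pm.span_base) (auto simp: U_space_def)
      finally show "u \<in> pm.span (?s ` {..n})" .
    qed
    show "pm.independent (?s ` {..n})"
    proof (rule pm.independent_if_scalars_zero)
      fix f x assume 0: "(\<Sum>v\<in>?s ` {..n}. pm_scale (f v) v) = 0" and "x \<in> ?s ` {..n}"
      then obtain i where i: "i \<le> n" "x = ?s i" by auto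
      have "0 = Poly_Mapping.lookup (\<Sum>j\<le>n. pm_scale (f (?s j)) (?s j)) i"
        using 0 by (simp add: sum.reindex[OF inj])
      also have "\<dots> = (\<Sum>j\<le>n. if j = i then f x else 0)"
        unfolding lookup_sum by (rule sum.cong) (auto simp: lookup_single when_def i)
      finally show "f x = 0" using i by simp
    qed simp
  qed
  then show ?thesis by (simp add: card_image[OF inj])
qed


subsection \<open>\<open>S\<^sup>k(U\<^sub>n)\<close> is a module over sl(2)\<close>

lemma pm_scale_single [simp]: "pm_scale c (Poly_Mapping.single b d) = Poly_Mapping.single b (c * d)"
  by (intro poly_mapping_eqI) (auto simp: lookup_single when_def)

lemma pm_induct [case_names single add]:
  assumes "\<And>b c. P (Poly_Mapping.single b c)" and "\<And>u v. P u \<Longrightarrow> P v \<Longrightarrow> P (u + v)"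
  shows "P (u :: 'b \<Rightarrow>\<^sub>0 'a::field)"
proof -
  have "P 0" using assms(1)[of undefined 0] by simp
  then have "P (\<Sum>b\<in>A. Poly_Mapping.single b (f b))" for A f
    by (induction A rule: infinite_finite_induct) (auto intro: assms)
  from this[of "Poly_Mapping.lookup u" "Poly_Mapping.keys u"] show ?thesis
    using lin_ext_id[of u] by (simp add: lin_ext_def)
qed

lemma pm_scale_mult_left: "pm_scale c a * b = pm_scale c (a * (b :: 'm::monoid_add \<Rightarrow>\<^sub>0 'a::field))"
  by (induction a rule: pm_induct; induction b rule: pm_induct)
     (auto simp: mult_single algebra_simps pm.scale_right_distrib)

lemma pm_scale_mult_right: "a * pm_scale c b = pm_scale c (a * (b :: 'm::monoid_add \<Rightarrow>\<^sub>0 'a::field))"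
  by (induction a rule: pm_induct; induction b rule: pm_induct)
     (auto simp: mult_single algebra_simps pm.scale_right_distrib)

lemma lin_ext_0 [simp]: "lin_ext \<phi> 0 = 0" by (simp add: lin_ext_def)

lemma lin_ext_sum: "lin_ext \<phi> (\<Sum>i\<in>A. g i) = (\<Sum>i\<in>A. lin_ext \<phi> (g i))"
  by (induction A rule: infinite_finite_induct) (auto simp: lin_ext_add)

lemma lin_ext_diff: "lin_ext \<phi> (u - v) = lin_ext \<phi> u - lin_ext \<phi> v"
  using lin_ext_add[of \<phi> "u - v" v] by simp

lemma pdiff_single [simp]: "pdiff i (Poly_Mapping.single m c) =
    Poly_Mapping.single (m - Poly_Mapping.single i 1) (c * of_nat (Poly_Mapping.lookup m i))"
  by (simp add: pdiff_def)

lemma pdiff_add: "pdiff i (p + q) = pdiff i p + pdiff i q"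
  and pdiff_diff: "pdiff i (p - q) = pdiff i p - pdiff i q"
  and pdiff_scale: "pdiff i (pm_scale c p) = pm_scale c (pdiff i p)"
  and pdiff_sum: "pdiff i (\<Sum>x\<in>A. g x) = (\<Sum>x\<in>A. pdiff i (g x))"
  by (simp_all add: pdiff_def lin_ext_add lin_ext_diff lin_ext_scale lin_ext_sum)

lemma pdiff_mult: "pdiff i (p * q) = pdiff i p * q + p * pdiff i q"
proof (induction p rule: pm_induct)
  case (single m c)
  show ?case
  proof (induction q rule: pm_induct)
    case (single m' c')
    have 1: "m - Poly_Mapping.single i 1 + m' = m + m' - Poly_Mapping.single i 1" if "Poly_Mapping.lookup m i \<noteq> 0"
      using that by (intro poly_mapping_eqI) (auto simp: lookup_add lookup_minus lookup_single when_def)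
    have 2: "m + (m' - Poly_Mapping.single i 1) = m + m' - Poly_Mapping.single i 1" if "Poly_Mapping.lookup m' i \<noteq> 0"
      using that by (intro poly_mapping_eqI) (auto simp: lookup_add lookup_minus lookup_single when_def)
    show ?case using 1 2
      by (cases "Poly_Mapping.lookup m i = 0"; cases "Poly_Mapping.lookup m' i = 0")
         (auto simp: mult_single lookup_add algebra_simps simp flip: single_add)
  qed (simp add: algebra_simps pdiff_add)
qed (simp add: algebra_simps pdiff_add)

lemma pdiff_commute: "pdiff i (pdiff j p) = pdiff j (pdiff i p)"
proof (induction p rule: pm_induct)
  case (single m c)
  have "m - Poly_Mapping.single i 1 - Poly_Mapping.single j 1 = m - Poly_Mapping.single j 1 - Poly_Mapping.single i 1"
    by (intro poly_mapping_eqI) (auto simp: lookup_minus)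
  then show ?case by (auto simp: lookup_minus lookup_single when_def algebra_simps)
qed (simp add: pdiff_add)

lemma pdiff_pvar: "pdiff i (pvar j) = (if i = j then 1 else 0)"
  by (auto simp: pvar_def lookup_single when_def)

lemma lin_form_single [simp]: "lin_form (Poly_Mapping.single i c) = pm_scale c (pvar i)"
  by (simp add: lin_form_def)

lemma lin_form_simps:
  "lin_form (u + v) = lin_form u + lin_form v" "lin_form (u - v) = lin_form u - lin_form v"
  "lin_form (pm_scale c u) = pm_scale c (lin_form u)"
  by (simp_all add: lin_form_def lin_ext_add lin_ext_diff lin_ext_scale)

lemma sym_deriv_add: "sym_deriv n T (p + q) = sym_deriv n T p + sym_deriv n T q"
  by (simp add: sym_deriv_def pdiff_add algebra_simps sum.distrib)

lemma sym_deriv_scale: "sym_deriv n T (pm_scale c p) = pm_scale c (sym_deriv n T p)"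
  by (simp add: sym_deriv_def pdiff_scale pm_scale_mult_right pm.scale_sum_right)

lemma sym_deriv_mult: "sym_deriv n T (p * q) = sym_deriv n T p * q + p * sym_deriv n T q"
  by (simp add: sym_deriv_def pdiff_mult algebra_simps sum.distrib sum_distrib_left sum_distrib_right)

lemma sym_deriv_lin_form:
  assumes "Vector_Spaces.linear pm_scale pm_scale T" "v \<in> U_space n"
  shows "sym_deriv n T (lin_form v) = lin_form (T v)"
proof -
  interpret T: Vector_Spaces.linear pm_scale pm_scale T by fact
  have 1: "sym_deriv n T (pvar i) = lin_form (T (Poly_Mapping.single i 1))" if "i \<le> n" for i
    using that by (simp add: sym_deriv_def pdiff_pvar if_distrib cong: if_cong)
  let ?K = "Poly_Mapping.keys v"
  have v: "v = (\<Sum>i\<in>?K. pm_scale (Poly_Mapping.lookup v i) (Poly_Mapping.single i 1))"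
    using lin_ext_id[of v] by (simp add: lin_ext_def)
  interpret D: Vector_Spaces.linear pm_scale pm_scale "sym_deriv n T"
    by unfold_locales (simp_all add: sym_deriv_add sym_deriv_scale)
  interpret F: Vector_Spaces.linear pm_scale pm_scale lin_form
    unfolding lin_form_def by (rule linear_lin_ext)
  have "sym_deriv n T (lin_form v) = (\<Sum>i\<in>?K. pm_scale (Poly_Mapping.lookup v i) (sym_deriv n T (pvar i)))"
    by (simp add: lin_form_def lin_ext_def D.sum D.scale)
  also have "\<dots> = (\<Sum>i\<in>?K. pm_scale (Poly_Mapping.lookup v i) (lin_form (T (Poly_Mapping.single i 1))))"
    using assms(2) by (intro sum.cong) (auto simp: 1 U_space_def)
  also have "\<dots> = lin_form (T (\<Sum>i\<in>?K. pm_scale (Poly_Mapping.lookup v i) (Poly_Mapping.single i 1)))"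
    by (simp add: T.sum T.scale F.sum F.scale del: pm_scale_single)
  finally show ?thesis using v by simp
qed

lemma mon_degree_superset:
  "finite A \<Longrightarrow> Poly_Mapping.keys m \<subseteq> A \<Longrightarrow> mon_degree m = (\<Sum>i\<in>A. Poly_Mapping.lookup m i)"
  unfolding mon_degree_def by (intro sum.mono_neutral_left) (auto simp: in_keys_iff)

lemma mon_degree_add: "mon_degree (m + m') = mon_degree m + mon_degree m'"
proof -
  let ?A = "Poly_Mapping.keys m \<union> Poly_Mapping.keys m'"
  have "Poly_Mapping.keys (m + m') \<subseteq> ?A" by (rule Poly_Mapping.keys_add)
  then show ?thesis by (simp add: mon_degree_superset[of ?A] lookup_add sum.distrib)
qed

lemma mon_degree_single [simp]: "mon_degree (Poly_Mapping.single i c) = c"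
  by (simp add: mon_degree_superset[of "{i}"])

lemma subspace_hom_polys: "pm.subspace (hom_polys n k :: 'a::field mpoly set)"
proof -
  have mem: "p \<in> hom_polys n k \<longleftrightarrow>
      (\<forall>m. Poly_Mapping.lookup p m \<noteq> 0 \<longrightarrow> Poly_Mapping.keys m \<subseteq> {..n} \<and> mon_degree m = k)" for p :: "'a mpoly"
    unfolding hom_polys_def polys_def using in_keys_iff[of _ p] by blast
  show ?thesis
  proof (rule pm.subspaceI)
    show "0 \<in> (hom_polys n k :: 'a mpoly set)" by (simp add: mem)
  next
    fix p q :: "'a mpoly" assume *: "p \<in> hom_polys n k" "q \<in> hom_polys n k"
    show "p + q \<in> hom_polys n k"
      unfolding mem
    proof (intro allI impI)
      fix m assume "Poly_Mapping.lookup (p + q) m \<noteq> 0"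
      then have "Poly_Mapping.lookup p m \<noteq> 0 \<or> Poly_Mapping.lookup q m \<noteq> 0"
        by (auto simp: lookup_add)
      then show "Poly_Mapping.keys m \<subseteq> {..n} \<and> mon_degree m = k"
        using *[unfolded mem] by blast
    qed
  next
    fix c and p :: "'a mpoly" assume "p \<in> hom_polys n k"
    then show "pm_scale c p \<in> hom_polys n k"
      unfolding mem lookup_pm_scale mult_eq_0_iff by blast
  qed
qed

lemma hom_polys_mult: "p \<in> hom_polys n k \<Longrightarrow> q \<in> hom_polys n l \<Longrightarrow> p * q \<in> hom_polys n (k + l)"
proof -
  assume p: "p \<in> hom_polys n k" and q: "q \<in> hom_polys n l"
  have "Poly_Mapping.keys m \<subseteq> {..n} \<and> mon_degree m = k + l" if m: "m \<in> Poly_Mapping.keys (p * q)" for m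
  proof -
    obtain a b where ab: "m = a + b" "a \<in> Poly_Mapping.keys p" "b \<in> Poly_Mapping.keys q"
      using keys_mult[of p q] m by blast
    then have "Poly_Mapping.keys a \<subseteq> {..n}" "Poly_Mapping.keys b \<subseteq> {..n}" "mon_degree a = k" "mon_degree b = l"
      using p q unfolding hom_polys_def polys_def by blast+
    then show ?thesis using Poly_Mapping.keys_add[of a b] unfolding ab mon_degree_add by blast
  qed
  then show ?thesis by (auto simp: hom_polys_def polys_def)
qed

lemma lin_form_in: "v \<in> U_space n \<Longrightarrow> lin_form v \<in> hom_polys n 1"
  unfolding lin_form_def lin_ext_def
  by (intro pm.subspace_sum pm.subspace_scale subspace_hom_polys)
     (auto simp: hom_polys_def polys_def pvar_def U_space_def)

lemma pdiff_in: 
  assumes "p \<in> hom_polys n (Suc k)" shows "pdiff i p \<in> hom_polys n k"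
  unfolding pdiff_def lin_ext_def
proof (intro pm.subspace_sum pm.subspace_scale subspace_hom_polys)
  fix m assume m: "m \<in> Poly_Mapping.keys p"
  show "Poly_Mapping.single (m - Poly_Mapping.single i 1) (of_nat (Poly_Mapping.lookup m i)) \<in> hom_polys n k"
  proof (cases "Poly_Mapping.lookup m i = 0")
    case True
    then show ?thesis by (simp add: subspace_hom_polys pm.subspace_0)
  next
    case False
    let ?m = "m - Poly_Mapping.single i 1"
    have e: "m = ?m + Poly_Mapping.single i 1"
      using False by (intro poly_mapping_eqI) (auto simp: lookup_add lookup_minus lookup_single when_def)
    have "mon_degree m = Suc k" "Poly_Mapping.keys m \<subseteq> {..n}"
      using assms m by (auto simp: hom_polys_def polys_def)
    moreover have "mon_degree m = mon_degree ?m + 1"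
      by (subst e) (simp add: mon_degree_add del: diff_add_cancel)
    moreover have "Poly_Mapping.keys ?m \<subseteq> Poly_Mapping.keys m"
      by (auto simp: in_keys_iff lookup_minus)
    ultimately show ?thesis by (auto simp: hom_polys_def polys_def split: if_splits)
  qed
qed

lemma pdiff_hom_0: assumes "p \<in> hom_polys n 0" shows "pdiff i p = 0"
proof -
  have "Poly_Mapping.lookup m i = 0" if "m \<in> Poly_Mapping.keys p" for m
    using assms that by (auto simp: hom_polys_def mon_degree_def in_keys_iff)
  then show ?thesis by (auto simp: pdiff_def lin_ext_def intro!: sum.neutral)
qed

lemma sym_deriv_in:
  assumes "\<And>v. v \<in> U_space n \<Longrightarrow> T v \<in> U_space n" "p \<in> hom_polys n k"
  shows "sym_deriv n T p \<in> hom_polys n k"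
proof (cases k)
  case 0
  then show ?thesis using assms(2) by (simp add: sym_deriv_def pdiff_hom_0 subspace_hom_polys pm.subspace_0)
next
  case (Suc l)
  have "lin_form (T (Poly_Mapping.single i 1)) * pdiff i p \<in> hom_polys n (1 + l)" if "i \<le> n" for i
    using that assms(2) Suc
    by (intro hom_polys_mult lin_form_in assms(1) pdiff_in) (auto simp: U_space_def)
  then show ?thesis unfolding sym_deriv_def Suc
    by (intro pm.subspace_sum subspace_hom_polys) auto
qed

lemma sym_deriv_commutator:
  assumes S: "Vector_Spaces.linear pm_scale pm_scale S" "\<And>v. v \<in> U_space n \<Longrightarrow> S v \<in> U_space n"
    and T: "Vector_Spaces.linear pm_scale pm_scale T" "\<And>v. v \<in> U_space n \<Longrightarrow> T v \<in> U_space n"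
  shows "sym_deriv n S (sym_deriv n T p) - sym_deriv n T (sym_deriv n S p) =
         sym_deriv n (\<lambda>v. S (T v) - T (S v)) p"
proof -
  let ?u = "\<lambda>i. Poly_Mapping.single i 1 :: nat \<Rightarrow>\<^sub>0 'a"
  have *: "sym_deriv n S (sym_deriv n T p) =
     (\<Sum>j\<le>n. lin_form (S (T (?u j))) * pdiff j p) +
     (\<Sum>j\<le>n. \<Sum>i\<le>n. lin_form (T (?u j)) * lin_form (S (?u i)) * pdiff i (pdiff j p))"
    if S: "Vector_Spaces.linear pm_scale pm_scale S" and T: "\<And>v. v \<in> U_space n \<Longrightarrow> T v \<in> U_space n" for S T
  proof -
    have D: "sym_deriv n S (\<Sum>j\<in>A. g j) = (\<Sum>j\<in>A. sym_deriv n S (g j))" for A :: "nat set" and g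
      by (induction A rule: infinite_finite_induct) (simp_all add: sym_deriv_add, simp_all add: sym_deriv_def pdiff_def)
    have "sym_deriv n S (sym_deriv n T p) = (\<Sum>j\<le>n. sym_deriv n S (lin_form (T (?u j)) * pdiff j p))"
      by (subst (2) sym_deriv_def) (simp add: D)
    also have "\<dots> = (\<Sum>j\<le>n. lin_form (S (T (?u j))) * pdiff j p + lin_form (T (?u j)) * sym_deriv n S (pdiff j p))"
    proof (rule sum.cong)
      fix j assume "j \<in> {..n}"
      then have "T (?u j) \<in> U_space n" by (intro T) (auto simp: U_space_def)
      then show "sym_deriv n S (lin_form (T (?u j)) * pdiff j p) =
         lin_form (S (T (?u j))) * pdiff j p + lin_form (T (?u j)) * sym_deriv n S (pdiff j p)"
        by (simp add: sym_deriv_mult sym_deriv_lin_form[OF S])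
    qed simp
    finally show ?thesis
      by (simp add: sum.distrib sym_deriv_def sum_distrib_left mult.assoc)
  qed
  have "(\<Sum>j\<le>n. \<Sum>i\<le>n. lin_form (T (?u j)) * lin_form (S (?u i)) * pdiff i (pdiff j p)) = 
        (\<Sum>j\<le>n. \<Sum>i\<le>n. lin_form (S (?u j)) * lin_form (T (?u i)) * pdiff i (pdiff j p))"
    by (subst sum.swap) (simp add: pdiff_commute mult.commute mult.left_commute)
  then show ?thesis
    by (simp add: *[OF S(1) T(2)] *[OF T(1) S(2)] sum_subtractf[symmetric] algebra_simps)
       (simp add: sym_deriv_def lin_form_simps algebra_simps flip: sum_subtractf)
qed

lemma sl2_module_sym_power:
  "sl2_module (sym_deriv n (U_e n)) (sym_deriv n (U_h n)) (sym_deriv n (U_f n)) (hom_polys n k :: 'a::field mpoly set)"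
proof -
  have lin: "Vector_Spaces.linear pm_scale pm_scale (U_e n :: (nat \<Rightarrow>\<^sub>0 'a) \<Rightarrow> _)" "Vector_Spaces.linear pm_scale pm_scale (U_h n :: (nat \<Rightarrow>\<^sub>0 'a) \<Rightarrow> _)"
    "Vector_Spaces.linear pm_scale pm_scale (U_f n :: (nat \<Rightarrow>\<^sub>0 'a) \<Rightarrow> _)"
   and inU: "v \<in> U_space n \<Longrightarrow> U_e n v \<in> U_space n" "v \<in> U_space n \<Longrightarrow> U_h n v \<in> U_space n"
      "v \<in> U_space n \<Longrightarrow> U_f n v \<in> U_space n"
   and rel: "v \<in> U_space n \<Longrightarrow> U_e n (U_f n v) - U_f n (U_e n v) = U_h n v"
     "v \<in> U_space n \<Longrightarrow> U_h n (U_e n v) - U_e n (U_h n v) = pm_scale 2 (U_e n v)"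
     "v \<in> U_space n \<Longrightarrow> U_h n (U_f n v) - U_f n (U_h n v) = pm_scale (-2) (U_f n v)" for v :: "nat \<Rightarrow>\<^sub>0 'a"
    using sl2_module_U_space[of n, where ?'a = 'a] by (auto simp: sl2_module_def sl2_submodule_def)
  have cong: "sym_deriv n T p = sym_deriv n T' p" if "\<And>v. v \<in> U_space n \<Longrightarrow> T v = T' v" for T T' and p :: "'a mpoly"
    unfolding sym_deriv_def using that by (intro sum.cong) (auto simp: U_space_def)
  have sc: "sym_deriv n (\<lambda>v. pm_scale c (T v)) p = pm_scale c (sym_deriv n T p)" for c T and p :: "'a mpoly"
    by (simp add: sym_deriv_def lin_form_simps pm_scale_mult_left pm.scale_sum_right)
  show ?thesis
    unfolding sl2_module_def sl2_submodule_def
    by (auto simp: sym_deriv_commutator lin inU subspace_hom_polys simp flip: sc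
             intro!: sym_deriv_in cong)
       (unfold_locales; simp add: sym_deriv_add sym_deriv_scale rel | simp add: rel)+
qed


subsection \<open>The center in terms of partial derivatives\<close>

text \<open>The Lie algebra \<open>\<gg>(n + 2)\<close> acts on the polynomial ring: \<open>x\<close> acts as the derivation
  \<open>fil_D n\<close> and \<open>y\<^sub>i\<close> as multiplication by \<open>y\<^sub>i\<close>. The induced action \<open>ue_act\<close> of the enveloping
  algebra recovers \<open>p\<close> from \<open>poly_to_ue n p\<close>, which is therefore injective modulo the ideal.\<close>

definition fil_D :: "nat \<Rightarrow> 'a::field mpoly \<Rightarrow> 'a mpoly" where
  "fil_D n p = (\<Sum>i<n. pvar i * pdiff (Suc i) p)"

lemma fil_D_add: "fil_D n (p + q) = fil_D n p + fil_D n q"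
  and fil_D_mult: "fil_D n (p * q) = fil_D n p * q + p * fil_D n q"
  and fil_D_scale: "fil_D n (pm_scale c p) = pm_scale c (fil_D n p)"
  by (simp_all add: fil_D_def pdiff_add pdiff_mult pdiff_scale pm_scale_mult_right pm.scale_sum_right
    algebra_simps sum.distrib sum_distrib_left sum_distrib_right)

lemma fil_D_0 [simp]: "fil_D n 0 = 0" by (simp add: fil_D_def pdiff_def)
lemma fil_D_1 [simp]: "fil_D n 1 = 0" 
  using pdiff_single[of _ 0 "1::'a"] by (simp add: fil_D_def)

lemma fil_D_sum: "fil_D n (\<Sum>x\<in>A. g x) = (\<Sum>x\<in>A. fil_D n (g x))"
  by (induction A rule: infinite_finite_induct) (auto simp: fil_D_add)

lemma fil_D_pvar_0: "fil_D n (pvar 0) = 0" by (simp add: fil_D_def pdiff_pvar)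
lemma fil_D_pvar_Suc: "i < n \<Longrightarrow> fil_D n (pvar (Suc i)) = pvar i" 
  by (simp add: fil_D_def pdiff_pvar if_distrib cong: if_cong)

definition ypart :: "nat \<Rightarrow> (filiform_basis \<Rightarrow>\<^sub>0 'a::field) \<Rightarrow> 'a mpoly" where
  "ypart n u = (\<Sum>i\<le>n. pm_scale (Poly_Mapping.lookup u (gen_y i)) (pvar i))"

definition ue_op :: "nat \<Rightarrow> (filiform_basis \<Rightarrow>\<^sub>0 'a::field) \<Rightarrow> 'a mpoly \<Rightarrow> 'a mpoly" where
  "ue_op n u p = pm_scale (Poly_Mapping.lookup u gen_x) (fil_D n p) + ypart n u * p"

definition ue_act :: "nat \<Rightarrow> ((filiform_basis \<Rightarrow>\<^sub>0 'a) free_monoid \<Rightarrow>\<^sub>0 'a) \<Rightarrow> 'a::field mpoly \<Rightarrow> 'a mpoly" where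
  "ue_act n a p = lin_ext (\<lambda>w. foldr (ue_op n) (letters w) p) a"

lemma ue_op_add: "ue_op n u (p + q) = ue_op n u p + ue_op n u q"
  and ue_op_scale: "ue_op n u (pm_scale c p) = pm_scale c (ue_op n u p)"
  by (simp_all add: ue_op_def fil_D_add fil_D_scale algebra_simps pm.scale_right_distrib pm_scale_mult_right pm_scale_mult_left)

lemma foldr_ue_op_add: "foldr (ue_op n) us (p + q) = foldr (ue_op n) us p + foldr (ue_op n) us q"
  and foldr_ue_op_scale: "foldr (ue_op n) us (pm_scale c p) = pm_scale c (foldr (ue_op n) us p)"
  by (induction us) (simp_all add: ue_op_add ue_op_scale)

lemma ue_act_add: "ue_act n (a + b) p = ue_act n a p + ue_act n b p" and ue_act_scale: "ue_act n (pm_scale c a) p = pm_scale c (ue_act n a p)"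
  and ue_act_diff: "ue_act n (a - b) p = ue_act n a p - ue_act n b p" 
  by (simp_all add: ue_act_def lin_ext_add lin_ext_scale lin_ext_diff)

lemma ue_act_single: "ue_act n (Poly_Mapping.single w c) p = pm_scale c (foldr (ue_op n) (letters w) p)"
  by (simp add: ue_act_def)

lemma ue_act_mult: "ue_act n (a * b) p = ue_act n a (ue_act n b p)"
proof (induction a rule: pm_induct)
  case (single w c)
  show ?case
  proof (induction b rule: pm_induct)
    case (single w' c')
    then show ?case by (simp add: mult_single ue_act_single plus_free_monoid_def foldr_ue_op_scale)
  next
    case (add u v)
    then show ?case by (simp add: algebra_simps ue_act_add) (simp add: ue_act_single foldr_ue_op_add pm.scale_right_distrib)
  qed
qed (simp add: algebra_simps ue_act_add)

lemma ue_act_letter: "ue_act n (letter u) p = ue_op n u p"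
  by (simp add: letter_def ue_act_single)

lemma ue_act_zero_arg [simp]: "ue_act n a 0 = 0"
  by (induction a rule: pm_induct) (use foldr_ue_op_scale[of n _ 0 0] in \<open>auto simp: ue_act_add ue_act_single\<close>)

lemma in_filiform: "u \<in> filiform n \<longleftrightarrow> (\<forall>i>n. Poly_Mapping.lookup u (gen_y i) = 0)" 
    unfolding filiform_def
    by (auto simp: subset_iff in_keys_iff) (metis filiform_basis.exhaust image_eqI atMost_iff not_le_imp_less)

lemma fil_D_ypart: "fil_D n (ypart n v) = (\<Sum>i<n. pm_scale (Poly_Mapping.lookup v (gen_y (Suc i))) (pvar i))"
proof -
  have "fil_D n (ypart n v) = (\<Sum>i<Suc n. pm_scale (Poly_Mapping.lookup v (gen_y i)) (fil_D n (pvar i)))"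
    by (simp only: ypart_def fil_D_sum fil_D_scale lessThan_Suc_atMost)
  also have "\<dots> = (\<Sum>i<n. pm_scale (Poly_Mapping.lookup v (gen_y (Suc i))) (fil_D n (pvar (Suc i))))"
    by (simp only: sum.lessThan_Suc_shift fil_D_pvar_0) simp
  also have "\<dots> = (\<Sum>i<n. pm_scale (Poly_Mapping.lookup v (gen_y (Suc i))) (pvar i))"
    by (rule sum.cong) (simp_all add: fil_D_pvar_Suc)
  finally show ?thesis .
qed

lemma ue_op_bracket:
  assumes "u \<in> filiform n" "v \<in> filiform n"
  shows "ue_op n u (ue_op n v p) - ue_op n v (ue_op n u p) = ue_op n (filiform_bracket u v) p"
proof -
  have "ypart n (filiform_bracket u v) = (\<Sum>i<n. pm_scale (Poly_Mapping.lookup (filiform_bracket u v) (gen_y i)) (pvar i))"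
    unfolding ypart_def lessThan_Suc_atMost[symmetric] using assms
    by (simp add: lookup_filiform_bracket in_filiform)
  also have "\<dots> = pm_scale (Poly_Mapping.lookup u gen_x) (fil_D n (ypart n v)) - pm_scale (Poly_Mapping.lookup v gen_x) (fil_D n (ypart n u))"
    by (simp add: lookup_filiform_bracket fil_D_ypart pm.scale_sum_right pm.scale_left_diff_distrib mult.commute flip: sum_subtractf)
  finally have e: "ypart n (filiform_bracket u v) = \<dots>" .
  show ?thesis unfolding ue_op_def e
    by (simp add: lookup_filiform_bracket fil_D_add fil_D_scale fil_D_mult pm_scale_mult_right pm_scale_mult_left
        algebra_simps pm.scale_right_distrib)
qed

lemma ue_op_letter_add: "ue_op n (u + v) p = ue_op n u p + ue_op n v p"
  and ue_op_letter_scale: "ue_op n (pm_scale c u) p = pm_scale c (ue_op n u p)"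
proof -
  have "ypart n (u + v) = ypart n u + ypart n v" "ypart n (pm_scale c u) = pm_scale c (ypart n u)"
    by (simp_all add: ypart_def lookup_add pm.scale_left_distrib sum.distrib pm.scale_sum_right)
  then show "ue_op n (u + v) p = ue_op n u p + ue_op n v p" "ue_op n (pm_scale c u) p = pm_scale c (ue_op n u p)"
    by (simp_all add: ue_op_def lookup_add pm.scale_left_distrib pm.scale_right_distrib pm_scale_mult_left distrib_right)
qed

lemma ue_act_relations: "r \<in> ue_relations (filiform n) filiform_bracket \<Longrightarrow> ue_act n r p = 0"
  by (induction rule: ue_relations.induct)
     (auto simp: ue_act_diff ue_act_letter ue_act_mult ue_act_scale ue_op_bracket ue_op_letter_add ue_op_letter_scale)

lemma ue_act_ideal: "r \<in> ue_ideal (filiform n) filiform_bracket \<Longrightarrow> ue_act n r p = 0"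
  unfolding ue_ideal_def
proof (induction rule: pm.span_induct)
  case base
  show ?case by (auto simp: pm.subspace_def ue_act_add ue_act_scale) (simp add: ue_act_def)
qed (auto simp: ue_act_mult ue_act_relations)

definition yword :: "nat list \<Rightarrow> ((filiform_basis \<Rightarrow>\<^sub>0 'a::field) free_monoid \<Rightarrow>\<^sub>0 'a)" where
  "yword xs = Poly_Mapping.single (Word (map (\<lambda>i. Poly_Mapping.single (gen_y i) 1) xs)) 1"

definition list_mon :: "nat list \<Rightarrow> (nat \<Rightarrow>\<^sub>0 nat)" where
  "list_mon xs = (\<Sum>i\<leftarrow>xs. Poly_Mapping.single i 1)"

definition ylist :: "nat \<Rightarrow> (nat \<Rightarrow>\<^sub>0 nat) \<Rightarrow> nat list" where
  "ylist n m = concat (map (\<lambda>i. replicate (Poly_Mapping.lookup m i) i) [0..<Suc n])"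

lemma list_mon_simps [simp]: "list_mon [] = 0" "list_mon (i # xs) = Poly_Mapping.single i 1 + list_mon xs"
  by (simp_all add: list_mon_def)

lemma lookup_mon: "Poly_Mapping.lookup (list_mon xs) j = count (mset xs) j"
  by (induction xs) (auto simp: lookup_add lookup_single)

lemma count_ylist: "count (mset (ylist n m)) j = (if j \<le> n then Poly_Mapping.lookup m j else 0)"
proof -
  have "count (mset (concat (map (\<lambda>i. replicate (Poly_Mapping.lookup m i) i) [0..<k]))) j = (if j < k then Poly_Mapping.lookup m j else 0)" for k
    by (induction k) auto
  then show ?thesis by (simp add: ylist_def less_Suc_eq_le del: upt_Suc)
qed

lemma list_mon_ylist: "Poly_Mapping.keys m \<subseteq> {..n} \<Longrightarrow> list_mon (ylist n m) = m"
  by (intro poly_mapping_eqI) (auto simp: lookup_mon count_ylist in_keys_iff subset_iff)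

lemma ylist_mon: "set xs \<subseteq> {..n} \<Longrightarrow> mset (ylist n (list_mon xs)) = mset xs"
  by (intro multiset_eqI) (auto simp: lookup_mon count_ylist subset_iff count_eq_zero_iff)

lemma set_ylist: "set (ylist n m) \<subseteq> {..n}" by (auto simp: ylist_def)

lemma poly_to_ue_yword: "poly_to_ue n = lin_ext (\<lambda>m. yword (ylist n m))"
  by (simp add: poly_to_ue_def yword_def ylist_def map_concat o_def)

lemma ue_act_yword: "set xs \<subseteq> {..n} \<Longrightarrow> ue_act n (yword xs) 1 = (Poly_Mapping.single (list_mon xs) 1 :: 'a::field mpoly)"
proof (induction xs)
  case (Cons i xs)
  have y: "ypart n (Poly_Mapping.single (gen_y i) 1) = (pvar i :: 'a mpoly)"
    using Cons.prems by (simp add: ypart_def lookup_single when_def if_distrib[of "\<lambda>c. pm_scale c _"] cong: if_cong)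
  have "ue_act n (yword (i # xs)) 1 = ue_op n (Poly_Mapping.single (gen_y i) 1) (ue_act n (yword xs) (1 :: 'a mpoly))"
    by (simp add: yword_def ue_act_single)
  then show ?case using Cons by (simp add: ue_op_def lookup_single y pvar_def mult_single)
qed (simp add: yword_def ue_act_single)

lemma ue_act_poly_to_ue:
  assumes "p \<in> polys n" shows "ue_act n (poly_to_ue n p) 1 = p"
proof -
  have s: "ue_act n (\<Sum>m\<in>A. g m) 1 = (\<Sum>m\<in>A. ue_act n (g m) 1)" for A :: "(nat \<Rightarrow>\<^sub>0 nat) set" and g
    by (induction A rule: infinite_finite_induct) (auto simp: ue_act_add, auto simp: ue_act_def)
  have "ue_act n (poly_to_ue n p) 1 = (\<Sum>m\<in>Poly_Mapping.keys p. pm_scale (Poly_Mapping.lookup p m) (ue_act n (yword (ylist n m)) 1))"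
    unfolding poly_to_ue_yword lin_ext_def[of _ p] by (simp add: s ue_act_scale)
  also have "\<dots> = lin_ext (\<lambda>m. Poly_Mapping.single m 1) p"
    unfolding lin_ext_def using assms
    by (intro sum.cong) (auto simp: ue_act_yword set_ylist list_mon_ylist polys_def)
  finally show ?thesis by (simp add: lin_ext_id)
qed

lemma yword_free: "set xs \<subseteq> {..n} \<Longrightarrow> yword xs \<in> free_alg (filiform n)"
  by (auto simp: free_alg_def yword_def filiform_def)

lemma free_alg_subspace: "pm.subspace (free_alg L :: ('l free_monoid \<Rightarrow>\<^sub>0 'a::field) set)"
proof -
  have mem: "p \<in> free_alg L \<longleftrightarrow> (\<forall>w. Poly_Mapping.lookup p w \<noteq> 0 \<longrightarrow> set (letters w) \<subseteq> L)" for p :: "'l free_monoid \<Rightarrow>\<^sub>0 'a"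
    unfolding free_alg_def using in_keys_iff[of _ p] by blast
  show ?thesis
  proof (rule pm.subspaceI)
    show "0 \<in> (free_alg L :: ('l free_monoid \<Rightarrow>\<^sub>0 'a::field) set)" by (simp add: mem)
  next
    fix p q :: "'l free_monoid \<Rightarrow>\<^sub>0 'a" assume *: "p \<in> free_alg L" "q \<in> free_alg L"
    show "p + q \<in> free_alg L"
      unfolding mem
    proof (intro allI impI)
      fix m assume "Poly_Mapping.lookup (p + q) m \<noteq> 0"
      then have "Poly_Mapping.lookup p m \<noteq> 0 \<or> Poly_Mapping.lookup q m \<noteq> 0"
        by (auto simp: lookup_add)
      then show "set (letters m) \<subseteq> L" using *[unfolded mem] by blast
    qed
  next
    fix c and p :: "'l free_monoid \<Rightarrow>\<^sub>0 'a" assume "p \<in> free_alg L"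
    then show "pm_scale c p \<in> free_alg L"
      unfolding mem lookup_pm_scale mult_eq_0_iff by blast
  qed
qed

lemma free_alg_mult: "a \<in> free_alg L \<Longrightarrow> b \<in> free_alg L \<Longrightarrow> a * b \<in> free_alg L"
proof -
  assume *: "a \<in> free_alg L" "b \<in> free_alg L"
  have "set (letters w) \<subseteq> L" if m: "w \<in> Poly_Mapping.keys (a * b)" for w
  proof -
    obtain u v where "w = u + v" "u \<in> Poly_Mapping.keys a" "v \<in> Poly_Mapping.keys b"
      using keys_mult[of a b] m by blast
    then show ?thesis using * by (simp add: free_alg_def plus_free_monoid_def)
  qed
  then show ?thesis by (auto simp: free_alg_def)
qed

lemma free_alg_1: "1 \<in> free_alg L" by (simp add: free_alg_def zero_free_monoid_def)
lemma free_alg_letter: "u \<in> L \<Longrightarrow> letter u \<in> free_alg L" by (simp add: free_alg_def letter_def)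

lemma poly_to_ue_free: "poly_to_ue n p \<in> free_alg (filiform n)"
  unfolding poly_to_ue_yword lin_ext_def
  by (intro pm.subspace_sum pm.subspace_scale free_alg_subspace yword_free set_ylist)

context
  fixes L :: "('b \<Rightarrow>\<^sub>0 'a::field) set" and br :: "('b \<Rightarrow>\<^sub>0 'a) \<Rightarrow> ('b \<Rightarrow>\<^sub>0 'a) \<Rightarrow> ('b \<Rightarrow>\<^sub>0 'a)"
begin

private abbreviation "II \<equiv> ue_ideal L br"

lemma II_sub: "pm.subspace II" by (simp add: ue_ideal_def)
lemmas II_add = pm.subspace_add[OF II_sub] and II_diff = pm.subspace_diff[OF II_sub] 
  and II_scale = pm.subspace_scale[OF II_sub] and II_0 = pm.subspace_0[OF II_sub]
  and II_sum = pm.subspace_sum[OF II_sub] and II_neg = pm.subspace_neg[OF II_sub]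

lemma II_rel: "r \<in> ue_relations L br \<Longrightarrow> r \<in> II"
  unfolding ue_ideal_def by (rule pm.span_base) (metis (mono_tags, lifting) free_alg_1 mem_Collect_eq mult_1 mult_1_right)

lemma II_left: "r \<in> II \<Longrightarrow> a \<in> free_alg L \<Longrightarrow> a * r \<in> II"
  unfolding ue_ideal_def
proof (induction rule: pm.span_induct)
  case base
  show ?case by (auto simp: pm.subspace_def algebra_simps pm_scale_mult_right intro: pm.span_add pm.span_scale pm.span_zero)
next
  case (step x)
  then obtain c r d where "x = c * r * d" "c \<in> free_alg L" "d \<in> free_alg L" "r \<in> ue_relations L br" by blast
  moreover have "a * (c * r * d) = (a * c) * r * d" by (simp add: mult.assoc)
  ultimately show ?case using step free_alg_mult by (intro pm.span_base) blast
qed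

lemma II_right: "r \<in> II \<Longrightarrow> a \<in> free_alg L \<Longrightarrow> r * a \<in> II"
  unfolding ue_ideal_def
proof (induction rule: pm.span_induct)
  case base
  show ?case by (auto simp: pm.subspace_def algebra_simps pm_scale_mult_left intro: pm.span_add pm.span_scale pm.span_zero)
next
  case (step x)
  then obtain c r d where "x = c * r * d" "c \<in> free_alg L" "d \<in> free_alg L" "r \<in> ue_relations L br" by blast
  moreover have "c * r * d * a = c * r * (d * a)" by (simp add: mult.assoc)
  ultimately show ?case using step free_alg_mult by (intro pm.span_base) blast
qed

lemma central_if_letters:
  assumes a: "a \<in> free_alg L" and c: "\<And>u. u \<in> L \<Longrightarrow> a * letter u - letter u * a \<in> II"
  shows "a \<in> ue_center L br"
proof -
  have w: "a * Poly_Mapping.single (Word us) 1 - Poly_Mapping.single (Word us) 1 * a \<in> II" if "set us \<subseteq> L" for us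
    using that
  proof (induction us)
    case Nil
    then show ?case using II_0 by (simp flip: zero_free_monoid_def)
  next
    case (Cons u us)
    let ?w = "Poly_Mapping.single (Word us) 1 :: ('b \<Rightarrow>\<^sub>0 'a) free_monoid \<Rightarrow>\<^sub>0 'a"
    have e: "Poly_Mapping.single (Word (u # us)) 1 = letter u * ?w"
      by (simp add: letter_def mult_single plus_free_monoid_def)
    have "?w \<in> free_alg L" using Cons by (auto simp: free_alg_def)
    then have "(a * letter u - letter u * a) * ?w + letter u * (a * ?w - ?w * a) \<in> II"
      using Cons c by (intro II_add II_left II_right free_alg_letter) auto
    then show ?case unfolding e by (simp add: algebra_simps)
  qed
  have "a * b - b * a \<in> II" if b: "b \<in> free_alg L" for b
  proof -
    have e: "b = (\<Sum>w\<in>Poly_Mapping.keys b. pm_scale (Poly_Mapping.lookup b w) (Poly_Mapping.single w 1))"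
      using lin_ext_id[of b] by (simp add: lin_ext_def)
    have "a * b - b * a = (\<Sum>w\<in>Poly_Mapping.keys b. pm_scale (Poly_Mapping.lookup b w) (a * Poly_Mapping.single w 1 - Poly_Mapping.single w 1 * a))"
      by (subst e, subst (2) e)
        (simp only: sum_distrib_left sum_distrib_right pm_scale_mult_left pm_scale_mult_right pm.scale_right_diff_distrib sum_subtractf)
    also have "\<dots> \<in> II"
    proof (intro II_sum II_scale)
      fix w assume "w \<in> Poly_Mapping.keys b"
      then show "a * Poly_Mapping.single w 1 - Poly_Mapping.single w 1 * a \<in> II"
        using b w[of "letters w"] by (auto simp: free_alg_def)
    qed
    finally show ?thesis .
  qed
  then show ?thesis using a by (simp add: ue_center_def)
qed

end

context fixes n :: nat and ty :: "'a::field itself" begin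
private abbreviation J :: "((filiform_basis \<Rightarrow>\<^sub>0 'a) free_monoid \<Rightarrow>\<^sub>0 'a) set" where "J \<equiv> ue_ideal (filiform n) filiform_bracket"
private abbreviation yy :: "nat \<Rightarrow> ((filiform_basis \<Rightarrow>\<^sub>0 'a) free_monoid \<Rightarrow>\<^sub>0 'a)" where "yy i \<equiv> letter (Poly_Mapping.single (gen_y i) 1)"
private abbreviation xx :: "((filiform_basis \<Rightarrow>\<^sub>0 'a) free_monoid \<Rightarrow>\<^sub>0 'a)" where "xx \<equiv> letter (Poly_Mapping.single gen_x 1)"

lemma J_trans: "a - b \<in> J \<Longrightarrow> b - c \<in> J \<Longrightarrow> a - c \<in> J"
  using II_add[of "a - b" _ _ "b - c"] by simp
lemma J_sym: "a - b \<in> J \<Longrightarrow> b - a \<in> J"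
  using II_neg[of "a - b"] by simp

lemma y_in: "i \<le> n \<Longrightarrow> Poly_Mapping.single (gen_y i) 1 \<in> filiform n" by (simp add: in_filiform lookup_single)
lemma x_in: "Poly_Mapping.single gen_x 1 \<in> filiform n" by (simp add: in_filiform lookup_single)

lemma letter_0: "letter 0 \<in> J"
  using II_rel[OF ue_relations.intros(2)[of 0 "filiform n" 0]] by (simp add: in_filiform)

lemma yword_Cons: "yword (i # xs) = yy i * yword xs"
  by (simp add: yword_def letter_def mult_single plus_free_monoid_def)
lemma yword_append: "yword (xs @ ys) = yword xs * yword ys"
  by (simp add: yword_def mult_single plus_free_monoid_def)

lemma yy_comm: assumes "i \<le> n" "j \<le> n" shows "yy i * yy j - yy j * yy i \<in> J"
proof -
  have "filiform_bracket (Poly_Mapping.single (gen_y i) 1) (Poly_Mapping.single (gen_y j) 1) = (0 :: filiform_basis \<Rightarrow>\<^sub>0 'a)"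
    by (intro poly_mapping_eqI) (simp add: lookup_filiform_bracket lookup_single split: filiform_basis.splits)
  then show ?thesis
    using II_add[OF II_rel[OF ue_relations.intros(3)[OF y_in[OF assms(1)] y_in[OF assms(2)]]] letter_0]
    by simp
qed

lemma yword_front: "set (x # ys @ zs) \<subseteq> {..n} \<Longrightarrow> yword (ys @ x # zs) - yword (x # ys @ zs) \<in> J"
proof (induction ys)
  case (Cons y ys)
  have "yy y * (yword (ys @ x # zs) - yword (x # ys @ zs)) \<in> J"
    using Cons by (intro II_left free_alg_letter y_in) auto
  moreover have "(yy y * yy x - yy x * yy y) * yword (ys @ zs) \<in> J"
    using Cons.prems by (intro II_right yy_comm yword_free) auto
  ultimately have "yy y * (yword (ys @ x # zs) - yword (x # ys @ zs)) + (yy y * yy x - yy x * yy y) * yword (ys @ zs) \<in> J"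
    by (rule II_add)
  then show ?case by (simp add: yword_Cons algebra_simps)
qed (simp add: II_0)

lemma yword_perm: "mset xs = mset ys \<Longrightarrow> set xs \<subseteq> {..n} \<Longrightarrow> yword xs - yword ys \<in> J"
proof (induction xs arbitrary: ys)
  case Nil
  then show ?case by (simp add: II_0)
next
  case (Cons x xs)
  have s: "set (x # xs) = set ys" using Cons.prems(1) by (rule mset_eq_setD)
  then have "x \<in> set ys" by auto
  then obtain a b where ys: "ys = a @ x # b" by (meson split_list)
  have sn: "set (x # a @ b) \<subseteq> {..n}" using s Cons.prems(2) unfolding ys by simp
  have "mset xs = mset (a @ b)" using Cons.prems(1) unfolding ys by simp
  then have "yword xs - yword (a @ b) \<in> J" using Cons.prems(2) by (intro Cons.IH) simp_all
  then have "yy x * (yword xs - yword (a @ b)) \<in> J" using sn by (intro II_left free_alg_letter y_in) simp_all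
  then have "yword (x # xs) - yword (x # a @ b) \<in> J" by (simp add: yword_Cons algebra_simps)
  moreover have "yword (x # a @ b) - yword ys \<in> J"
    unfolding ys by (rule J_sym, rule yword_front, rule sn)
  ultimately show ?case by (rule J_trans)
qed

private abbreviation E :: "'a mpoly \<Rightarrow> ((filiform_basis \<Rightarrow>\<^sub>0 'a) free_monoid \<Rightarrow>\<^sub>0 'a)" where "E \<equiv> poly_to_ue n"

lemma E_simps: "E (p + q) = E p + E q" "E (pm_scale c p) = pm_scale c (E p)" "E (Poly_Mapping.single m c) = pm_scale c (yword (ylist n m))"
  "E 0 = 0"
  by (simp_all add: poly_to_ue_yword lin_ext_add lin_ext_scale)

lemma E_yword: "set xs \<subseteq> {..n} \<Longrightarrow> yword xs - E (Poly_Mapping.single (list_mon xs) 1) \<in> J"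
  by (simp add: E_simps) (intro yword_perm ylist_mon[symmetric])

lemma polys_sum:
  assumes "p \<in> polys n" "\<And>m c. Poly_Mapping.keys m \<subseteq> {..n} \<Longrightarrow> P (Poly_Mapping.single m c)"
    "\<And>u v. P u \<Longrightarrow> P v \<Longrightarrow> P (u + v)" "P 0"
  shows "P (p :: 'a mpoly)"
proof -
  have "P (\<Sum>m\<in>A. Poly_Mapping.single m (f m))" if "\<And>m. m \<in> A \<Longrightarrow> Poly_Mapping.keys m \<subseteq> {..n}" for A f
    using that by (induction A rule: infinite_finite_induct) (auto intro: assms)
  from this[of "Poly_Mapping.keys p" "Poly_Mapping.lookup p"] show ?thesis
    using lin_ext_id[of p] assms(1) by (simp add: lin_ext_def polys_def)
qed

lemma E_y: assumes "i \<le> n" "p \<in> polys n" shows "yy i * E p - E (pvar i * p) \<in> J"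
  using assms(2)
proof (rule polys_sum)
  fix m :: "nat \<Rightarrow>\<^sub>0 nat" and c :: 'a assume m: "Poly_Mapping.keys m \<subseteq> {..n}"
  have "yword (i # ylist n m) - E (Poly_Mapping.single (list_mon (i # ylist n m)) 1) \<in> J"
    by (rule E_yword) (use assms(1) set_ylist in auto)
  then have "pm_scale c (yy i * yword (ylist n m) - E (Poly_Mapping.single (Poly_Mapping.single i 1 + m) 1)) \<in> J"
    by (intro II_scale) (simp add: yword_Cons list_mon_ylist m)
  then show "yy i * E (Poly_Mapping.single m c) - E (pvar i * Poly_Mapping.single m c) \<in> J"
    by (simp add: E_simps pvar_def mult_single pm_scale_mult_right pm.scale_right_diff_distrib)
next
  fix u v assume "yy i * E u - E (pvar i * u) \<in> J" "yy i * E v - E (pvar i * v) \<in> J"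
  from II_add[OF this] show "yy i * E (u + v) - E (pvar i * (u + v)) \<in> J"
    by (simp add: E_simps algebra_simps)
qed (simp add: E_simps II_0)

lemma fil_D_polys: assumes "Poly_Mapping.keys m \<subseteq> {..n}" shows "fil_D n (Poly_Mapping.single m (c::'a)) \<in> polys n"
proof -
  have *: "Poly_Mapping.single m c \<in> hom_polys n (mon_degree m)" "\<And>i. i \<le> n \<Longrightarrow> (pvar i :: 'a mpoly) \<in> hom_polys n 1"
    using assms by (auto simp: hom_polys_def polys_def pvar_def)
  have "fil_D n (Poly_Mapping.single m c) \<in> hom_polys n (mon_degree m)"
    unfolding fil_D_def
  proof (intro pm.subspace_sum subspace_hom_polys)
    fix i assume i: "i \<in> {..<n}"
    let ?p = "Poly_Mapping.single m c"
    show "pvar i * pdiff (Suc i) ?p \<in> hom_polys n (mon_degree m)"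
    proof (cases "mon_degree m")
      case 0
      then have "pdiff (Suc i) ?p = 0" using *(1) by (intro pdiff_hom_0[of _ n]) simp
      then show ?thesis using pm.subspace_0[OF subspace_hom_polys] by (simp del: pdiff_single)
    next
      case (Suc k)
      then have "pdiff (Suc i) ?p \<in> hom_polys n k" using *(1) by (intro pdiff_in) simp
      from hom_polys_mult[OF *(2)[of i] this] show ?thesis using i Suc by (simp del: pdiff_single)
    qed
  qed
  then show ?thesis by (simp add: hom_polys_def)
qed

lemma x_yword: "set xs \<subseteq> {..n} \<Longrightarrow> xx * yword xs - yword xs * xx - E (fil_D n (Poly_Mapping.single (list_mon xs) (1::'a))) \<in> J"
proof (induction xs)
  case Nil
  have "yword [] = (1 :: (filiform_basis \<Rightarrow>\<^sub>0 'a) free_monoid \<Rightarrow>\<^sub>0 'a)" by (simp add: yword_def flip: zero_free_monoid_def)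
  then show ?case by (simp add: E_simps II_0)
next
  case (Cons i xs)
  then have i: "i \<le> n" and xs: "set xs \<subseteq> {..n}" by auto
  have k: "Poly_Mapping.keys (list_mon xs) \<subseteq> {..n}"
    using xs by (auto simp: in_keys_iff lookup_mon)
  define p where "p = Poly_Mapping.single (list_mon xs) (1::'a)"
  define w :: "(filiform_basis \<Rightarrow>\<^sub>0 'a) free_monoid \<Rightarrow>\<^sub>0 'a" where "w = yword xs"
  have w: "w \<in> free_alg (filiform n)" unfolding w_def by (rule yword_free[OF xs])
  have p: "Poly_Mapping.single (list_mon (i # xs)) 1 = pvar i * p" by (simp add: p_def pvar_def mult_single)
  let ?b = "filiform_bracket (Poly_Mapping.single gen_x 1) (Poly_Mapping.single (gen_y i) 1) :: filiform_basis \<Rightarrow>\<^sub>0 'a"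
  have br: "letter ?b * w - E (fil_D n (pvar i) * p) \<in> J"
  proof (cases i)
    case 0
    have "?b = 0" unfolding 0 by (intro poly_mapping_eqI) (auto simp: lookup_filiform_bracket lookup_single split: filiform_basis.splits)
    then show ?thesis using II_right[OF letter_0 w] by (simp add: 0 fil_D_pvar_0 E_simps)
  next
    case (Suc j)
    have b: "?b = Poly_Mapping.single (gen_y j) 1" unfolding Suc
      by (intro poly_mapping_eqI) (auto simp: lookup_filiform_bracket lookup_single when_def split: filiform_basis.splits)
    have "yy j * yword xs - E (Poly_Mapping.single (list_mon (j # xs)) 1) \<in> J"
      using E_yword[of "j # xs"] i xs Suc by (simp add: yword_Cons)
    moreover have "Poly_Mapping.single (list_mon (j # xs)) 1 = fil_D n (pvar i) * p"
      using i by (simp add: Suc fil_D_pvar_Suc p_def) (simp add: pvar_def mult_single)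
    ultimately show ?thesis unfolding b w_def by simp
  qed
  have "yy i * (xx * w - w * xx - E (fil_D n p)) \<in> J"
    unfolding w_def p_def using Cons i by (intro II_left free_alg_letter y_in) auto
  moreover have "yy i * E (fil_D n p) - E (pvar i * fil_D n p) \<in> J"
    unfolding p_def by (intro E_y i fil_D_polys k)
  moreover have "(xx * yy i - yy i * xx - letter ?b) * w \<in> J"
    by (intro II_right II_rel ue_relations.intros x_in y_in i w)
  ultimately have "yy i * (xx * w - w * xx - E (fil_D n p)) + (yy i * E (fil_D n p) - E (pvar i * fil_D n p))
     + (xx * yy i - yy i * xx - letter ?b) * w + (letter ?b * w - E (fil_D n (pvar i) * p)) \<in> J"
    by (intro II_add br)
  then show ?case unfolding p yword_Cons fil_D_mult E_simps w_def by (simp add: algebra_simps)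
qed

lemma x_E: assumes "p \<in> polys n" shows "xx * E p - E p * xx - E (fil_D n p) \<in> J"
  using assms
proof (rule polys_sum)
  fix m :: "nat \<Rightarrow>\<^sub>0 nat" and c :: 'a assume m: "Poly_Mapping.keys m \<subseteq> {..n}"
  have s: "Poly_Mapping.single m c = pm_scale c (Poly_Mapping.single m 1)" by simp
  from II_scale[OF x_yword[OF set_ylist[of n m]], of c]
  show "xx * E (Poly_Mapping.single m c) - E (Poly_Mapping.single m c) * xx - E (fil_D n (Poly_Mapping.single m c)) \<in> J"
    unfolding list_mon_ylist[OF m] 
    by (subst (3) s) (simp add: E_simps fil_D_scale pm_scale_mult_right pm_scale_mult_left pm.scale_right_diff_distrib del: pm_scale_single)
next
  fix u v assume "xx * E u - E u * xx - E (fil_D n u) \<in> J" "xx * E v - E v * xx - E (fil_D n v) \<in> J"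
  from II_add[OF this] show "xx * E (u + v) - E (u + v) * xx - E (fil_D n (u + v)) \<in> J"
    by (simp add: E_simps algebra_simps fil_D_add)
qed (simp add: E_simps II_0)

lemma y_E: assumes "i \<le> n" "p \<in> polys n" shows "yy i * E p - E p * yy i \<in> J"
  using assms(2)
proof (rule polys_sum)
  fix m :: "nat \<Rightarrow>\<^sub>0 nat" and c :: 'a assume m: "Poly_Mapping.keys m \<subseteq> {..n}"
  have "yword (i # ylist n m) - yword (ylist n m @ [i]) \<in> J"
    by (rule yword_perm) (use assms(1) set_ylist in auto)
  moreover have "yword [i] = (yy i :: (filiform_basis \<Rightarrow>\<^sub>0 'a) free_monoid \<Rightarrow>\<^sub>0 'a)" by (simp add: yword_def letter_def)
  ultimately have "pm_scale c (yy i * yword (ylist n m) - yword (ylist n m) * yy i) \<in> J"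
    by (intro II_scale) (simp add: yword_Cons yword_append)
  then show "yy i * E (Poly_Mapping.single m c) - E (Poly_Mapping.single m c) * yy i \<in> J"
    by (simp add: E_simps pm_scale_mult_right pm_scale_mult_left pm.scale_right_diff_distrib)
next
  fix u v assume "yy i * E u - E u * yy i \<in> J" "yy i * E v - E v * yy i \<in> J"
  from II_add[OF this] show "yy i * E (u + v) - E (u + v) * yy i \<in> J"
    by (simp add: E_simps algebra_simps)
qed (simp add: E_simps II_0)

lemma letters_induct:
  assumes a: "a \<in> free_alg (filiform n)"
    and xc: "xx * a - a * xx \<in> J" and yc: "\<And>i. i \<le> n \<Longrightarrow> yy i * a - a * yy i \<in> J"
    and u: "u \<in> filiform n"
  shows "a * letter u - letter u * (a :: (filiform_basis \<Rightarrow>\<^sub>0 'a) free_monoid \<Rightarrow>\<^sub>0 'a) \<in> J"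
proof -
  let ?C = "\<lambda>u. u \<in> filiform n \<and> letter u * a - a * letter u \<in> J"
  have scale: "?C (pm_scale c v)" if "?C v" for c v
  proof -
    let ?r = "letter (pm_scale c v) - pm_scale c (letter v)"
    have r: "?r \<in> J" using that by (intro II_rel ue_relations.intros) auto
    have "?r * a - a * ?r + pm_scale c (letter v * a - a * letter v) \<in> J"
      by (rule II_add[OF II_diff[OF II_right[OF r a] II_left[OF r a]] II_scale]) (use that in simp)
    then show ?thesis using that
      by (simp add: algebra_simps pm_scale_mult_left pm_scale_mult_right pm.scale_right_diff_distrib in_filiform)
  qed
  have add: "?C (v + w)" if "?C v" "?C w" for v w
  proof -
    let ?r = "letter (v + w) - letter v - letter w"
    have r: "?r \<in> J" using that by (intro II_rel ue_relations.intros) auto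
    have "?r * a - a * ?r + (letter v * a - a * letter v) + (letter w * a - a * letter w) \<in> J"
      by (rule II_add[OF II_add[OF II_diff[OF II_right[OF r a] II_left[OF r a]]]]) (use that in simp_all)
    then show ?thesis using that by (simp add: algebra_simps in_filiform lookup_add)
  qed
  have C0: "?C 0" using II_diff[OF II_right[OF letter_0 a] II_left[OF letter_0 a]] by (simp add: in_filiform)
  have b: "?C (Poly_Mapping.single b c)" if "b \<in> insert gen_x (gen_y ` {..n})" for b c
    using scale[of "Poly_Mapping.single b 1" c] that xc yc x_in y_in by auto
  have "?C (\<Sum>b\<in>A. Poly_Mapping.single b (f b))" if "A \<subseteq> insert gen_x (gen_y ` {..n})" for A f
    using that
  proof (induction A rule: infinite_finite_induct)
    case (insert x F)
    then show ?case using add b by auto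
  qed (use C0 in auto)
  from this[of "Poly_Mapping.keys u" "Poly_Mapping.lookup u"] have "?C u"
    using u lin_ext_id[of u] by (simp add: lin_ext_def filiform_def)
  then show ?thesis using J_sym by (metis II_neg minus_diff_eq)
qed

end

theorem filiform_center_eq:
  "filiform_center n = {p \<in> polys n. (\<Sum>i<n. pvar i * pdiff (Suc i) p) = (0 :: 'a::field mpoly)}"
proof (intro set_eqI iffI)
  fix p :: "'a mpoly" assume "p \<in> filiform_center n"
  then have p: "p \<in> polys n" and c: "poly_to_ue n p \<in> ue_center (filiform n) filiform_bracket"
    by (auto simp: filiform_center_def)
  have "letter (Poly_Mapping.single gen_x 1) \<in> free_alg (filiform n)" by (intro free_alg_letter x_in)
  with c have "poly_to_ue n p * letter (Poly_Mapping.single gen_x 1) - letter (Poly_Mapping.single gen_x 1) * poly_to_ue n p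
      \<in> ue_ideal (filiform n) filiform_bracket"
    by (auto simp: ue_center_def)
  from ue_act_ideal[OF this, of 1]
  have "fil_D n p = 0"
    by (simp add: ue_act_diff ue_act_mult ue_act_letter ue_act_poly_to_ue p ue_op_def ypart_def lookup_single)
  then show "p \<in> {p \<in> polys n. (\<Sum>i<n. pvar i * pdiff (Suc i) p) = 0}"
    using p by (simp add: fil_D_def)
next
  fix p :: "'a mpoly" assume "p \<in> {p \<in> polys n. (\<Sum>i<n. pvar i * pdiff (Suc i) p) = 0}"
  then have p: "p \<in> polys n" and D: "fil_D n p = 0" by (auto simp: fil_D_def)
  have x: "letter (Poly_Mapping.single gen_x 1) * poly_to_ue n p - poly_to_ue n p * letter (Poly_Mapping.single gen_x 1)
      \<in> ue_ideal (filiform n) filiform_bracket"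
    using x_E[OF p] D by (simp add: poly_to_ue_def)
  have "poly_to_ue n p \<in> ue_center (filiform n) filiform_bracket"
    by (intro central_if_letters letters_induct poly_to_ue_free x y_E p)
  then show "p \<in> filiform_center n" using p by (simp add: filiform_center_def)
qed

end

(* The derivation defining the center is, after rescaling the variables, the raising operator e of
   S^k(U_n), so dim Z_{n,k} is the dimension of the kernel of e. Every irreducible submodule meets
   this kernel in a line, hence the number of summands of any decomposition is dim ker e. A basis
   of ker e consisting of weight vectors b generates strings b, f b, f^2 b, ..., which together form
   a basis of the whole module; that they span is seen by lifting along e (for weights >= 0) and
   along f (for weights <= 0). All weights have the parity of kn, and each string meets the weight
   kn mod 2 once, so dim ker e is the number of monomials of that weight, which correspond to the
   partitions of floor(kn/2) in a k x n box. Conjugating partitions exchanges k and n. *)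
theory Submission
  imports Defs
begin

section \<open>Weight modules over sl(2)\<close>

text \<open>Everything rests on e f^(j+1) u = (j+1)(l-j) f^j u for a vector u of weight l killed by
  e. In characteristic zero the factor vanishes only at j = l; this forces l >= 0, fixes the length
  of the string, and lets a power of e recover u from any nonzero element of the string.
  Irreducibility and directness both come from this recovery. Lifting along e divides by
  (j+1)(\<mu>+2+j), which can vanish once \<mu> < -1, so negative weights need the triple (f, -h,
  e). The strings give one decomposition; the count for an arbitrary one uses that e maps each
  summand to itself, so that ker e is the direct sum of the lines in the summands. Counting strings
  at the middle weight avoids differences of weight multiplicities. The factorials in the rescaling
  solve (n-i) c_(i+1) = c_i with c_n = 1, where e u_(i+1) = (n-i) u_i.\<close>

lemma linear_funpow:
  fixes T :: "('b \<Rightarrow>\<^sub>0 'a::field) \<Rightarrow> ('b \<Rightarrow>\<^sub>0 'a)"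
  assumes "Vector_Spaces.linear pm_scale pm_scale T"
  shows "Vector_Spaces.linear pm_scale pm_scale (T ^^ j)"
proof (induction j)
  case 0
  show ?case by unfold_locales auto
next
  case (Suc j)
  from Vector_Spaces.linear_compose[OF Suc assms] show ?case by (simp add: o_def)
qed

text \<open>The assumption \<open>weights\<close> makes \<open>h\<close> diagonalizable with eigenvalues \<open>N, N - 2, \<dots>, - N\<close>, so no
  appeal to complete reducibility or to an algebraically closed field is needed.\<close>

locale sl2_weight_module =
  fixes e h f :: "('b \<Rightarrow>\<^sub>0 'a::field_char_0) \<Rightarrow> ('b \<Rightarrow>\<^sub>0 'a)" and V :: "('b \<Rightarrow>\<^sub>0 'a) set" and N :: nat
  assumes sl2: "sl2_module e h f V"
    and fin_dim: "\<exists>S. finite S \<and> V \<subseteq> pm.span S"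
    and weights: "v \<in> V \<Longrightarrow> \<exists>g. (\<forall>s. g s \<in> V \<and> h (g s) = pm_scale (of_int (int N - 2 * int s)) (g s)) \<and>
                                v = (\<Sum>s\<le>N. g s)"
begin

sublocale e: Vector_Spaces.linear pm_scale pm_scale e
  using sl2 by (simp add: sl2_module_def)
sublocale h: Vector_Spaces.linear pm_scale pm_scale h
  using sl2 by (simp add: sl2_module_def)
sublocale f: Vector_Spaces.linear pm_scale pm_scale f
  using sl2 by (simp add: sl2_module_def)
sublocale e_pow: Vector_Spaces.linear pm_scale pm_scale "e ^^ j" for j
  by (rule linear_funpow) (rule e.linear_axioms)
sublocale f_pow: Vector_Spaces.linear pm_scale pm_scale "f ^^ j" for j
  by (rule linear_funpow) (rule f.linear_axioms)

lemma V_subspace: "pm.subspace V"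
  and V_e: "v \<in> V \<Longrightarrow> e v \<in> V" and V_h: "v \<in> V \<Longrightarrow> h v \<in> V" and V_f: "v \<in> V \<Longrightarrow> f v \<in> V"
  using sl2 by (auto simp: sl2_module_def sl2_submodule_def)

lemma commutator:
  assumes "v \<in> V"
  shows "e (f v) = f (e v) + h v" "h (e v) = e (h v) + pm_scale 2 (e v)" "h (f v) = f (h v) - pm_scale 2 (f v)"
  using sl2 assms by (auto simp: sl2_module_def algebra_simps)

text \<open>The triple \<open>(f, -h, e)\<close> satisfies the same relations, so each fact about
  highest weight vectors and lifting along \<open>e\<close> also holds for lowest weight vectors and
  \<open>f\<close>.\<close>

lemma swap: "sl2_weight_module f (\<lambda>v. - h v) e V N"
proof
  show "sl2_module f (\<lambda>v. - h v) e V"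
    unfolding sl2_module_def sl2_submodule_def
    using V_subspace V_e V_h V_f
    by (auto simp: commutator e.linear_axioms f.linear_axioms pm.subspace_neg e.neg f.neg algebra_simps)
       (unfold_locales, auto simp: h.add h.scale)
  show "\<exists>S. finite S \<and> V \<subseteq> pm.span S" by (rule fin_dim)
  fix v assume "v \<in> V"
  from weights[OF this] obtain g where
    g: "\<And>s. g s \<in> V" "\<And>s. h (g s) = pm_scale (of_int (int N - 2 * int s)) (g s)" and v: "v = (\<Sum>s\<le>N. g s)"
    by blast
  \<comment> \<open>\<open>g (N - s)\<close> has weight \<open>N - 2 s\<close> for
    \<open>-h\<close>. Beyond \<open>N\<close> the subtraction is truncated, so the value there is
    0, which satisfies the eigenvalue condition for every \<open>s\<close>.\<close>
  define g' where "g' s = (if s \<le> N then g (N - s) else 0)" for s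
  have "v = (\<Sum>s\<le>N. g' s)"
    unfolding v g'_def by (rule sum.reindex_bij_witness[of _ "\<lambda>s. N - s" "\<lambda>s. N - s"]) auto
  moreover have "g' s \<in> V" "- h (g' s) = pm_scale (of_int (int N - 2 * int s)) (g' s)" for s
    using g(1) V_subspace
    by (auto simp: g'_def g(2) pm.subspace_0 of_nat_diff simp flip: pm.scale_minus_left)
  ultimately show "\<exists>g. (\<forall>s. g s \<in> V \<and> - h (g s) = pm_scale (of_int (int N - 2 * int s)) (g s)) \<and>
                                v = (\<Sum>s\<le>N. g s)" by blast
qed

section \<open>Weight spaces\<close>

definition wt_space :: "int \<Rightarrow> ('b \<Rightarrow>\<^sub>0 'a) set" where
  "wt_space \<mu> = {v \<in> V. h v = pm_scale (of_int \<mu>) v}"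

lemma wt_spaceD: "v \<in> wt_space \<mu> \<Longrightarrow> v \<in> V" "v \<in> wt_space \<mu> \<Longrightarrow> h v = pm_scale (of_int \<mu>) v"
  by (auto simp: wt_space_def)

lemma wt_space_subspace: "pm.subspace (wt_space \<mu>)"
  using V_subspace
  by (auto simp: pm.subspace_def wt_space_def h.add h.scale pm.scale_right_distrib mult.commute)

lemma wt_space_e: "v \<in> wt_space \<mu> \<Longrightarrow> e v \<in> wt_space (\<mu> + 2)"
  and wt_space_f: "v \<in> wt_space \<mu> \<Longrightarrow> f v \<in> wt_space (\<mu> - 2)"
  by (auto simp: wt_space_def V_e V_f commutator e.scale f.scale pm.scale_left_distrib pm.scale_left_diff_distrib)

lemma wt_space_e_pow: "v \<in> wt_space \<mu> \<Longrightarrow> (e ^^ j) v \<in> wt_space (\<mu> + 2 * int j)"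
proof (induction j)
  case (Suc j)
  then show ?case using wt_space_e[of "(e ^^ j) v" "\<mu> + 2 * int j"] by (simp add: algebra_simps)
qed simp

lemma wt_space_f_pow: "v \<in> wt_space \<mu> \<Longrightarrow> (f ^^ j) v \<in> wt_space (\<mu> - 2 * int j)"
proof (induction j)
  case (Suc j)
  then show ?case using wt_space_f[of "(f ^^ j) v" "\<mu> - 2 * int j"] by (simp add: algebra_simps)
qed simp

text \<open>Applying \<open>h - t\<close> removes the component of weight \<open>t\<close> and
  multiplies each other one by the nonzero scalar \<open>\<mu> - t\<close>, so induction on
  \<open>S\<close> applies. For \<open>X = {0}\<close> this is the independence of weight spaces;
  for a submodule it says that the submodule is graded.\<close>

lemma weight_components:
  assumes X: "pm.subspace X" "h ` X \<subseteq> X"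
    and S: "finite S" and g: "\<And>\<mu>. \<mu> \<in> S \<Longrightarrow> g \<mu> \<in> wt_space \<mu>"
    and sum: "(\<Sum>\<mu>\<in>S. g \<mu>) \<in> X"
  shows "\<forall>\<mu>\<in>S. g \<mu> \<in> X"
  using S g sum
proof (induction S arbitrary: g rule: finite_induct)
  case (insert t S)
  let ?v = "\<Sum>\<mu>\<in>insert t S. g \<mu>"
  have "h ?v - pm_scale (of_int t) ?v = (\<Sum>\<mu>\<in>S. pm_scale (of_int (\<mu> - t)) (g \<mu>))"
  proof -
    have "h ?v - pm_scale (of_int t) ?v = (\<Sum>\<mu>\<in>insert t S. h (g \<mu>) - pm_scale (of_int t) (g \<mu>))"
      by (simp only: h.sum pm.scale_sum_right sum_subtractf)
    also have "\<dots> = (\<Sum>\<mu>\<in>insert t S. pm_scale (of_int (\<mu> - t)) (g \<mu>))"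
      using insert.prems(1) by (intro sum.cong) (auto simp: wt_spaceD pm.scale_left_diff_distrib)
    finally show ?thesis using insert.hyps by simp
  qed
  moreover have "h ?v - pm_scale (of_int t) ?v \<in> X"
    using insert.prems(2) X by (intro pm.subspace_diff pm.subspace_scale) auto
  ultimately have "\<forall>\<mu>\<in>S. pm_scale (of_int (\<mu> - t)) (g \<mu>) \<in> X"
    using insert.prems(1) by (intro insert.IH) (auto intro: pm.subspace_scale wt_space_subspace)
  then have "pm_scale (inverse (of_int (\<mu> - t))) (pm_scale (of_int (\<mu> - t)) (g \<mu>)) \<in> X" if "\<mu> \<in> S" for \<mu>
    using that by (intro pm.subspace_scale[OF X(1), of "pm_scale _ _"]) blast
  moreover have "(of_int (\<mu> - t) :: 'a) \<noteq> 0" if "\<mu> \<in> S" for \<mu>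
    using that insert.hyps by (subst of_int_eq_0_iff) auto
  ultimately have S: "\<forall>\<mu>\<in>S. g \<mu> \<in> X" by (simp del: of_int_diff)
  then have "?v - (\<Sum>\<mu>\<in>S. g \<mu>) \<in> X"
    using X(1) by (intro pm.subspace_diff[OF X(1) insert.prems(2)] pm.subspace_sum) auto
  moreover have "?v - (\<Sum>\<mu>\<in>S. g \<mu>) = g t" using insert.hyps by simp
  ultimately show ?case using S by auto
qed simp

lemma zero_stable: "pm.subspace {0}" "h ` {0} \<subseteq> {0}"
  by (auto simp: pm.subspace_def)

text \<open>Grouping the \<open>y i\<close> by weight and subtracting \<open>x\<close> at
  \<open>\<mu>\<close> gives weight vectors with sum zero, so each of them vanishes.\<close>

lemma weight_part:
  assumes "finite I" "\<And>i. i \<in> I \<Longrightarrow> y i \<in> wt_space (\<omega> i)" and x: "x \<in> wt_space \<mu>" "x = (\<Sum>i\<in>I. y i)"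
  shows "x = (\<Sum>i\<in>{i\<in>I. \<omega> i = \<mu>}. y i)"
proof -
  let ?S = "insert \<mu> (\<omega> ` I)"
  define g where "g \<nu> = (\<Sum>i\<in>{i\<in>I. \<omega> i = \<nu>}. y i) - (if \<nu> = \<mu> then x else 0)" for \<nu>
  have "(\<Sum>\<nu>\<in>?S. \<Sum>i\<in>{i\<in>I. \<omega> i = \<nu>}. y i) = (\<Sum>i\<in>I. y i)"
    using assms(1) by (intro sum.group) auto
  then have "(\<Sum>\<nu>\<in>?S. g \<nu>) = 0"
    using assms(1) x(2) by (simp only: g_def sum_subtractf) (simp add: sum.delta)
  moreover have "g \<nu> \<in> wt_space \<nu>" for \<nu>
    unfolding g_def using assms(2) x(1)
    by (intro pm.subspace_diff pm.subspace_sum wt_space_subspace) (auto intro: pm.subspace_0 wt_space_subspace)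
  ultimately have "g \<mu> = 0"
    using weight_components[OF zero_stable, of ?S g] assms(1) by auto
  then show ?thesis by (simp add: g_def)
qed

lemma V_weights:
  assumes "v \<in> V"
  obtains g where "\<And>\<mu>. g \<mu> \<in> wt_space \<mu>" "v = (\<Sum>\<mu>\<in>(\<lambda>s. int N - 2 * int s) ` {..N}. g \<mu>)"
proof -
  obtain g where
    g: "\<And>s. g s \<in> V" "\<And>s. h (g s) = pm_scale (of_int (int N - 2 * int s)) (g s)" and v: "v = (\<Sum>s\<le>N. g s)"
    using weights[OF assms] by blast
  define g' where "g' \<mu> = (if \<exists>s. \<mu> = int N - 2 * int s then g (nat ((int N - \<mu>) div 2)) else 0)" for \<mu>
  have "g' \<mu> \<in> wt_space \<mu>" for \<mu>
    using g pm.subspace_0[OF wt_space_subspace] by (auto simp: g'_def wt_space_def)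
  moreover have "inj_on (\<lambda>s. int N - 2 * int s) {..N}" by (auto simp: inj_on_def)
  then have "v = (\<Sum>\<mu>\<in>(\<lambda>s. int N - 2 * int s) ` {..N}. g' \<mu>)"
    by (simp add: sum.reindex v g'_def)
  ultimately show ?thesis using that by blast
qed

text \<open>At any other weight the matching part of the decomposition of \<open>v\<close> is an
  empty sum. Both the bound \<open>N\<close> and the parity of the weights come from here.\<close>

lemma weight_form:
  assumes "v \<in> wt_space \<mu>" "v \<noteq> 0"
  obtains s where "s \<le> N" "\<mu> = int N - 2 * int s"
proof -
  let ?S = "(\<lambda>s. int N - 2 * int s) ` {..N}"
  obtain g where "\<And>\<mu>. g \<mu> \<in> wt_space \<mu>" "v = (\<Sum>\<mu>\<in>?S. g \<mu>)"
    using V_weights wt_spaceD(1)[OF assms(1)] by blast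
  then have v: "v = (\<Sum>i\<in>{i\<in>?S. i = \<mu>}. g i)"
    using assms(1) by (intro weight_part) auto
  have "\<mu> \<in> ?S"
  proof (rule ccontr)
    assume "\<mu> \<notin> ?S"
    then have "{i\<in>?S. i = \<mu>} = {}" by blast
    then show False using v assms(2) by (metis sum.empty)
  qed
  then show ?thesis using that by blast
qed

lemma wt_space_bound:
  assumes "v \<in> wt_space \<mu>" "\<bar>\<mu>\<bar> > int N"
  shows "v = 0"
proof (rule ccontr)
  assume "v \<noteq> 0"
  with assms(1) obtain s where "s \<le> N" "\<mu> = int N - 2 * int s" by (rule weight_form)
  then show False using assms(2) by linarith
qed

subsection \<open>Highest weight vectors\<close>

definition hw_space :: "int \<Rightarrow> ('b \<Rightarrow>\<^sub>0 'a) set" where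
  "hw_space l = {u \<in> wt_space l. e u = 0}"

lemma hw_spaceD: "u \<in> hw_space l \<Longrightarrow> u \<in> wt_space l" "u \<in> hw_space l \<Longrightarrow> e u = 0" "u \<in> hw_space l \<Longrightarrow> u \<in> V"
  by (auto simp: hw_space_def wt_space_def)

text \<open>Moving \<open>e\<close> past each \<open>f\<close> adds the weight met there, and l +
  (l-2) + ... + (l-2j) = (j+1)(l-j).\<close>

lemma e_f_pow:
  assumes "u \<in> hw_space l"
  shows "e ((f ^^ Suc j) u) = pm_scale (of_int ((int j + 1) * (l - int j))) ((f ^^ j) u)"
proof (induction j)
  case 0
  show ?case using assms by (simp add: hw_spaceD wt_spaceD commutator)
next
  case (Suc j)
  note w = wt_space_f_pow[OF hw_spaceD(1)[OF assms], of "Suc j"]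
  have "e ((f ^^ Suc (Suc j)) u) = f (e ((f ^^ Suc j) u)) + h ((f ^^ Suc j) u)"
    using commutator(1)[OF wt_spaceD(1)[OF w]] by simp
  also have "\<dots> = pm_scale (of_int ((int j + 1) * (l - int j)) + of_int (l - 2 * int (Suc j))) ((f ^^ Suc j) u)"
    unfolding Suc wt_spaceD(2)[OF w] by (simp add: f.scale pm.scale_left_distrib)
  finally show ?case by (simp add: algebra_simps)
qed

text \<open>For negative \<open>l\<close> the factors (j+1)(l-j) never vanish, so no power of
  \<open>f\<close> could kill \<open>u\<close>; but weights below \<open>-N\<close> do not
  occur.\<close>

lemma hw_weight_nonneg:
  assumes "u \<in> hw_space l" "u \<noteq> 0"
  shows "l \<ge> 0"
proof (rule ccontr)
  assume "\<not> l \<ge> 0"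
  then have nz: "(of_int ((int j + 1) * (l - int j)) :: 'a) \<noteq> 0" for j
    by (subst of_int_eq_0_iff) auto
  have "(f ^^ j) u \<noteq> 0" for j
  proof (induction j)
    case (Suc j)
    show ?case
    proof
      assume "(f ^^ Suc j) u = 0"
      then have "pm_scale (of_int ((int j + 1) * (l - int j))) ((f ^^ j) u) = 0"
        using e_f_pow[OF assms(1), of j] by simp
      then show False using Suc nz[of j] by (simp only: pm.scale_eq_0_iff) blast
    qed
  qed (use assms in simp)
  moreover have "(f ^^ Suc N) u = 0"
    using \<open>\<not> l \<ge> 0\<close> by (intro wt_space_bound[OF wt_space_f_pow[OF hw_spaceD(1)[OF assms(1)]]]) auto
  ultimately show False by blast
qed

text \<open>At j = l the factor in \<open>e_f_pow\<close> vanishes, so f^(l+1) u is again killed by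
  \<open>e\<close>, now with weight -l-2 < 0, hence zero.\<close>

lemma f_pow_eq_0:
  assumes u: "u \<in> hw_space l" and "int j > l"
  shows "(f ^^ j) u = 0"
proof (cases "u = 0")
  case False
  then have l: "l \<ge> 0" using u by (rule hw_weight_nonneg[rotated])
  define i where "i = nat l"
  have i: "l = int i" using l by (simp add: i_def)
  have "(f ^^ Suc i) u \<in> hw_space (l - 2 * int (Suc i))"
    using wt_space_f_pow[OF hw_spaceD(1)[OF u], of "Suc i"] e_f_pow[OF u, of i]
    by (simp add: hw_space_def i)
  then have 0: "(f ^^ Suc i) u = 0" using hw_weight_nonneg i by fastforce
  have "j = (j - Suc i) + Suc i" using assms(2) i by simp
  then have "(f ^^ j) u = (f ^^ (j - Suc i)) ((f ^^ Suc i) u)" by (metis comp_apply funpow_add)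
  then show ?thesis using 0 by (simp add: f_pow.zero)
qed (simp add: f_pow.zero)

text \<open>The scalar is the product of the factors (i+1)(l-i) over i < J.\<close>

lemma e_pow_f_pow:
  assumes "u \<in> hw_space l"
  shows "\<exists>c. (e ^^ J) ((f ^^ J) u) = pm_scale c u \<and> (int J \<le> l \<longrightarrow> c \<noteq> 0)"
proof (induction J)
  case 0
  show ?case by (rule exI[of _ 1]) simp
next
  case (Suc J)
  then obtain c where c: "(e ^^ J) ((f ^^ J) u) = pm_scale c u" "int J \<le> l \<longrightarrow> c \<noteq> 0" by blast
  let ?d = "of_int ((int J + 1) * (l - int J)) :: 'a"
  have "(e ^^ Suc J) ((f ^^ Suc J) u) = (e ^^ J) (e ((f ^^ Suc J) u))" by (simp only: funpow_Suc_right o_apply)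
  also have "\<dots> = pm_scale (?d * c) u" by (simp only: e_f_pow[OF assms] e_pow.scale c pm.scale_scale)
  finally have "(e ^^ Suc J) ((f ^^ Suc J) u) = pm_scale (?d * c) u" .
  moreover have "?d * c \<noteq> 0" if "int (Suc J) \<le> l"
  proof -
    have "?d \<noteq> 0" using that by (subst of_int_eq_0_iff) auto
    then show ?thesis using that c(2) by simp
  qed
  ultimately show ?case by blast
qed

lemma e_pow_f_pow_less:
  assumes u: "u \<in> hw_space l" and "j < J"
  shows "(e ^^ J) ((f ^^ j) u) = 0"
proof -
  obtain c where c: "(e ^^ j) ((f ^^ j) u) = pm_scale c u" using e_pow_f_pow[OF u] by blast
  have "J = (J - Suc j) + Suc j" using assms(2) by simp
  then have "(e ^^ J) ((f ^^ j) u) = (e ^^ (J - Suc j)) ((e ^^ Suc j) ((f ^^ j) u))"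
    by (metis comp_apply funpow_add)
  then show ?thesis using u by (simp add: c e.scale hw_spaceD e_pow.zero)
qed

text \<open>Reads off the top coefficient, since \<open>e ^^ J\<close> kills the terms with
  \<open>j < J\<close>. The scalar \<open>c\<close> depends on \<open>u\<close> and
  \<open>J\<close>, not on the coefficients.\<close>

lemma e_pow_leading:
  assumes u: "u \<in> hw_space l"
  obtains c where "\<And>a. (e ^^ J) (\<Sum>j<Suc J. pm_scale (a j) ((f ^^ j) u)) = pm_scale (a J * c) u" "int J \<le> l \<Longrightarrow> c \<noteq> 0"
proof -
  obtain c where c: "(e ^^ J) ((f ^^ J) u) = pm_scale c u" "int J \<le> l \<Longrightarrow> c \<noteq> 0" using e_pow_f_pow[OF u] by blast
  show ?thesis
  proof (rule that)
    fix a
    show "(e ^^ J) (\<Sum>j<Suc J. pm_scale (a j) ((f ^^ j) u)) = pm_scale (a J * c) u"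
      by (simp add: e_pow.sum e_pow.scale e_pow.add e_pow_f_pow_less[OF u] c)
  qed (rule c)
qed

subsection \<open>The module is spanned by the images of the highest weight vectors\<close>

definition hw_gen :: "int \<Rightarrow> ('b \<Rightarrow>\<^sub>0 'a) set" where
  "hw_gen \<mu> = {(f ^^ j) u | j u. u \<in> hw_space (\<mu> + 2 * int j)}"

text \<open>Downward induction on the weight: some \<open>m\<close> in the span has
  \<open>e m = e v\<close>, and \<open>v - m\<close> is then itself a highest weight vector. The
  lift exists because the divisor (j+1)(\<mu>+2+j) is nonzero for \<mu> \<ge> 0.\<close>

lemma wt_space_hw_gen:
  assumes "\<mu> \<ge> 0"
  shows "wt_space \<mu> \<subseteq> pm.span (hw_gen \<mu>)"
proof -
  \<comment> \<open>\<open>d\<close> measures the distance to the bound \<open>N\<close>; at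
    \<open>d = 0\<close> the weight space is zero, and raising the weight by 2 pays for one unit of
    \<open>d\<close>.\<close>
  have "wt_space \<mu> \<subseteq> pm.span (hw_gen \<mu>)" if "int N < \<mu> + int d" "\<mu> \<ge> 0" for d \<mu>
    using that
  proof (induction d arbitrary: \<mu>)
    case 0
    show ?case
    proof
      fix v assume "v \<in> wt_space \<mu>"
      then have "v = 0" by (rule wt_space_bound) (use 0 in linarith)
      then show "v \<in> pm.span (hw_gen \<mu>)" by (simp only: pm.span_zero)
    qed
  next
    case (Suc d)
    then have IH: "wt_space (\<mu> + 2) \<subseteq> pm.span (hw_gen (\<mu> + 2))" by simp
    have preimage: "\<exists>m\<in>pm.span (hw_gen \<mu>). e m = x" if "x \<in> pm.span (hw_gen (\<mu> + 2))" for x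
      using that
    proof (induction rule: pm.span_induct_alt)
      case base
      show ?case by (intro bexI[of _ 0]) (simp_all add: e.zero pm.span_zero)
    next
      case (step c x y)
      then obtain j u m where u: "u \<in> hw_space (\<mu> + 2 + 2 * int j)" "x = (f ^^ j) u"
        and m: "m \<in> pm.span (hw_gen \<mu>)" "e m = y"
        by (auto simp: hw_gen_def)
      let ?d = "of_int ((int j + 1) * (\<mu> + 2 + 2 * int j - int j)) :: 'a"
      have d: "?d \<noteq> 0" using Suc.prems by (subst of_int_eq_0_iff) auto
      have "(f ^^ Suc j) u \<in> hw_gen \<mu>"
        using u(1) unfolding hw_gen_def by (intro CollectI exI[of _ "Suc j"] exI[of _ u]) (simp add: algebra_simps)
      then have "pm_scale (c * inverse ?d) ((f ^^ Suc j) u) + m \<in> pm.span (hw_gen \<mu>)"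
        by (intro pm.span_add[OF pm.span_scale[OF pm.span_base] m(1)])
      moreover have "e (pm_scale (c * inverse ?d) ((f ^^ Suc j) u) + m) = pm_scale (c * inverse ?d * ?d) x + y"
        by (simp only: e.add e.scale e_f_pow[OF u(1)] pm.scale_scale m(2) u(2))
      ultimately show ?case using d by (metis (no_types, lifting) mult.assoc left_inverse mult_1_right)
    qed
    show ?case
    proof
      fix v assume v: "v \<in> wt_space \<mu>"
      then have "e v \<in> pm.span (hw_gen (\<mu> + 2))" using IH wt_space_e by blast
      then obtain m where m: "m \<in> pm.span (hw_gen \<mu>)" "e m = e v" using preimage by blast
      have "hw_gen \<mu> \<subseteq> wt_space \<mu>"
      proof
        fix x assume "x \<in> hw_gen \<mu>"
        then obtain j u where "u \<in> hw_space (\<mu> + 2 * int j)" "x = (f ^^ j) u" by (auto simp: hw_gen_def)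
        then show "x \<in> wt_space \<mu>" using wt_space_f_pow[OF hw_spaceD(1), of u "\<mu> + 2 * int j" j] by simp
      qed
      then have "m \<in> wt_space \<mu>" using m(1) wt_space_subspace pm.span_minimal by blast
      then have "v - m \<in> hw_space \<mu>"
        using v m(2) wt_space_subspace by (simp add: hw_space_def e.diff pm.subspace_diff)
      then have "v - m \<in> hw_gen \<mu>" unfolding hw_gen_def by (intro CollectI exI[of _ 0] exI[of _ "v - m"]) simp
      then have "(v - m) + m \<in> pm.span (hw_gen \<mu>)" using m(1) by (intro pm.span_add) (auto intro: pm.span_base)
      then show "v \<in> pm.span (hw_gen \<mu>)" by simp
    qed
  qed
  from this[of \<mu> "Suc N"] show ?thesis using assms by simp
qed

section \<open>Strings generated by highest weight vectors\<close>

definition hw_all :: "('b \<Rightarrow>\<^sub>0 'a) set" where "hw_all = (\<Union>l. hw_space l)"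

text \<open>For a highest weight vector this is the submodule generated by it. Allowing all powers
  makes stability under \<open>f\<close> immediate.\<close>

definition cyc :: "('b \<Rightarrow>\<^sub>0 'a) \<Rightarrow> ('b \<Rightarrow>\<^sub>0 'a) set" where
  "cyc u = pm.span (range (\<lambda>j. (f ^^ j) u))"

lemma self_in_cyc: "u \<in> cyc u"
  unfolding cyc_def by (intro pm.span_base image_eqI[of _ _ 0]) simp_all

lemma cyc_subspace: "pm.subspace (cyc u)"
  by (simp add: cyc_def)

lemma span_stable:
  assumes "Vector_Spaces.linear pm_scale pm_scale T" "\<And>x. x \<in> S \<Longrightarrow> T x \<in> pm.span S" "v \<in> pm.span S"
  shows "T v \<in> pm.span S"
proof -
  interpret T: Vector_Spaces.linear pm_scale pm_scale T by fact
  have "T ` pm.span S = pm.span (T ` S)" by (rule T.span_image[symmetric])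
  also have "\<dots> \<subseteq> pm.span S" using assms(2) by (intro pm.span_minimal) auto
  finally show ?thesis using assms(3) by blast
qed

lemma cyc_submodule:
  assumes u: "u \<in> hw_space l"
  shows "sl2_submodule e h f (cyc u)"
proof -
  let ?S = "range (\<lambda>j. (f ^^ j) u)"
  have b: "(f ^^ j) u \<in> pm.span ?S" for j by (rule pm.span_base) simp
  have "e v \<in> cyc u" if "v \<in> cyc u" for v
    using e.linear_axioms _ that unfolding cyc_def
  proof (rule span_stable)
    fix x assume "x \<in> ?S"
    then obtain j where x: "x = (f ^^ j) u" by blast
    show "e x \<in> pm.span ?S"
    proof (cases j)
      case 0
      then show ?thesis using x u by (simp add: hw_spaceD pm.span_zero)
    next
      case (Suc i)
      show ?thesis unfolding x Suc e_f_pow[OF u] by (intro pm.span_scale b)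
    qed
  qed
  moreover have "h v \<in> cyc u" if "v \<in> cyc u" for v
    using h.linear_axioms _ that unfolding cyc_def
    by (rule span_stable) (auto simp only: wt_spaceD(2)[OF wt_space_f_pow[OF hw_spaceD(1)[OF u]]] intro!: pm.span_scale b)
  moreover have "f v \<in> cyc u" if "v \<in> cyc u" for v
    using f.linear_axioms _ that unfolding cyc_def
  proof (rule span_stable)
    fix x assume "x \<in> ?S"
    then obtain j where "x = (f ^^ j) u" by blast
    then show "f x \<in> pm.span ?S" using b[of "Suc j"] by simp
  qed
  ultimately show ?thesis by (auto simp: sl2_submodule_def cyc_subspace)
qed

text \<open>Nonnegative weights are done. The span is stable under \<open>e\<close> and
  \<open>f\<close>, so for the negative ones the swapped triple reduces the claim to lowest weight
  vectors.\<close>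

lemma V_spanned: "V \<subseteq> pm.span (\<Union>u\<in>hw_all. cyc u)" (is "_ \<subseteq> pm.span ?G")
proof -
  have gen: "(f ^^ j) u \<in> ?G" if "u \<in> hw_space l" for j u l
    using that by (auto simp: hw_all_def cyc_def intro!: pm.span_base)
  have nonneg: "wt_space \<mu> \<subseteq> pm.span ?G" if "\<mu> \<ge> 0" for \<mu>
  proof -
    have "hw_gen \<mu> \<subseteq> ?G" using gen by (fastforce simp: hw_gen_def)
    then show ?thesis using wt_space_hw_gen[OF that] pm.span_mono by blast
  qed
  have stable: "T v \<in> pm.span ?G" if T: "Vector_Spaces.linear pm_scale pm_scale T"
    "\<And>W. sl2_submodule e h f W \<Longrightarrow> T ` W \<subseteq> W" and v: "v \<in> pm.span ?G" for T v
    using T(1) _ v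
  proof (rule span_stable)
    fix x assume "x \<in> ?G"
    then obtain u l where "u \<in> hw_space l" "x \<in> cyc u" "u \<in> hw_all" by (auto simp: hw_all_def)
    then have "T x \<in> cyc u" "u \<in> hw_all" using T(2)[OF cyc_submodule] by auto
    then show "T x \<in> pm.span ?G" by (intro pm.span_base) blast
  qed
  have Ge: "e v \<in> pm.span ?G" if "v \<in> pm.span ?G" for v
    by (rule stable[OF e.linear_axioms _ that]) (simp add: sl2_submodule_def)
  have Gf: "f v \<in> pm.span ?G" if "v \<in> pm.span ?G" for v
    by (rule stable[OF f.linear_axioms _ that]) (simp add: sl2_submodule_def)
  have Ge': "(e ^^ j) v \<in> pm.span ?G" if "v \<in> pm.span ?G" for v j using that by (induction j) (auto intro: Ge)
  have Gf': "(f ^^ j) v \<in> pm.span ?G" if "v \<in> pm.span ?G" for v j using that by (induction j) (auto intro: Gf)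
  interpret sw: sl2_weight_module f "\<lambda>v. - h v" e V N by (rule swap)
  have sw_wt: "sw.wt_space \<mu> = wt_space (- \<mu>)" for \<mu>
  proof -
    have "- h v = pm_scale (of_int \<mu>) v \<longleftrightarrow> h v = pm_scale (of_int (- \<mu>)) v" for v
      by (simp add: minus_equation_iff[of "h v"] eq_commute)
    then show ?thesis by (simp only: sw.wt_space_def wt_space_def)
  qed
  have lowest: "w \<in> pm.span ?G" if w: "w \<in> sw.hw_space l" for w l
  proof (cases "w = 0")
    case False
    then have l: "l \<ge> 0" using w by (rule sw.hw_weight_nonneg[rotated])
    from sw.e_pow_f_pow[OF w, of "nat l"] l obtain c
      where c: "(f ^^ nat l) ((e ^^ nat l) w) = pm_scale c w" "c \<noteq> 0" by auto
    \<comment> \<open>\<open>w\<close> has weight \<open>-l\<close>, so this vector has weight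
      \<open>l \<ge> 0\<close> and is already covered; \<open>f ^^ nat l\<close> brings it back to a
      nonzero multiple of \<open>w\<close>.\<close>
    have "(e ^^ nat l) w \<in> wt_space (- l + 2 * int (nat l))"
      using w sw_wt by (intro wt_space_e_pow) (auto dest: sw.hw_spaceD)
    then have "(e ^^ nat l) w \<in> pm.span ?G" using l nonneg[of l] by auto
    from pm.span_scale[OF Gf'[OF this, of "nat l"], of "inverse c"] c show ?thesis by simp
  qed (simp add: pm.span_zero)
  have "wt_space \<mu> \<subseteq> pm.span ?G" for \<mu>
  proof (cases "\<mu> \<ge> 0")
    case False
    then have "wt_space \<mu> \<subseteq> pm.span (sw.hw_gen (- \<mu>))" using sw.wt_space_hw_gen[of "- \<mu>"] sw_wt[of "- \<mu>"] by simp
    also have "\<dots> \<subseteq> pm.span ?G"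
      by (intro pm.span_minimal) (auto simp: sw.hw_gen_def intro: Ge' lowest)
    finally show ?thesis .
  qed (rule nonneg)
  then show ?thesis
    by (metis (no_types, lifting) V_weights pm.span_sum subset_iff)
qed

subsection \<open>Decompositions\<close>

text \<open>The upper limit \<open>J\<close> is free so that strings of different lengths can share
  one range; the coefficients past \<open>l\<close> are set to zero because the powers vanish
  there.\<close>

lemma cyc_expansion:
  assumes u: "u \<in> hw_space (int l)" and x: "x \<in> cyc u" and J: "l < J"
  shows "\<exists>a. (\<forall>j>l. a j = 0) \<and> x = (\<Sum>j<J. pm_scale (a j) ((f ^^ j) u))"
  using x unfolding cyc_def
proof (induction rule: pm.span_induct_alt)
  case base
  show ?case by (rule exI[of _ "\<lambda>_. 0"]) simp
next
  case (step c x y)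
  then obtain i a where x: "x = (f ^^ i) u" and a: "\<forall>j>l. a j = 0" and y: "y = (\<Sum>j<J. pm_scale (a j) ((f ^^ j) u))"
    by blast
  show ?case
  proof (cases "i \<le> l")
    case True
    let ?a = "\<lambda>j. (if j = i then c else 0) + a j"
    have "(\<Sum>j<J. pm_scale (if j = i then c else 0) ((f ^^ j) u)) = (\<Sum>j<J. if j = i then pm_scale c ((f ^^ j) u) else 0)"
      by (intro sum.cong) auto
    then have "(\<Sum>j<J. pm_scale (?a j) ((f ^^ j) u)) = pm_scale c x + y"
      using True J x y by (simp add: pm.scale_left_distrib sum.distrib)
    then show ?thesis using a True by (intro exI[of _ ?a]) auto
  next
    case False
    then have "x = 0" unfolding x by (intro f_pow_eq_0[OF u]) simp
    then show ?thesis using a y by auto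
  qed
qed

lemma cyc_least:
  assumes "pm.subspace X" "f ` X \<subseteq> X" "u \<in> X"
  shows "cyc u \<subseteq> X"
proof -
  have "(f ^^ j) u \<in> X" for j by (induction j) (use assms in auto)
  then show ?thesis unfolding cyc_def by (intro pm.span_minimal assms(1)) auto
qed

lemma cyc_subset: "u \<in> hw_space l \<Longrightarrow> cyc u \<subseteq> V"
  by (rule cyc_least) (auto simp: V_subspace V_f dest: hw_spaceD)

text \<open>\<open>J\<close> is the largest index with a nonzero coefficient, so
  \<open>e ^^ J\<close> leaves only the leading term. The clause on \<open>J = 0\<close> serves
  elements killed by \<open>e\<close>, for which no positive \<open>J\<close> can occur.\<close>

lemma cyc_leading:
  assumes u: "u \<in> hw_space (int l)" and x: "x \<in> cyc u" "x \<noteq> 0"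
  obtains J c where "(e ^^ J) x = pm_scale c u" "c \<noteq> 0" "J = 0 \<Longrightarrow> x = pm_scale c u"
proof -
  obtain a where a: "\<forall>j>l. a j = 0" "x = (\<Sum>j<Suc l. pm_scale (a j) ((f ^^ j) u))"
    using cyc_expansion[OF u x(1), of "Suc l"] by auto
  let ?A = "{j. a j \<noteq> 0}"
  have fin: "finite ?A" by (rule finite_subset[of _ "{..l}"]) (use a(1) not_le in auto)
  have "?A \<noteq> {}"
  proof
    assume "?A = {}"
    then have "\<forall>j. a j = 0" by blast
    then have "x = 0" unfolding a(2) by (intro sum.neutral) simp
    then show False using x(2) by blast
  qed
  then have J: "a (Max ?A) \<noteq> 0" using Max_in[OF fin] by blast
  define J where "J = Max ?A"
  have le: "J \<le> l" using a(1) J not_le unfolding J_def by blast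
  have gt: "a j = 0" if "j > J" for j using that Max_ge[OF fin, of j] unfolding J_def by fastforce
  have x_eq: "x = (\<Sum>j<Suc J. pm_scale (a j) ((f ^^ j) u))"
    unfolding a(2) by (rule sum.mono_neutral_right) (use le gt in auto)
  obtain d where "\<And>a. (e ^^ J) (\<Sum>j<Suc J. pm_scale (a j) ((f ^^ j) u)) = pm_scale (a J * d) u" "int J \<le> int l \<Longrightarrow> d \<noteq> 0"
    using e_pow_leading[OF u, of J] by blast
  then have "(e ^^ J) x = pm_scale (a J * d) u" "a J * d \<noteq> 0" using x_eq J le by (auto simp: J_def)
  then show ?thesis using that[of J "a J * d"] x_eq by (metis funpow_0)
qed

lemma cyc_irreducible:
  assumes u: "u \<in> hw_space (int l)" "u \<noteq> 0"
  shows "sl2_irreducible e h f (cyc u)"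
  unfolding sl2_irreducible_def
proof (intro conjI allI impI)
  show "sl2_submodule e h f (cyc u)" by (rule cyc_submodule[OF u(1)])
  show "cyc u \<noteq> {0}" using self_in_cyc u(2) by blast
  fix X assume "sl2_submodule e h f X \<and> X \<subseteq> cyc u"
  then have X: "pm.subspace X" "e ` X \<subseteq> X" "f ` X \<subseteq> X" "X \<subseteq> cyc u" by (auto simp: sl2_submodule_def)
  show "X = {0} \<or> X = cyc u"
  proof (cases "X = {0}")
    case False
    then obtain x where x: "x \<in> X" "x \<noteq> 0" using pm.subspace_0[OF X(1)] by blast
    then have "x \<in> cyc u" using X(4) by blast
    then obtain J c where c: "(e ^^ J) x = pm_scale c u" "c \<noteq> 0" by (rule cyc_leading[OF u(1) _ x(2)])
    have "(e ^^ J) x \<in> X" by (induction J) (use x X(2) in auto)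
    from pm.subspace_scale[OF X(1) this, of "inverse c"] have "u \<in> X" using c by simp
    then have "cyc u \<subseteq> X" by (rule cyc_least[OF X(1,3)])
    then show ?thesis using X(4) by blast
  qed simp
qed

text \<open>\<open>W\<close> contains a nonzero weight vector, and its last nonzero image under
  powers of \<open>e\<close> is a highest weight vector \<open>u\<close>. Irreducibility gives
  \<open>W = cyc u\<close>, where the kernel of \<open>e\<close> is the line through
  \<open>u\<close>.\<close>

lemma irreducible_kernel:
  assumes W: "sl2_irreducible e h f W" "W \<subseteq> V"
  obtains u where "u \<in> W" "u \<noteq> 0" "e u = 0" "\<And>x. x \<in> W \<Longrightarrow> e x = 0 \<Longrightarrow> x \<in> pm.span {u}"
proof -
  have sub: "pm.subspace W" "e ` W \<subseteq> W" "h ` W \<subseteq> W" "f ` W \<subseteq> W" "W \<noteq> {0}"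
    and min: "\<And>X. sl2_submodule e h f X \<Longrightarrow> X \<subseteq> W \<Longrightarrow> X = {0} \<or> X = W"
    using W(1) by (auto simp: sl2_irreducible_def sl2_submodule_def)
  obtain v where v: "v \<in> W" "v \<noteq> 0" using sub(1,5) pm.subspace_0 by blast
  then have "v \<in> V" using W(2) by blast
  then obtain g where g: "\<And>\<mu>. g \<mu> \<in> wt_space \<mu>" "v = (\<Sum>\<mu>\<in>(\<lambda>s. int N - 2 * int s) ` {..N}. g \<mu>)"
    by (rule V_weights) blast
  have "\<forall>\<mu>\<in>(\<lambda>s. int N - 2 * int s) ` {..N}. g \<mu> \<in> W"
    by (rule weight_components[OF sub(1,3)]) (use g v in auto)
  moreover have "\<exists>\<mu>\<in>(\<lambda>s. int N - 2 * int s) ` {..N}. g \<mu> \<noteq> 0"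
    using g(2) v(2) by (metis (no_types, lifting) sum.neutral)
  ultimately obtain \<mu> where mu: "g \<mu> \<in> W" "g \<mu> \<noteq> 0" by blast
  \<comment> \<open>This exponent lifts the weight above \<open>N\<close>, whatever the sign of
    \<open>\<mu>\<close>.\<close>
  have "(e ^^ (N + nat \<bar>\<mu>\<bar> + 1)) (g \<mu>) = 0"
    by (rule wt_space_bound[OF wt_space_e_pow[OF g(1)]]) (use abs_ge_minus_self[of \<mu>] in \<open>simp add: algebra_simps\<close>)
  then obtain j where j: "(e ^^ Suc j) (g \<mu>) = 0" "(e ^^ j) (g \<mu>) \<noteq> 0"
    using mu(2) ex_least_nat_less[of "\<lambda>n. (e ^^ n) (g \<mu>) = 0" "N + nat \<bar>\<mu>\<bar> + 1"] by auto
  define u where "u = (e ^^ j) (g \<mu>)"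
  have u: "u \<noteq> 0" "u \<in> hw_space (\<mu> + 2 * int j)"
    using j wt_space_e_pow[OF g(1)] by (auto simp: u_def hw_space_def)
  then have "\<mu> + 2 * int j \<ge> 0" by (intro hw_weight_nonneg)
  then obtain l where l: "u \<in> hw_space (int l)" using u(2) by (metis nonneg_int_cases)
  have uW: "u \<in> W" unfolding u_def by (induction j) (use mu(1) sub(2) in auto)
  have "cyc u = W"
    using min[OF cyc_submodule[OF l] cyc_least[OF sub(1,4) uW]] self_in_cyc u(1) by blast
  have "x \<in> pm.span {u}" if "x \<in> W" "e x = 0" for x
  proof (cases "x = 0")
    case False
    have "x \<in> cyc u" using that \<open>cyc u = W\<close> by simp
    then obtain J c where c: "(e ^^ J) x = pm_scale c u" "c \<noteq> 0" "J = 0 \<Longrightarrow> x = pm_scale c u"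
      by (rule cyc_leading[OF l _ False]) blast
    have "J = 0"
    proof (rule ccontr)
      assume "J \<noteq> 0"
      then have "(e ^^ J) x = (e ^^ (J - 1)) (e x)" by (metis Suc_pred' comp_apply funpow_Suc_right not_gr_zero)
      then show False using that(2) c u(1) by (simp add: e_pow.zero)
    qed
    then show ?thesis using c(3) by (auto intro: pm.span_scale pm.span_base)
  qed (simp add: pm.span_zero)
  then show ?thesis using that uW u hw_spaceD(2) by blast
qed

text \<open>Since \<open>e\<close> preserves the summands of a direct sum, \<open>e v = 0\<close>
  holds componentwise, and one kernel vector from each summand gives a basis of the kernel.\<close>

lemma dim_kernel_eq_card:
  assumes "sl2_decomposition e h f V \<W>"
  shows "pm.dim {v \<in> V. e v = 0} = card \<W>"
proof -
  have fin: "finite \<W>" and W: "\<And>W. W \<in> \<W> \<Longrightarrow> W \<subseteq> V" "\<And>W. W \<in> \<W> \<Longrightarrow> sl2_irreducible e h f W"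
    and ex1: "\<And>v. v \<in> V \<Longrightarrow> \<exists>!g. g \<in> (\<Pi>\<^sub>E W\<in>\<W>. W) \<and> v = (\<Sum>W\<in>\<W>. g W)"
    using assms by (auto simp: sl2_decomposition_def)
  have sub: "pm.subspace W" "e ` W \<subseteq> W" if "W \<in> \<W>" for W
    using W(2)[OF that] by (auto simp: sl2_irreducible_def sl2_submodule_def)
  \<comment> \<open>Uniqueness of the expansion of 0, applied to restrictions because the functions
    in \<open>\<Pi>\<^sub>E\<close> have a fixed value outside \<open>\<W>\<close>.\<close>
  have direct: "w W = 0" if "\<And>W. W \<in> \<W> \<Longrightarrow> w W \<in> W" "(\<Sum>W\<in>\<W>. w W) = 0" "W \<in> \<W>" for w W
  proof -
    have 1: "restrict w \<W> \<in> (\<Pi>\<^sub>E W\<in>\<W>. W) \<and> 0 = (\<Sum>W\<in>\<W>. restrict w \<W> W)"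
      using that(1,2) by auto
    have 2: "restrict (\<lambda>_. 0) \<W> \<in> (\<Pi>\<^sub>E W\<in>\<W>. W) \<and> 0 = (\<Sum>W\<in>\<W>. restrict (\<lambda>_. 0) \<W> W)"
      using sub(1) pm.subspace_0 by auto
    have "a = b" if "a \<in> (\<Pi>\<^sub>E W\<in>\<W>. W) \<and> 0 = (\<Sum>W\<in>\<W>. a W)" "b \<in> (\<Pi>\<^sub>E W\<in>\<W>. W) \<and> 0 = (\<Sum>W\<in>\<W>. b W)" for a b
      using ex1[OF pm.subspace_0[OF V_subspace]] that by blast
    from this[OF 1 2] have "restrict w \<W> = restrict (\<lambda>_. 0) \<W>" .
    then show ?thesis using that(3) by (metis restrict_apply')
  qed
  have "\<forall>W\<in>\<W>. \<exists>u. u \<in> W \<and> u \<noteq> 0 \<and> e u = 0 \<and> (\<forall>x\<in>W. e x = 0 \<longrightarrow> x \<in> pm.span {u})"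
    using irreducible_kernel[OF W(2) W(1)] by metis
  then obtain u where u: "\<And>W. W \<in> \<W> \<Longrightarrow> u W \<in> W" "\<And>W. W \<in> \<W> \<Longrightarrow> u W \<noteq> 0" "\<And>W. W \<in> \<W> \<Longrightarrow> e (u W) = 0"
    "\<And>W x. W \<in> \<W> \<Longrightarrow> x \<in> W \<Longrightarrow> e x = 0 \<Longrightarrow> x \<in> pm.span {u W}"
    by metis
  have zero: "a W = 0" if "(\<Sum>W\<in>\<W>. pm_scale (a W) (u W)) = 0" "W \<in> \<W>" for a W
    using direct[of "\<lambda>W. pm_scale (a W) (u W)" W] that u sub pm.subspace_scale by (metis (mono_tags, lifting) pm.scale_eq_0_iff)
  have inj: "inj_on u \<W>"
  proof (rule inj_onI, rule ccontr)
    fix W W' assume *: "W \<in> \<W>" "W' \<in> \<W>" "u W = u W'" "W \<noteq> W'"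
    let ?a = "\<lambda>X. (if X = W then 1 else 0) - (if X = W' then 1 else 0) :: 'a"
    have "(\<Sum>X\<in>\<W>. pm_scale (?a X) (u X)) = (\<Sum>X\<in>\<W>. (if X = W then u X else 0) - (if X = W' then u X else 0))"
      by (intro sum.cong) (auto simp: *(4))
    also have "\<dots> = 0" using * fin by (simp add: sum_subtractf)
    finally have "?a W = 0" using *(1) by (rule zero)
    then show False using *(4) by simp
  qed
  have "card (u ` \<W>) = pm.dim {v \<in> V. e v = 0}"
  proof (rule pm.basis_card_eq_dim)
    show "u ` \<W> \<subseteq> {v \<in> V. e v = 0}" using u W(1) by blast
    show "{v \<in> V. e v = 0} \<subseteq> pm.span (u ` \<W>)"
    proof
      fix v assume v: "v \<in> {v \<in> V. e v = 0}"
      then obtain g where g: "g \<in> (\<Pi>\<^sub>E W\<in>\<W>. W)" "v = (\<Sum>W\<in>\<W>. g W)" using ex1[of v] by blast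
      have "(\<Sum>W\<in>\<W>. e (g W)) = 0" using v g(2) by (simp add: e.sum)
      then have "e (g W) = 0" if "W \<in> \<W>" for W
        using direct[of "\<lambda>W. e (g W)", OF _ _ that] g(1) sub(2) by blast
      then have "g W \<in> pm.span {u W}" if "W \<in> \<W>" for W using that g(1) u(4) by blast
      then have "g W \<in> pm.span (u ` \<W>)" if "W \<in> \<W>" for W
        using that pm.span_mono[of "{u W}" "u ` \<W>"] by blast
      then show "v \<in> pm.span (u ` \<W>)" unfolding g(2) by (intro pm.span_sum)
    qed
    show "pm.independent (u ` \<W>)"
    proof (rule pm.independent_if_scalars_zero)
      fix a x assume "(\<Sum>v\<in>u ` \<W>. pm_scale (a v) v) = 0" "x \<in> u ` \<W>"
      then show "a x = 0" using zero[of "\<lambda>W. a (u W)"] by (auto simp: sum.reindex[OF inj])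
    qed (use fin in simp)
  qed
  then show ?thesis by (simp add: card_image[OF inj])
qed

text \<open>Coefficients are removed from the top power of \<open>f\<close> downwards:
  \<open>e ^^ J\<close> turns the relation into one among the \<open>b\<close> themselves, which are
  independent. Where \<open>J > \<omega> b\<close> the resulting scalar may vanish, but there the
  coefficient is zero by choice.\<close>

lemma cyc_direct:
  assumes fin: "finite B" and ind: "pm.independent B" and B: "\<And>b. b \<in> B \<Longrightarrow> b \<in> hw_space (int (\<omega> b))"
    and w: "\<And>b. b \<in> B \<Longrightarrow> w b \<in> cyc b" and sum: "(\<Sum>b\<in>B. w b) = 0" and b: "b \<in> B"
  shows "w b = 0"
proof -
  obtain K where K: "\<And>b. b \<in> B \<Longrightarrow> \<omega> b < K"
    using fin by (metis finite_imageI finite_nat_set_iff_bounded imageI)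
  have "\<exists>a. \<forall>b\<in>B. (\<forall>j>\<omega> b. a b j = 0) \<and> w b = (\<Sum>j<K. pm_scale (a b j) ((f ^^ j) b))"
    using cyc_expansion[OF B w K] by metis
  then obtain a where a: "\<And>b j. b \<in> B \<Longrightarrow> j > \<omega> b \<Longrightarrow> a b j = 0"
    and wa: "\<And>b. b \<in> B \<Longrightarrow> w b = (\<Sum>j<K. pm_scale (a b j) ((f ^^ j) b))"
    by metis
  have "\<forall>b\<in>B. \<forall>j<J. a b j = 0" if "(\<Sum>b\<in>B. \<Sum>j<J. pm_scale (a b j) ((f ^^ j) b)) = 0" for J
    using that
  proof (induction J)
    case (Suc J)
    have "\<forall>b\<in>B. \<exists>c. (\<forall>a. (e ^^ J) (\<Sum>j<Suc J. pm_scale (a j) ((f ^^ j) b)) = pm_scale (a J * c) b) \<and> (J \<le> \<omega> b \<longrightarrow> c \<noteq> 0)"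
    proof
      fix b assume "b \<in> B"
      from e_pow_leading[OF B[OF this], of J] obtain c where
        "\<And>a. (e ^^ J) (\<Sum>j<Suc J. pm_scale (a j) ((f ^^ j) b)) = pm_scale (a J * c) b" "int J \<le> int (\<omega> b) \<Longrightarrow> c \<noteq> 0"
        by blast
      then show "\<exists>c. (\<forall>a. (e ^^ J) (\<Sum>j<Suc J. pm_scale (a j) ((f ^^ j) b)) = pm_scale (a J * c) b) \<and> (J \<le> \<omega> b \<longrightarrow> c \<noteq> 0)"
        by auto
    qed
    from bchoice[OF this] obtain c where
      c: "\<And>b a. b \<in> B \<Longrightarrow> (e ^^ J) (\<Sum>j<Suc J. pm_scale (a j) ((f ^^ j) b)) = pm_scale (a J * c b) b"
        "\<And>b. b \<in> B \<Longrightarrow> J \<le> \<omega> b \<Longrightarrow> c b \<noteq> 0"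
      by blast
    have "0 = (e ^^ J) (\<Sum>b\<in>B. \<Sum>j<Suc J. pm_scale (a b j) ((f ^^ j) b))"
      unfolding Suc.prems by (rule e_pow.zero[symmetric])
    also have "\<dots> = (\<Sum>b\<in>B. (e ^^ J) (\<Sum>j<Suc J. pm_scale (a b j) ((f ^^ j) b)))" by (rule e_pow.sum)
    also have "\<dots> = (\<Sum>b\<in>B. pm_scale (a b J * c b) b)" by (rule sum.cong[OF refl]) (rule c(1))
    finally have "a b J * c b = 0" if "b \<in> B" for b
      using pm.independentD[OF ind fin order_refl _ that] by metis
    then have aJ: "a b J = 0" if "b \<in> B" for b
      using that c(2) a by (metis mult_eq_0_iff not_le)
    then have "(\<Sum>b\<in>B. \<Sum>j<J. pm_scale (a b j) ((f ^^ j) b)) = 0"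
      using Suc.prems by simp
    then show ?case using Suc.IH aJ less_Suc_eq by auto
  qed simp
  moreover have "(\<Sum>b\<in>B. \<Sum>j<K. pm_scale (a b j) ((f ^^ j) b)) = 0"
    using sum wa by simp
  ultimately have "\<forall>b\<in>B. \<forall>j<K. a b j = 0" .
  then show ?thesis using wa[OF b] b by simp
qed

section \<open>Bases of highest weight vectors and the resulting decomposition\<close>

lemma kernel_spanned: "{v \<in> V. e v = 0} \<subseteq> pm.span hw_all"
proof
  fix v assume "v \<in> {v \<in> V. e v = 0}" (is "_ \<in> ?K")
  then have v: "v \<in> ?K" "v \<in> V" by auto
  obtain g where g: "\<And>\<mu>. g \<mu> \<in> wt_space \<mu>" "v = (\<Sum>\<mu>\<in>(\<lambda>s. int N - 2 * int s) ` {..N}. g \<mu>)"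
    using V_weights[OF v(2)] by blast
  have K: "pm.subspace ?K"
    using V_subspace by (auto simp: pm.subspace_def e.add e.scale e.zero)
  have "h ` ?K \<subseteq> ?K"
  proof
    fix x assume "x \<in> h ` ?K"
    then obtain y where y: "y \<in> V" "e y = 0" "x = h y" by blast
    \<comment> \<open>From \<open>e h = h e - 2 e\<close> the kernel is stable under
      \<open>h\<close>, hence graded by weight.\<close>
    then have "e (h y) = 0" using commutator(2)[OF y(1)] by (simp add: h.zero)
    then show "x \<in> ?K" using y V_h by simp
  qed
  then have "\<forall>\<mu>\<in>(\<lambda>s. int N - 2 * int s) ` {..N}. g \<mu> \<in> ?K"
    using g v(1) by (intro weight_components[OF K]) auto
  then have "\<forall>\<mu>\<in>(\<lambda>s. int N - 2 * int s) ` {..N}. g \<mu> \<in> hw_all"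
    using g(1) by (auto simp: hw_all_def hw_space_def)
  then show "v \<in> pm.span hw_all" unfolding g(2) by (intro pm.span_sum pm.span_base) blast
qed

text \<open>The basis is picked inside the union \<open>hw_all\<close> of the highest weight spaces
  and not from their span, so each basis vector has a weight.\<close>

lemma hw_basis:
  obtains B \<omega> where "finite B" "pm.independent B" "\<And>b. b \<in> B \<Longrightarrow> b \<in> hw_space (int (\<omega> b))" "hw_all \<subseteq> pm.span B"
proof -
  obtain B where B: "B \<subseteq> hw_all" "pm.independent B" "hw_all \<subseteq> pm.span B"
    using pm.maximal_independent_subset[of hw_all] by blast
  obtain S where S: "finite S" "V \<subseteq> pm.span S" using fin_dim by blast
  have "hw_all \<subseteq> V" by (auto simp: hw_all_def dest: hw_spaceD)
  then have fin: "finite B" using pm.independent_span_bound[OF S(1) B(2)] B(1) S(2) by blast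
  have "\<exists>l. b \<in> hw_space (int l)" if b: "b \<in> B" for b
  proof -
    have "b \<noteq> 0" using B(2) b pm.dependent_zero by blast
    moreover obtain l where "b \<in> hw_space l" using b B(1) unfolding hw_all_def by blast
    ultimately show ?thesis using hw_weight_nonneg by (metis nonneg_int_cases)
  qed
  then obtain \<omega> where "\<And>b. b \<in> B \<Longrightarrow> b \<in> hw_space (int (\<omega> b))" by metis
  with fin B that show ?thesis by blast
qed

text \<open>The sum of the \<open>cyc b\<close> contains \<open>(f ^^ j) u\<close> for every highest
  weight vector \<open>u\<close>, since \<open>u\<close> is a combination of \<open>B\<close> and
  \<open>f ^^ j\<close> is linear; such vectors span \<open>V\<close>.\<close>

lemma cyc_sum:
  assumes fin: "finite B" and B: "hw_all \<subseteq> pm.span B" and v: "v \<in> V"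
  obtains w where "\<And>b. b \<in> B \<Longrightarrow> w b \<in> cyc b" "v = (\<Sum>b\<in>B. w b)"
proof -
  let ?X = "{\<Sum>b\<in>B. w b | w. \<forall>b\<in>B. w b \<in> cyc b}"
  have X: "pm.subspace ?X"
  proof (rule pm.subspaceI)
    show "0 \<in> ?X" by (intro CollectI exI[of _ "\<lambda>_. 0"]) (auto simp: pm.subspace_0 cyc_subspace)
  next
    fix x y assume "x \<in> ?X" "y \<in> ?X"
    then obtain u w where "x = (\<Sum>b\<in>B. u b)" "y = (\<Sum>b\<in>B. w b)" "\<forall>b\<in>B. u b \<in> cyc b" "\<forall>b\<in>B. w b \<in> cyc b" by blast
    then show "x + y \<in> ?X"
      by (intro CollectI exI[of _ "\<lambda>b. u b + w b"]) (auto simp: sum.distrib pm.subspace_add cyc_subspace)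
  next
    fix c x assume "x \<in> ?X"
    then obtain u where "x = (\<Sum>b\<in>B. u b)" "\<forall>b\<in>B. u b \<in> cyc b" by blast
    then show "pm_scale c x \<in> ?X"
      by (intro CollectI exI[of _ "\<lambda>b. pm_scale c (u b)"]) (auto simp: pm.scale_sum_right pm.subspace_scale cyc_subspace)
  qed
  have cyc_X: "cyc b \<subseteq> ?X" if "b \<in> B" for b
  proof
    fix x assume "x \<in> cyc b"
    then show "x \<in> ?X" using that fin
      by (intro CollectI exI[of _ "\<lambda>b'. if b' = b then x else 0"]) (auto simp: pm.subspace_0 cyc_subspace)
  qed
  have "(f ^^ j) u \<in> ?X" if "u \<in> hw_all" for u j
  proof -
    have "(f ^^ j) u \<in> (f ^^ j) ` pm.span B" using that B by blast
    also have "\<dots> = pm.span ((f ^^ j) ` B)" by (rule f_pow.span_image[symmetric])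
    also have "\<dots> \<subseteq> ?X"
    proof (rule pm.span_minimal[OF _ X])
      have "(f ^^ j) b \<in> cyc b" for b unfolding cyc_def by (rule pm.span_base) blast
      then show "(f ^^ j) ` B \<subseteq> ?X" using cyc_X by blast
    qed
    finally show ?thesis .
  qed
  then have "cyc u \<subseteq> ?X" if "u \<in> hw_all" for u
    unfolding cyc_def[of u] using that by (intro pm.span_minimal[OF _ X]) blast
  then have "pm.span (\<Union>u\<in>hw_all. cyc u) \<subseteq> ?X" by (intro pm.span_minimal[OF _ X]) blast
  then have "v \<in> ?X" using V_spanned v by blast
  then show ?thesis using that by blast
qed

lemma dim_kernel:
  assumes "pm.independent B" "\<And>b. b \<in> B \<Longrightarrow> b \<in> hw_space (int (\<omega> b))" "hw_all \<subseteq> pm.span B"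
  shows "pm.dim {v \<in> V. e v = 0} = card B"
proof (rule pm.basis_card_eq_dim[symmetric])
  show "B \<subseteq> {v \<in> V. e v = 0}" using assms(2) by (auto dest: hw_spaceD)
  have "pm.span hw_all \<subseteq> pm.span B" using assms(3) by (intro pm.span_minimal) auto
  then show "{v \<in> V. e v = 0} \<subseteq> pm.span B" using kernel_spanned by blast
qed (rule assms(1))

lemma decomposition_exists: "\<exists>\<W>. sl2_decomposition e h f V \<W>"
proof -
  obtain B \<omega> where fin: "finite B" and ind: "pm.independent B"
    and B: "\<And>b. b \<in> B \<Longrightarrow> b \<in> hw_space (int (\<omega> b))" "hw_all \<subseteq> pm.span B" using hw_basis by blast
  have nz: "b \<noteq> 0" if "b \<in> B" for b using ind that pm.dependent_zero by blast
  note direct = cyc_direct[OF fin ind B(1)]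
  have inj: "inj_on cyc B"
  proof (rule inj_onI, rule ccontr)
    fix b b' assume *: "b \<in> B" "b' \<in> B" "cyc b = cyc b'" "b \<noteq> b'"
    \<comment> \<open>If the two strings had equal spans, \<open>b\<close> and \<open>-b\<close>
      placed in the two summands would be a nontrivial relation.\<close>
    let ?w = "\<lambda>x. (if x = b then b else 0) - (if x = b' then b else 0)"
    have "?w b = 0"
    proof (rule direct[where w = ?w])
      show "?w x \<in> cyc x" if "x \<in> B" for x
      proof (rule pm.subspace_diff[OF cyc_subspace])
        show "(if x = b then b else 0) \<in> cyc x" by (simp add: self_in_cyc pm.subspace_0[OF cyc_subspace])
        show "(if x = b' then b else 0) \<in> cyc x"
          using self_in_cyc[of b] by (simp add: *(3)[symmetric] pm.subspace_0[OF cyc_subspace])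
      qed
      show "(\<Sum>x\<in>B. ?w x) = 0" using *(1,2) fin by (simp add: sum_subtractf)
    qed (use * in auto)
    then show False using *(4) nz[OF *(1)] by simp
  qed
  have "\<exists>!g. g \<in> (\<Pi>\<^sub>E W\<in>cyc ` B. W) \<and> v = (\<Sum>W\<in>cyc ` B. g W)" if v: "v \<in> V" for v
  proof (rule ex_ex1I)
    obtain w where w: "\<And>b. b \<in> B \<Longrightarrow> w b \<in> cyc b" "v = (\<Sum>b\<in>B. w b)" using cyc_sum[OF fin B(2) v] by blast
    let ?g = "\<lambda>W\<in>cyc ` B. w (inv_into B cyc W)"
    have "?g \<in> (\<Pi>\<^sub>E W\<in>cyc ` B. W)" using w(1) inj by auto
    moreover have "v = (\<Sum>W\<in>cyc ` B. ?g W)" using w(2) by (simp add: sum.reindex[OF inj] inv_into_f_f[OF inj])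
    ultimately show "\<exists>g. g \<in> (\<Pi>\<^sub>E W\<in>cyc ` B. W) \<and> v = (\<Sum>W\<in>cyc ` B. g W)" by blast
  next
    fix g g' assume "g \<in> (\<Pi>\<^sub>E W\<in>cyc ` B. W) \<and> v = (\<Sum>W\<in>cyc ` B. g W)" "g' \<in> (\<Pi>\<^sub>E W\<in>cyc ` B. W) \<and> v = (\<Sum>W\<in>cyc ` B. g' W)"
    then have g: "g \<in> (\<Pi>\<^sub>E W\<in>cyc ` B. W)" "g' \<in> (\<Pi>\<^sub>E W\<in>cyc ` B. W)"
      and s: "(\<Sum>b\<in>B. g (cyc b)) = v" "(\<Sum>b\<in>B. g' (cyc b)) = v"
      by (simp_all add: sum.reindex[OF inj])
    have "g (cyc b) - g' (cyc b) = 0" if "b \<in> B" for b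
    proof (rule direct[where w = "\<lambda>b. g (cyc b) - g' (cyc b)"])
      show "g (cyc x) - g' (cyc x) \<in> cyc x" if "x \<in> B" for x
        using g that by (intro pm.subspace_diff cyc_subspace) auto
    qed (use that s in \<open>simp_all add: sum_subtractf\<close>)
    then show "g = g'" using g by (intro PiE_ext[OF g]) auto
  qed
  moreover have "\<forall>W\<in>cyc ` B. W \<subseteq> V \<and> sl2_irreducible e h f W"
    using cyc_subset[OF B(1)] cyc_irreducible[OF B(1) nz] by blast
  ultimately have "sl2_decomposition e h f V (cyc ` B)"
    using fin by (simp add: sl2_decomposition_def)
  then show ?thesis by blast
qed

text \<open>Every string \<open>b, f b, f\<^sup>2 b, \<dots>\<close> passes exactly once through the weight \<open>N mod 2\<close>, at its middle.\<close>

lemma dim_kernel_eq_middle: "pm.dim {v \<in> V. e v = 0} = pm.dim (wt_space (int (N mod 2)))"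
proof -
  obtain B \<omega> where fin: "finite B" and ind: "pm.independent B"
    and B: "\<And>b. b \<in> B \<Longrightarrow> b \<in> hw_space (int (\<omega> b))" "hw_all \<subseteq> pm.span B" using hw_basis by blast
  have nz: "b \<noteq> 0" if "b \<in> B" for b using ind that pm.dependent_zero by blast
  note direct = cyc_direct[OF fin ind B(1)]
  let ?p = "int (N mod 2)"
  \<comment> \<open>Each \<open>f\<close> lowers the weight by 2, so this many of them lead from
    \<open>\<omega> b\<close> to \<open>\<omega> b mod 2\<close>.\<close>
  define mid where "mid b = (f ^^ (\<omega> b div 2)) b" for b
  have mid_cyc: "mid b \<in> cyc b" for b unfolding mid_def cyc_def by (rule pm.span_base) blast
  have mid_nz: "mid b \<noteq> 0" if b: "b \<in> B" for b
  proof
    assume "mid b = 0"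
    moreover obtain c where "(e ^^ (\<omega> b div 2)) (mid b) = pm_scale c b" "int (\<omega> b div 2) \<le> int (\<omega> b) \<longrightarrow> c \<noteq> 0"
      using e_pow_f_pow[OF B(1)[OF b], of "\<omega> b div 2"] unfolding mid_def by blast
    ultimately show False using nz[OF b] by (simp add: e_pow.zero)
  qed
  have parity: "\<omega> b mod 2 = N mod 2" if b: "b \<in> B" for b
  proof -
    obtain s where "int (\<omega> b) = int N - 2 * int s"
      by (rule weight_form[OF hw_spaceD(1)[OF B(1)[OF b]] nz[OF b]])
    then show ?thesis by presburger
  qed
  have mid_wt: "mid b \<in> wt_space ?p" if b: "b \<in> B" for b
  proof -
    have "int (\<omega> b) - 2 * int (\<omega> b div 2) = ?p" unfolding parity[OF b, symmetric] by presburger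
    then show ?thesis using wt_space_f_pow[OF hw_spaceD(1)[OF B(1)[OF b]], of "\<omega> b div 2"] by (simp only: mid_def)
  qed
  have zero: "a b = 0" if "(\<Sum>b\<in>B. pm_scale (a b) (mid b)) = 0" "b \<in> B" for a b
    using direct[of "\<lambda>b. pm_scale (a b) (mid b)" b] that mid_cyc mid_nz pm.subspace_scale[OF cyc_subspace]
    by (metis (mono_tags, lifting) pm.scale_eq_0_iff)
  have inj: "inj_on mid B"
  proof (rule inj_onI, rule ccontr)
    fix b b' assume *: "b \<in> B" "b' \<in> B" "mid b = mid b'" "b \<noteq> b'"
    let ?a = "\<lambda>x. (if x = b then 1 else 0) - (if x = b' then 1 else 0) :: 'a"
    have "(\<Sum>x\<in>B. pm_scale (?a x) (mid x)) = (\<Sum>x\<in>B. (if x = b then mid x else 0) - (if x = b' then mid x else 0))"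
      by (intro sum.cong) (auto simp: *(4))
    also have "\<dots> = 0" using * fin by (simp add: sum_subtractf)
    finally have "?a b = 0" using *(1) by (rule zero)
    then show False using *(4) by simp
  qed
  have "card (mid ` B) = pm.dim (wt_space ?p)"
  proof (rule pm.basis_card_eq_dim)
    show "mid ` B \<subseteq> wt_space ?p" using mid_wt by blast
    show "pm.independent (mid ` B)"
    proof (rule pm.independent_if_scalars_zero)
      fix a x assume "(\<Sum>v\<in>mid ` B. pm_scale (a v) v) = 0" "x \<in> mid ` B"
      then show "a x = 0" using zero[of "\<lambda>b. a (mid b)"] by (auto simp: sum.reindex[OF inj])
    qed (use fin in simp)
    show "wt_space ?p \<subseteq> pm.span (mid ` B)"
    proof
      fix v assume v: "v \<in> wt_space ?p"
      obtain w where w: "\<And>b. b \<in> B \<Longrightarrow> w b \<in> cyc b" "v = (\<Sum>b\<in>B. w b)"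
        using cyc_sum[OF fin B(2) wt_spaceD(1)[OF v]] by blast
      have "\<forall>b\<in>B. \<exists>a. w b = (\<Sum>j<Suc (\<omega> b). pm_scale (a j) ((f ^^ j) b))"
        using cyc_expansion[OF B(1) w(1) lessI] by blast
      from bchoice[OF this] obtain a where
        a: "\<And>b. b \<in> B \<Longrightarrow> w b = (\<Sum>j<Suc (\<omega> b). pm_scale (a b j) ((f ^^ j) b))"
        by blast
      \<comment> \<open>Expand \<open>v\<close> over all pairs \<open>(b, j)\<close>; only pairs of
        weight \<open>N mod 2\<close> survive, which forces
        \<open>j = \<omega> b div 2\<close>.\<close>
      let ?I = "SIGMA b:B. {..<Suc (\<omega> b)}"
      let ?y = "\<lambda>(b, j). pm_scale (a b j) ((f ^^ j) b)"
      let ?wt = "\<lambda>(b, j). int (\<omega> b) - 2 * int j"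
      have "v = (\<Sum>i\<in>?I. ?y i)" unfolding w(2) using a fin by (subst sum.Sigma[symmetric]) auto
      then have "v = (\<Sum>i\<in>{i\<in>?I. ?wt i = ?p}. ?y i)"
        using fin v wt_space_f_pow[OF hw_spaceD(1)[OF B(1)]]
        by (intro weight_part) (auto intro!: pm.subspace_scale wt_space_subspace)
      also have "\<dots> \<in> pm.span (mid ` B)"
      proof (rule pm.span_sum)
        fix i assume i: "i \<in> {i\<in>?I. ?wt i = ?p}"
        then obtain b j where bj: "i = (b, j)" "b \<in> B" "int (\<omega> b) - 2 * int j = ?p" by auto
        then have "j = \<omega> b div 2" using parity[OF bj(2)] by presburger
        then have y: "?y i = pm_scale (a b j) (mid b)" by (simp add: bj mid_def)
        show "?y i \<in> pm.span (mid ` B)" unfolding y by (intro pm.span_scale pm.span_base imageI bj(2))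
      qed
      finally show "v \<in> pm.span (mid ` B)" .
    qed
  qed
  then show ?thesis using dim_kernel[OF ind B] by (simp add: card_image[OF inj])
qed

end

section \<open>Symmetric powers and the center\<close>

subsection \<open>Partitions in a box\<close>

definition box_partitions :: "nat \<Rightarrow> nat \<Rightarrow> nat \<Rightarrow> nat multiset set" where
  "box_partitions k n s = {M. size M = k \<and> (\<forall>b\<in>#M. b \<le> n) \<and> sum_mset M = s}"

lemma finite_box_partitions: "finite (box_partitions k n s)"
proof (rule finite_subset)
  show "box_partitions k n s \<subseteq> multisets_of_size {..n} k"
    by (auto simp: box_partitions_def multisets_of_size_def)
qed (rule finite_multisets_of_size, simp)

lemma box_partitions_0: "box_partitions 0 n s = (if s = 0 then {{#}} else {})"
  by (auto simp: box_partitions_def)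

lemma box_partitions_0': "box_partitions k 0 s = (if s = 0 then {replicate_mset k 0} else {})"
proof -
  have "M = replicate_mset k 0" if "\<forall>b\<in>#M. b = 0" "size M = k" for M :: "nat multiset"
    using that by (metis set_mset_subset_singletonD singletonI subsetI)
  then have "{M :: nat multiset. size M = k \<and> (\<forall>b\<in>#M. b \<le> 0)} = {replicate_mset k 0}"
    by (auto split: if_splits)
  moreover have "box_partitions k 0 s = {M \<in> {M. size M = k \<and> (\<forall>b\<in>#M. b \<le> 0)}. sum_mset M = s}"
    by (auto simp: box_partitions_def)
  ultimately show ?thesis by auto
qed

text \<open>Split by whether 0 is a part: if so, one zero is dropped; otherwise 1 is subtracted from
  all \<open>Suc k\<close> parts.\<close>

lemma card_box_partitions_smallest:
  "card (box_partitions (Suc k) (Suc n) s) =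
     card (box_partitions k (Suc n) s) + (if Suc k \<le> s then card (box_partitions (Suc k) n (s - Suc k)) else 0)"
proof -
  let ?A = "add_mset 0 ` box_partitions k (Suc n) s"
  let ?B = "if Suc k \<le> s then image_mset Suc ` box_partitions (Suc k) n (s - Suc k) else {}"
  have sum_Suc: "sum_mset (image_mset Suc M) = size M + sum_mset M" for M
    by (induction M) auto
  have split: "box_partitions (Suc k) (Suc n) s = ?A \<union> ?B"
  proof (intro equalityI subsetI)
    fix M assume "M \<in> box_partitions (Suc k) (Suc n) s"
    then have M: "size M = Suc k" "\<forall>b\<in>#M. b \<le> Suc n" "sum_mset M = s" by (auto simp: box_partitions_def)
    show "M \<in> ?A \<union> ?B"
    proof (cases "0 \<in># M")
      case True
      then obtain M' where "M = add_mset 0 M'" by (metis multi_member_split)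
      then have "M \<in> ?A" using M by (auto simp: box_partitions_def)
      then show ?thesis by blast
    next
      case False
      define M' where "M' = image_mset (\<lambda>b. b - 1) M"
      have "image_mset Suc M' = image_mset (\<lambda>b. b) M"
        unfolding M'_def multiset.map_comp o_def by (rule image_mset_cong) (use False in \<open>metis Suc_pred' diff_Suc_1 not0_implies_Suc\<close>)
      then have M': "M = image_mset Suc M'" by simp
      then have "s = Suc k + sum_mset M'" using M sum_Suc[of M'] by simp
      moreover have "\<forall>b\<in>#M'. b \<le> n" using M(2) M' by auto
      ultimately have "M \<in> ?B" using M(1) M' by (auto simp: box_partitions_def)
      then show ?thesis by blast
    qed
  next
    fix M assume "M \<in> ?A \<union> ?B"
    then show "M \<in> box_partitions (Suc k) (Suc n) s"
      by (auto simp: box_partitions_def sum_Suc split: if_splits)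
  qed
  have "?A \<inter> ?B = {}" by (auto dest: arg_cong[where f = "\<lambda>M. 0 \<in># M"])
  moreover have "card ?A = card (box_partitions k (Suc n) s)"
    by (rule card_image) (auto simp: inj_on_def)
  moreover have "inj (image_mset Suc)" 
    by (rule inj_on_inverseI[where g = "image_mset (\<lambda>b. b - 1)"]) (simp add: multiset.map_comp o_def)
  then have "card ?B = (if Suc k \<le> s then card (box_partitions (Suc k) n (s - Suc k)) else 0)"
    by (auto intro!: card_image intro: inj_on_subset)
  moreover have "finite ?A" "finite ?B" by (simp_all add: finite_box_partitions)
  ultimately show ?thesis
    unfolding split by (simp only: card_Un_disjoint)
qed

text \<open>Split by whether a part of maximal size \<open>Suc n\<close> occurs, in which case one
  is removed. In the transposed diagram this is the split by a part 0.\<close>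

lemma card_box_partitions_largest:
  "card (box_partitions (Suc k) (Suc n) s) =
     card (box_partitions (Suc k) n s) + (if Suc n \<le> s then card (box_partitions k (Suc n) (s - Suc n)) else 0)"
proof -
  let ?A = "box_partitions (Suc k) n s"
  let ?B = "if Suc n \<le> s then add_mset (Suc n) ` box_partitions k (Suc n) (s - Suc n) else {}"
  have split: "box_partitions (Suc k) (Suc n) s = ?A \<union> ?B"
  proof (intro equalityI subsetI)
    fix M assume "M \<in> box_partitions (Suc k) (Suc n) s"
    then have M: "size M = Suc k" "\<forall>b\<in>#M. b \<le> Suc n" "sum_mset M = s" by (auto simp: box_partitions_def)
    show "M \<in> ?A \<union> ?B"
    proof (cases "Suc n \<in># M")
      case True
      then obtain M' where M': "M = add_mset (Suc n) M'" by (metis multi_member_split)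
      then have "s = Suc n + sum_mset M'" using M by simp
      then have "M \<in> ?B" using M M' by (auto simp: box_partitions_def)
      then show ?thesis by blast
    next
      case False
      then have "\<forall>b\<in>#M. b \<le> n" using M(2) le_Suc_eq by metis
      then show ?thesis using M by (simp add: box_partitions_def)
    qed
  next
    fix M assume "M \<in> ?A \<union> ?B"
    then show "M \<in> box_partitions (Suc k) (Suc n) s"
      by (auto simp: box_partitions_def split: if_splits)
  qed
  have "Suc n \<in># M" if "M \<in> ?B" for M using that by (auto split: if_splits)
  moreover have "Suc n \<notin># M" if "M \<in> ?A" for M using that by (auto simp: box_partitions_def)
  ultimately have "?A \<inter> ?B = {}" by blast
  moreover have "card ?B = (if Suc n \<le> s then card (box_partitions k (Suc n) (s - Suc n)) else 0)"
  proof (cases "Suc n \<le> s")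
    case True
    have "inj_on (add_mset (Suc n)) X" for X by (simp add: inj_on_def)
    then show ?thesis using True by (simp only: if_True card_image)
  next
    case False
    then show ?thesis by (simp only: if_False card.empty)
  qed
  moreover have "finite ?A" "finite ?B" by (simp_all add: finite_box_partitions)
  ultimately show ?thesis
    unfolding split by (simp only: card_Un_disjoint)
qed

text \<open>Conjugation of partitions exchanges the two recurrences.\<close>

lemma card_box_partitions_commute: "card (box_partitions k n s) = card (box_partitions n k s)"
proof (induction "k + n" arbitrary: k n s rule: less_induct)
  case less
  show ?case
  proof (cases k)
    case 0
    then show ?thesis by (simp add: box_partitions_0 box_partitions_0')
  next
    case k: (Suc k')
    show ?thesis
    proof (cases n)
      case 0
      then show ?thesis by (simp add: box_partitions_0 box_partitions_0')
    next
      case n: (Suc n')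
      show ?thesis
        unfolding k n card_box_partitions_smallest[of k'] card_box_partitions_largest[of n']
        using less[of k' "Suc n'"] less[of "Suc k'" n'] k n by simp
    qed
  qed
qed

subsection \<open>Monomials\<close>

lemma
  fixes A :: "'b set"
  assumes "finite A"
  shows dim_supported: "card A = pm.dim {v :: 'b \<Rightarrow>\<^sub>0 'a::field. Poly_Mapping.keys v \<subseteq> A}"
    and spanned_supported: "{v :: 'b \<Rightarrow>\<^sub>0 'a. Poly_Mapping.keys v \<subseteq> A} \<subseteq> pm.span ((\<lambda>i. Poly_Mapping.single i 1) ` A)"
proof -
  let ?s = "\<lambda>i. Poly_Mapping.single i (1::'a)"
  let ?V = "{v :: 'b \<Rightarrow>\<^sub>0 'a. Poly_Mapping.keys v \<subseteq> A}"
  have inj: "inj_on ?s A"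
    by (rule inj_onI) (metis lookup_single_eq lookup_single_not_eq zero_neq_one)
  show span: "?V \<subseteq> pm.span (?s ` A)"
  proof
    fix u assume u: "u \<in> ?V"
    have "u = lin_ext ?s u" by (rule lin_ext_id[symmetric])
    also have "\<dots> \<in> pm.span (?s ` A)"
      unfolding lin_ext_def using u
      by (intro pm.span_sum pm.span_scale pm.span_base) auto
    finally show "u \<in> pm.span (?s ` A)" .
  qed
  have "card (?s ` A) = pm.dim ?V"
  proof (rule pm.basis_card_eq_dim)
    show "?s ` A \<subseteq> ?V" by auto
    show "pm.independent (?s ` A)"
    proof (rule pm.independent_if_scalars_zero)
      fix f x assume 0: "(\<Sum>v\<in>?s ` A. pm_scale (f v) v) = 0" and "x \<in> ?s ` A"
      then obtain i where i: "i \<in> A" "x = ?s i" by auto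
      have "0 = Poly_Mapping.lookup (\<Sum>j\<in>A. pm_scale (f (?s j)) (?s j)) i"
        using 0 by (simp add: sum.reindex[OF inj])
      also have "\<dots> = (\<Sum>j\<in>A. if j = i then f x else 0)"
        unfolding lookup_sum by (rule sum.cong) (auto simp: lookup_single when_def i)
      finally show "f x = 0" using i assms by simp
    qed (use assms in simp)
  qed (rule span)
  then show "card A = pm.dim ?V" by (simp add: card_image[OF inj])
qed

text \<open>As \<open>u_i\<close> has weight \<open>n - 2 i\<close>, a monomial of degree
  \<open>k\<close> has weight \<open>n k - 2 mon_weight m\<close> under \<open>h\<close>.\<close>

definition mon_weight :: "(nat \<Rightarrow>\<^sub>0 nat) \<Rightarrow> nat" where
  "mon_weight m = (\<Sum>i\<in>Poly_Mapping.keys m. i * Poly_Mapping.lookup m i)"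

lemma mon_weight_superset:
  "finite A \<Longrightarrow> Poly_Mapping.keys m \<subseteq> A \<Longrightarrow> mon_weight m = (\<Sum>i\<in>A. i * Poly_Mapping.lookup m i)"
  unfolding mon_weight_def by (intro sum.mono_neutral_left) (auto simp: in_keys_iff)

text \<open>Reads a multiset of variable indices as an exponent vector: size becomes degree and the
  sum becomes \<open>mon_weight\<close>, so monomials of fixed weight are box partitions.\<close>

definition mset_mon :: "nat multiset \<Rightarrow> (nat \<Rightarrow>\<^sub>0 nat)" where
  "mset_mon M = Abs_poly_mapping (count M)"

lemma lookup_mset_mon [simp]: "Poly_Mapping.lookup (mset_mon M) = count M"
  unfolding mset_mon_def by (rule lookup_Abs_poly_mapping) (simp flip: set_mset_def add: count_greater_zero_iff)

lemma keys_mset_mon [simp]: "Poly_Mapping.keys (mset_mon M) = set_mset M"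
  by (auto simp: in_keys_iff)

lemma mon_degree_mset_mon [simp]: "mon_degree (mset_mon M) = size M"
  by (simp add: mon_degree_def size_multiset_overloaded_eq)

lemma mon_weight_mset_mon [simp]: "mon_weight (mset_mon M) = sum_mset M"
proof (induction M)
  case (add x M)
  let ?A = "insert x (set_mset M)"
  have "mon_weight (mset_mon (add_mset x M)) = (\<Sum>i\<in>?A. (if i = x then x else 0) + i * count M i)"
    by (subst mon_weight_superset[of ?A]) (auto intro!: sum.cong)
  also have "\<dots> = x + mon_weight (mset_mon M)"
    by (subst mon_weight_superset[of ?A]) (auto simp: sum.distrib simp del: sum.insert_remove)
  finally show ?case using add by simp
qed (simp add: mon_weight_def)

lemma bij_mset_mon: "bij mset_mon"
proof (rule o_bij)
  define g :: "(nat \<Rightarrow>\<^sub>0 nat) \<Rightarrow> nat multiset" where "g m = Abs_multiset (Poly_Mapping.lookup m)" for m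
  have c: "count (g m) = Poly_Mapping.lookup m" for m
    unfolding g_def by (rule count_Abs_multiset) (simp add: finite_lookup)
  show "g \<circ> mset_mon = id" by (auto intro!: multiset_eqI simp: c)
  show "mset_mon \<circ> g = id" by (auto intro!: poly_mapping_eqI simp: c)
qed

definition monomials :: "nat \<Rightarrow> nat \<Rightarrow> (nat \<Rightarrow>\<^sub>0 nat) set" where
  "monomials n k = {m. Poly_Mapping.keys m \<subseteq> {..n} \<and> mon_degree m = k}"

lemma hom_polys_eq: "hom_polys n k = {p. Poly_Mapping.keys p \<subseteq> monomials n k}"
  by (auto simp: hom_polys_def polys_def monomials_def)

lemma monomials_mset: "monomials n k = mset_mon ` multisets_of_size {..n} k"
proof -
  have "m \<in> mset_mon ` multisets_of_size {..n} k" if "m \<in> monomials n k" for m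
  proof -
    obtain M where "m = mset_mon M" using bij_mset_mon by (metis bij_pointE)
    then show ?thesis using that by (auto simp: monomials_def multisets_of_size_def)
  qed
  then show ?thesis by (auto simp: monomials_def multisets_of_size_def)
qed

lemma finite_monomials: "finite (monomials n k)"
  unfolding monomials_mset by (intro finite_imageI finite_multisets_of_size) simp

lemma card_monomials_weight: "card {m \<in> monomials n k. mon_weight m = s} = card (box_partitions k n s)"
proof -
  have "{m \<in> monomials n k. mon_weight m = s} = mset_mon ` box_partitions k n s"
    unfolding monomials_mset by (auto simp: box_partitions_def multisets_of_size_def)
  then show ?thesis by (simp add: card_image inj_on_subset[OF bij_is_inj[OF bij_mset_mon]])
qed

lemma mon_weight_le: "m \<in> monomials n k \<Longrightarrow> mon_weight m \<le> n * k"
proof -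
  assume "m \<in> monomials n k"
  then have "mon_weight m \<le> (\<Sum>i\<in>Poly_Mapping.keys m. n * Poly_Mapping.lookup m i)" "mon_degree m = k"
    unfolding mon_weight_def monomials_def by (auto intro!: sum_mono)
  then show ?thesis by (simp add: mon_degree_def flip: sum_distrib_left)
qed

subsection \<open>The action on monomials\<close>

lemma mult_pvar: "pvar i * Poly_Mapping.single m c = Poly_Mapping.single (Poly_Mapping.single i 1 + m) c"
  by (simp add: pvar_def mult_single)

lemma single_unit_split:
  "Poly_Mapping.lookup m i \<noteq> 0 \<Longrightarrow> Poly_Mapping.single i 1 + (m - Poly_Mapping.single i 1) = (m :: nat \<Rightarrow>\<^sub>0 nat)"
  by (intro poly_mapping_eqI) (auto simp: lookup_add lookup_minus lookup_single when_def)

lemma sym_deriv_U_h_single: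
  assumes "m \<in> monomials n k"
  shows "sym_deriv n (U_h n) (Poly_Mapping.single m c :: 'a::field_char_0 mpoly) =
         pm_scale (of_int (int (n * k) - 2 * int (mon_weight m))) (Poly_Mapping.single m c)"
proof -
  have "sym_deriv n (U_h n) (Poly_Mapping.single m c) =
      (\<Sum>i\<le>n. Poly_Mapping.single m ((of_nat n - 2 * of_nat i) * (c * of_nat (Poly_Mapping.lookup m i))))"
    unfolding sym_deriv_def U_h_def
  proof (rule sum.cong[OF refl])
    fix i
    show "lin_form (lin_ext (\<lambda>i. Poly_Mapping.single i (of_nat n - 2 * of_nat i)) (Poly_Mapping.single i 1)) * pdiff i (Poly_Mapping.single m c)
        = Poly_Mapping.single m ((of_nat n - 2 * of_nat i) * (c * of_nat (Poly_Mapping.lookup m i)))"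
      \<comment> \<open>If the variable \<open>i\<close> is absent from \<open>m\<close>, the
        truncated difference does not restore \<open>m\<close>, but then the coefficient is
        0.\<close>
      using single_unit_split[of m i]
      by (cases "Poly_Mapping.lookup m i = 0") (simp_all add: pm_scale_mult_left mult_pvar del: single_diff)
  qed
  also have "\<dots> = Poly_Mapping.single m (\<Sum>i\<le>n. (of_nat n - 2 * of_nat i) * (c * of_nat (Poly_Mapping.lookup m i)))"
    by (intro poly_mapping_eqI) (simp add: lookup_sum lookup_single when_def)
  also have "(\<Sum>i\<le>n. (of_nat n - 2 * of_nat i) * (c * of_nat (Poly_Mapping.lookup m i))) =
      (of_nat (n * (\<Sum>i\<le>n. Poly_Mapping.lookup m i)) - 2 * of_nat (\<Sum>i\<le>n. i * Poly_Mapping.lookup m i)) * c"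
    by (simp add: sum_distrib_left sum_distrib_right sum_subtractf algebra_simps)
  also have "(\<Sum>i\<le>n. Poly_Mapping.lookup m i) = k"
    using assms mon_degree_superset[of "{..n}" m] by (simp add: monomials_def)
  also have "(\<Sum>i\<le>n. i * Poly_Mapping.lookup m i) = mon_weight m"
    using assms mon_weight_superset[of "{..n}" m] by (simp add: monomials_def)
  finally show ?thesis by simp
qed

lemma lookup_sym_deriv_U_h:
  fixes p :: "'a::field_char_0 mpoly"
  assumes "p \<in> hom_polys n k"
  shows "Poly_Mapping.lookup (sym_deriv n (U_h n) p) m =
         of_int (int (n * k) - 2 * int (mon_weight m)) * Poly_Mapping.lookup p m"
proof -
  interpret h: Vector_Spaces.linear pm_scale pm_scale "sym_deriv n (U_h n) :: 'a mpoly \<Rightarrow> _"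
    using sl2_module_sym_power[of n k, where ?'a = 'a] by (simp add: sl2_module_def)
  let ?K = "Poly_Mapping.keys p"
  let ?w = "\<lambda>m. of_int (int (n * k) - 2 * int (mon_weight m)) :: 'a"
  have p: "(\<Sum>m\<in>?K. Poly_Mapping.single m (Poly_Mapping.lookup p m)) = p"
    using lin_ext_id[of p] by (simp add: lin_ext_def)
  have "sym_deriv n (U_h n) p = (\<Sum>m\<in>?K. sym_deriv n (U_h n) (Poly_Mapping.single m (Poly_Mapping.lookup p m)))"
    unfolding h.sum[symmetric] p ..
  also have "\<dots> = (\<Sum>m\<in>?K. Poly_Mapping.single m (?w m * Poly_Mapping.lookup p m))"
  proof (rule sum.cong[OF refl])
    fix m assume "m \<in> ?K"
    then have "m \<in> monomials n k" using assms unfolding hom_polys_eq by blast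
    then show "sym_deriv n (U_h n) (Poly_Mapping.single m (Poly_Mapping.lookup p m)) =
        Poly_Mapping.single m (?w m * Poly_Mapping.lookup p m)"
      by (simp only: sym_deriv_U_h_single pm_scale_single)
  qed
  finally show ?thesis
    by (cases "m \<in> ?K") (auto simp: lookup_sum lookup_single when_def in_keys_iff)
qed

subsection \<open>Rescaling the variables\<close>

text \<open>The substitution \<open>y\<^sub>i = (n - i)! u\<^sub>i\<close> turns \<open>fil_D n\<close> into the raising operator of \<open>S\<^sup>k(U\<^sub>n)\<close>.\<close>

definition rescaling :: "nat \<Rightarrow> (nat \<Rightarrow>\<^sub>0 nat) \<Rightarrow> 'a::field_char_0" where
  "rescaling n m = (\<Prod>i\<le>n. fact (n - i) ^ Poly_Mapping.lookup m i)"

lemma rescaling_nonzero: "rescaling n m \<noteq> 0"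
  by (simp add: rescaling_def)

lemma rescaling_add: "rescaling n (m + m') = rescaling n m * rescaling n m'"
  by (simp add: rescaling_def lookup_add power_add prod.distrib)

lemma rescaling_single: "i \<le> n \<Longrightarrow> rescaling n (Poly_Mapping.single i 1) = fact (n - i)"
proof -
  assume "i \<le> n"
  have "rescaling n (Poly_Mapping.single i 1) = (\<Prod>j\<le>n. if j = i then fact (n - j) else 1 :: 'a)"
    unfolding rescaling_def by (intro prod.cong) (auto simp: lookup_single when_def)
  then show ?thesis using \<open>i \<le> n\<close> by simp
qed

definition rescale :: "nat \<Rightarrow> 'a::field_char_0 mpoly \<Rightarrow> 'a mpoly" where
  "rescale n = lin_ext (\<lambda>m. Poly_Mapping.single m (rescaling n m))"

lemma lookup_rescale: "Poly_Mapping.lookup (rescale n p) m = rescaling n m * Poly_Mapping.lookup p m"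
  unfolding rescale_def
  by (subst lookup_lin_ext[of "insert m (Poly_Mapping.keys p)"]) (auto simp: lookup_single when_def if_distrib cong: if_cong)

text \<open>For y_i = (n-i)! u_i one has e y_(i+1) = (n-i-1)! (n-i) u_i = y_i, the rule for
  \<open>fil_D\<close>. Multiplicativity of \<open>rescaling\<close> carries this from variables to
  monomials.\<close>

lemma rescale_fil_D: "sym_deriv n (U_e n) (rescale n p) = rescale n (fil_D n p)"
proof (induction p rule: pm_induct)
  case (single m c)
  have "sym_deriv n (U_e n) (rescale n (Poly_Mapping.single m c)) =
     (\<Sum>j<Suc n. lin_form (U_e n (Poly_Mapping.single j 1)) * pdiff j (Poly_Mapping.single m (c * rescaling n m)))"
    by (simp add: sym_deriv_def rescale_def lessThan_Suc_atMost del: sum.lessThan_Suc pdiff_single)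
  also have "\<dots> = (\<Sum>i<n. lin_form (U_e n (Poly_Mapping.single (Suc i) 1)) * pdiff (Suc i) (Poly_Mapping.single m (c * rescaling n m)))"
  proof -
    \<comment> \<open>\<open>u_0\<close> is the highest weight vector, so the term
      \<open>j = 0\<close> drops out and the range becomes that of \<open>fil_D\<close>.\<close>
    have "U_e n (Poly_Mapping.single 0 1) = (0 :: nat \<Rightarrow>\<^sub>0 'a)"
      by (intro poly_mapping_eqI) (simp add: lookup_single del: single_one)
    then show ?thesis
      by (subst sum.lessThan_Suc_shift) (simp add: lin_form_def del: single_one pdiff_single)
  qed
  also have "\<dots> = (\<Sum>i<n. rescale n (pvar i * pdiff (Suc i) (Poly_Mapping.single m c)))"
  proof (rule sum.cong[OF refl])
    fix i assume i: "i \<in> {..<n}"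
    let ?m = "m - Poly_Mapping.single (Suc i) 1"
    show "lin_form (U_e n (Poly_Mapping.single (Suc i) 1)) * pdiff (Suc i) (Poly_Mapping.single m (c * rescaling n m)) =
        rescale n (pvar i * pdiff (Suc i) (Poly_Mapping.single m c))"
    proof (cases "Poly_Mapping.lookup m (Suc i) = 0")
      case False
      have "(rescaling n m :: 'a) = rescaling n (Poly_Mapping.single (Suc i) 1) * rescaling n ?m"
        by (simp only: rescaling_add[symmetric] single_unit_split[OF False])
      moreover have "(of_nat n - of_nat i :: 'a) * fact (n - Suc i) = fact (n - i)"
        using i by (metis Suc_diff_Suc fact_Suc lessThan_iff less_imp_le_nat of_nat_diff)
      ultimately have c: "(of_nat n - of_nat i) * rescaling n m = (rescaling n (Poly_Mapping.single i 1 + ?m) :: 'a)"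
        using i by (simp add: rescaling_add rescaling_single[unfolded One_nat_def] mult.assoc[symmetric])
      have L: "lin_form (U_e n (Poly_Mapping.single (Suc i) 1)) = pm_scale (of_nat n - of_nat i) (pvar i :: 'a mpoly)"
        by (simp add: U_e_def)
      have "lin_form (U_e n (Poly_Mapping.single (Suc i) 1)) * pdiff (Suc i) (Poly_Mapping.single m (c * rescaling n m)) =
          Poly_Mapping.single (Poly_Mapping.single i 1 + ?m) (c * ((of_nat n - of_nat i) * rescaling n m) * of_nat (Poly_Mapping.lookup m (Suc i)))"
        unfolding L pdiff_single pm_scale_mult_left mult_pvar pm_scale_single by (simp only: ac_simps)
      also have "\<dots> = rescale n (pvar i * pdiff (Suc i) (Poly_Mapping.single m c))"
        unfolding c by (simp add: mult_pvar rescale_def algebra_simps)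
      finally show ?thesis .
    qed (simp add: rescale_def)
  qed
  also have "\<dots> = rescale n (fil_D n (Poly_Mapping.single m c))"
    by (simp only: fil_D_def rescale_def lin_ext_sum)
  finally show ?case .
next
  case (add u v)
  then show ?case by (simp add: rescale_def lin_ext_add sym_deriv_add fil_D_add)
qed

section \<open>Comparison of the graded center with \<open>S^k(U_n)\<close>\<close>

lemma filiform_center_hom_eq: "filiform_center_hom n k = {p \<in> hom_polys n k. fil_D n p = (0 :: 'a::field mpoly)}"
  by (auto simp: filiform_center_hom_def filiform_center_eq fil_D_def hom_polys_def)

text \<open>\<open>rescale\<close> is a linear bijection that preserves supports, hence degrees, and
  it carries the kernel of \<open>fil_D\<close> onto that of the raising operator.\<close>

lemma dim_filiform_center_hom:
  "pm.dim (filiform_center_hom n k :: 'a::field_char_0 mpoly set) =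
   pm.dim {p \<in> hom_polys n k :: 'a mpoly set. sym_deriv n (U_e n) p = 0}"
proof -
  let ?S = "filiform_center_hom n k :: 'a mpoly set"
  interpret r: Vector_Spaces.linear pm_scale pm_scale "rescale n :: 'a mpoly \<Rightarrow> _"
    unfolding rescale_def by (rule linear_lin_ext)
  have keys: "Poly_Mapping.keys (rescale n p) = Poly_Mapping.keys p" for p :: "'a mpoly"
    by (auto simp: in_keys_iff lookup_rescale rescaling_nonzero)
  have inj: "inj (rescale n :: 'a mpoly \<Rightarrow> _)"
    by (rule injI, rule poly_mapping_eqI, drule arg_cong[where f = Poly_Mapping.lookup], drule fun_cong)
       (simp add: lookup_rescale rescaling_nonzero)
  have image: "rescale n ` ?S = {p \<in> hom_polys n k. sym_deriv n (U_e n) p = 0}"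
  proof (intro equalityI subsetI)
    fix p :: "'a mpoly" assume p: "p \<in> {p \<in> hom_polys n k. sym_deriv n (U_e n) p = 0}"
    define q where "q = lin_ext (\<lambda>m. Poly_Mapping.single m (inverse (rescaling n m))) p"
    have "Poly_Mapping.lookup q m = inverse (rescaling n m) * Poly_Mapping.lookup p m" for m
      unfolding q_def
      by (subst lookup_lin_ext[of "insert m (Poly_Mapping.keys p)"]) (auto simp: lookup_single when_def if_distrib cong: if_cong)
    then have pq: "p = rescale n q" by (intro poly_mapping_eqI) (simp add: lookup_rescale rescaling_nonzero)
    then have "rescale n (fil_D n q) = rescale n 0" using p by (simp add: rescale_fil_D r.zero)
    then have "fil_D n q = 0" by (rule injD[OF inj])
    then have "q \<in> ?S" using p by (simp add: filiform_center_hom_eq hom_polys_eq pq keys)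
    then show "p \<in> rescale n ` ?S" using pq by blast
  qed (auto simp: filiform_center_hom_eq hom_polys_eq keys rescale_fil_D r.zero)
  obtain B where B: "B \<subseteq> ?S" "pm.independent B" "?S \<subseteq> pm.span B" "card B = pm.dim ?S"
    using pm.basis_exists by blast
  have "card (rescale n ` B) = pm.dim (rescale n ` ?S)"
  proof (rule pm.basis_card_eq_dim)
    show "rescale n ` ?S \<subseteq> pm.span (rescale n ` B)" unfolding r.span_image using B(3) by blast
    show "pm.independent (rescale n ` B)"
      by (rule r.independent_injective_image[OF B(2)]) (use inj in \<open>blast intro: inj_on_subset\<close>)
  qed (use B(1) in blast)
  then show ?thesis using B(4) inj by (simp add: image card_image inj_on_subset)
qed

text \<open>Grouping the monomials of a polynomial by \<open>mon_weight\<close>, which lies between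
  0 and \<open>n k\<close>, gives its weight components.\<close>

lemma sl2_weight_module_sym_power:
  "sl2_weight_module (sym_deriv n (U_e n)) (sym_deriv n (U_h n)) (sym_deriv n (U_f n))
     (hom_polys n k :: 'a::field_char_0 mpoly set) (n * k)"
proof
  show "sl2_module (sym_deriv n (U_e n)) (sym_deriv n (U_h n)) (sym_deriv n (U_f n)) (hom_polys n k :: 'a mpoly set)"
    by (rule sl2_module_sym_power)
  show "\<exists>S. finite S \<and> (hom_polys n k :: 'a mpoly set) \<subseteq> pm.span S"
    unfolding hom_polys_eq
    by (intro exI[of _ "(\<lambda>i. Poly_Mapping.single i 1) ` monomials n k"] conjI spanned_supported
        finite_imageI finite_monomials)
  fix p :: "'a mpoly" assume p: "p \<in> hom_polys n k"
  then have K: "Poly_Mapping.keys p \<subseteq> monomials n k" by (simp add: hom_polys_eq)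
  let ?K = "Poly_Mapping.keys p"
  define g where "g s = (\<Sum>m\<in>{m \<in> ?K. mon_weight m = s}. Poly_Mapping.single m (Poly_Mapping.lookup p m))" for s
  have lookup_g: "Poly_Mapping.lookup (g s) m = (if mon_weight m = s then Poly_Mapping.lookup p m else 0)" for s m
    by (auto simp: g_def lookup_sum lookup_single when_def in_keys_iff sum.delta)
  have g_hom: "g s \<in> hom_polys n k" for s
    using K by (auto simp: hom_polys_eq in_keys_iff lookup_g split: if_splits)
  moreover have "sym_deriv n (U_h n) (g s) = pm_scale (of_int (int (n * k) - 2 * int s)) (g s)" for s
    by (rule poly_mapping_eqI) (simp add: lookup_sym_deriv_U_h[OF g_hom] lookup_g)
  moreover have "p = (\<Sum>s\<le>n * k. g s)"
  proof -
    have "(\<Sum>s\<le>n * k. g s) = (\<Sum>m\<in>?K. Poly_Mapping.single m (Poly_Mapping.lookup p m))"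
      unfolding g_def by (rule sum.group) (use K mon_weight_le in auto)
    then show ?thesis using lin_ext_id[of p] by (simp add: lin_ext_def)
  qed
  ultimately show "\<exists>g. (\<forall>s. g s \<in> hom_polys n k \<and>
        sym_deriv n (U_h n) (g s) = pm_scale (of_int (int (n * k) - 2 * int s)) (g s)) \<and> p = (\<Sum>s\<le>n * k. g s)"
    by blast
qed

text \<open>\<open>n k - 2 w = n k mod 2\<close> means \<open>w = n k div 2\<close>, the origin of
  the floor in the theorem. Characteristic zero lets the eigenvalues be compared as
  integers.\<close>

lemma wt_space_sym_power:
  "sl2_weight_module.wt_space (sym_deriv n (U_h n)) (hom_polys n k :: 'a::field_char_0 mpoly set) (int (n * k mod 2)) =
   {p. Poly_Mapping.keys p \<subseteq> {m \<in> monomials n k. mon_weight m = n * k div 2}}"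
proof -
  interpret sl2_weight_module "sym_deriv n (U_e n)" "sym_deriv n (U_h n)" "sym_deriv n (U_f n)"
    "hom_polys n k :: 'a mpoly set" "n * k"
    by (rule sl2_weight_module_sym_power)
  have middle: "of_int (int (n * k) - 2 * int w) = (of_int (int (n * k mod 2)) :: 'a) \<longleftrightarrow> w = n * k div 2" for w
  proof -
    have "int (n * k) = 2 * int (n * k div 2) + int (n * k mod 2)" by presburger
    then show ?thesis unfolding of_int_eq_iff by linarith
  qed
  have "p \<in> wt_space (int (n * k mod 2)) \<longleftrightarrow> (\<forall>m\<in>Poly_Mapping.keys p. mon_weight m = n * k div 2)"
    if p: "p \<in> hom_polys n k" for p
  proof -
    have "p \<in> wt_space (int (n * k mod 2)) \<longleftrightarrow>
        (\<forall>m. of_int (int (n * k) - 2 * int (mon_weight m)) * Poly_Mapping.lookup p m =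
             of_int (int (n * k mod 2)) * Poly_Mapping.lookup p m)"
      using p by (simp only: wt_space_def poly_mapping_eq_iff fun_eq_iff lookup_sym_deriv_U_h[OF p] lookup_pm_scale mem_Collect_eq simp_thms)
    then show ?thesis by (simp only: mult_cancel_right middle in_keys_iff Ball_def imp_conv_disj not_not)
  qed
  moreover have "p \<in> hom_polys n k" if "p \<in> wt_space \<mu>" for p \<mu> using that by (rule wt_spaceD)
  ultimately show ?thesis unfolding hom_polys_eq by blast
qed

theorem theorem1p2:
  fixes n k :: nat
  assumes "n \<ge> 1" and "k \<ge> 1"
  shows "(\<exists>\<W> :: 'a::field_char_0 mpoly set set. sym_power_decomposition n k \<W>) \<and>
         (\<forall>\<W> :: 'a mpoly set set. sym_power_decomposition n k \<W> \<longrightarrow>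
            pm.dim (filiform_center_hom n k :: 'a mpoly set) = card \<W>) \<and>
         pm.dim (filiform_center_hom n k :: 'a mpoly set) =
           card {M :: nat multiset. size M = k \<and> (\<forall>b\<in>#M. b \<le> n) \<and> sum_mset M = k * n div 2} \<and>
         pm.dim (filiform_center_hom n k :: 'a mpoly set) =
           pm.dim (filiform_center_hom k n :: 'a mpoly set)"
proof -
  \<comment> \<open>Proved for all \<open>n\<close> and \<open>k\<close> at once, so that it can
    also be used with the two exchanged.\<close>
  have dim: "pm.dim (filiform_center_hom n k :: 'a mpoly set) = card (box_partitions k n (k * n div 2))" for n k
  proof -
    interpret sl2_weight_module "sym_deriv n (U_e n)" "sym_deriv n (U_h n)" "sym_deriv n (U_f n)"
      "hom_polys n k :: 'a mpoly set" "n * k"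
      by (rule sl2_weight_module_sym_power)
    have "pm.dim (wt_space (int (n * k mod 2))) = card {m \<in> monomials n k. mon_weight m = n * k div 2}"
      unfolding wt_space_sym_power by (rule dim_supported[symmetric]) (simp add: finite_monomials)
    then show ?thesis
      by (simp only: dim_filiform_center_hom dim_kernel_eq_middle card_monomials_weight mult.commute[of n k])
  qed
  interpret sl2_weight_module "sym_deriv n (U_e n)" "sym_deriv n (U_h n)" "sym_deriv n (U_f n)"
    "hom_polys n k :: 'a mpoly set" "n * k"
    by (rule sl2_weight_module_sym_power)
  show ?thesis
  proof (intro conjI allI impI)
    \<comment> \<open>Existence keeps the statement about all decompositions from being
      vacuous.\<close>
    show "\<exists>\<W> :: 'a mpoly set set. sym_power_decomposition n k \<W>" by (rule decomposition_exists)
    show "pm.dim (filiform_center_hom n k :: 'a mpoly set) = card \<W>"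
      if "sym_power_decomposition n k \<W>" for \<W> :: "'a mpoly set set"
      unfolding dim_filiform_center_hom by (rule dim_kernel_eq_card[OF that])
    show "pm.dim (filiform_center_hom n k :: 'a mpoly set) =
        card {M :: nat multiset. size M = k \<and> (\<forall>b\<in>#M. b \<le> n) \<and> sum_mset M = k * n div 2}"
      by (simp only: dim box_partitions_def)
    show "pm.dim (filiform_center_hom n k :: 'a mpoly set) = pm.dim (filiform_center_hom k n :: 'a mpoly set)"
      by (simp only: dim card_box_partitions_commute[of k n] mult.commute[of k n])
  qed
qed

end
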